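(* Suppose that $\bar x$ is a locally optimal solution to the problem $\mathrm{P}(0,0)$ (i.e. $\min f(x)$ s.t. $G(x)\in\mathcal{K}$), where $\mathcal{K}$ is $C^2$-cone reducible, and that the Robinson constraint qualification (RCQ) holds at $\bar x$. Let $\bar y\in M(\bar x,0,0)\ne\emptyset$ and $\bar z=G(\bar x)+\bar y$. Consider the following statements: (i) the KKT point $(\bar x,\bar y)$ is a strongly regular solution to the KKT system with $(a,b)=(0,0)$; (ii) the mapping $\Psi^{-1}$ has the Aubin property at the origin for $(\bar x,\bar z)$; (iii) the KKT solution mapping $S_{\mathrm{KKT}}$ has the Aubin property at the origin for $(\bar x,\bar y)$; (iv) the constraint non-degeneracy holds at $\bar x$ and the second order sufficient condition (SOSC) holds at $\bar x$ for $\mathrm{P}(0,0)$; (v) the strict Robinson constraint qualification (SRCQ) holds at $\bar x$ with respect to $\bar y$ and the SOSC holds at $\bar x$ for $\mathrm{P}(0,0)$; (vi) the KKT solution mapping $S_{\mathrm{KKT}}$ is robustly isolated calm at the origin for $(\bar x,\bar y)$; (vii) the mapping $F^{-1}$ is isolated calm at the origin for $(\bar x,\bar y)$. Then $$(i)\Longrightarrow(ii)\Longleftrightarrow(iii)\Longrightarrow(iv)\Longrightarrow(v)\Longleftrightarrow(vi)\Longleftrightarrow(vii).$$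
   Context: Setting. $\mathcal{X},\mathcal{Y}$ are finite dimensional real Euclidean spaces, $f:\mathcal{X}\to\mathbb{R}$ and $G:\mathcal{X}\to\mathcal{Y}$ are twice continuously differentiable, and $\mathcal{K}\subset\mathcal{Y}$ is a nonempty closed convex set. For $(a,b)\in\mathcal{X}\times\mathcal{Y}$, $\mathrm{P}(a,b)$ is the problem $\min f(x)-\langle a,x\rangle$ s.t. $G(x)+b\in\mathcal{K}$. $C^2$-cone reducibility (standing assumption on $\mathcal{K}$): for every $\overline A\in\mathcal{K}$ there exist an open neighborhood $\mathcal{W}\subset\mathcal{Y}$ of $\overline A$, a pointed closed convex cone $\mathcal{Q}$ (pointed: its lineality space is $\{0\}$) in a finite dimensional space $\mathcal{Z}$, and a twice continuously differentiable $\Xi:\mathcal{W}\to\mathcal{Z}$ such that $\Xi(\overline A)=0$, $\Xi'(\overline A):\mathcal{Y}\to\mathcal{Z}$ is onto, and $\mathcal{K}\cap\mathcal{W}=\{A\in\mathcal{W}\mid\Xi(A)\in\mathcal{Q}\}$. KKT system. $L(x;y):=f(x)+\langle y,G(x)\rangle$, so $\nabla_xL(x;y)=\nabla f(x)+G'(x)^*y$; $\nabla^2_{xx}L(\bar x;y)$ is the Hessian of $L(\cdot;y)$ at $\bar x$. $\mathcal{N}_{\mathcal{K}}(z)$ is the normal cone of convex analysis; $\sigma(y,Z):=\sup\{\langle y,z\rangle\mid z\in Z\}$ is the support function. The KKT system for $(a,b)$ is $a=\nabla_xL(x;y)$, $b\in-G(x)+\partial\sigma(y,\mathcal{K})$ (subdifferential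 in $y$), the second relation being equivalent to $y\in\mathcal{N}_{\mathcal{K}}(G(x)+b)$. $S_{\mathrm{KKT}}(a,b)$ is its set of solutions $(x,y)$, and $M(x,a,b):=\{y\mid(x,y)\in S_{\mathrm{KKT}}(a,b)\}$. Strong regularity (Robinson): $(\bar x,\bar y)\in S_{\mathrm{KKT}}(0,0)$ is a strongly regular solution of the KKT system if there are neighborhoods $\mathcal{U}$ of the origin of $\mathcal{X}\times\mathcal{Y}$ and $\mathcal{V}$ of $(\bar x,\bar y)$ such that for every $(\delta_1,\delta_2)\in\mathcal{U}$ the linearized system $\delta_1=\nabla_xL(\bar x;\bar y)+\nabla^2_{xx}L(\bar x;\bar y)(x-\bar x)+G'(\bar x)^*(y-\bar y)$, $\delta_2\in-G(\bar x)-G'(\bar x)(x-\bar x)+\partial\sigma(y,\mathcal{K})$ has a unique solution $(x,y)$ in $\mathcal{V}$, and this solution is a Lipschitz continuous function of $(\delta_1,\delta_2)\in\mathcal{U}$. Mappings. With $\Pi_{\mathcal{K}}$ the metric projection onto $\mathcal{K}$: Robinson's normal mapping $\Psi:\mathcal{X}\times\mathcal{Y}\to\mathcal{X}\times\mathcal{Y}$ is $\Psi(x,z):=\big(\nabla f(x)+G'(x)^*(z-\Pi_{\mathcal{K}}(z)),\ G(x)-\Pi_{\mathcal{K}}(z)\big)$, and the natural mapping is $F(x,y):=\big(\nabla f(x)+G'(x)^*y,\ G(x)-\Pi_{\mathcal{K}}(G(x)+y)\big)$; $\Psi^{-1},F^{-1}$ are the set-valued inverses. Tangent sets. $\mathcal{T}_{\mathcal{K}}(z):=\{d\mid\exists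 z^k\to z,\ z^k\in\mathcal{K},\ t^k\downarrow0,\ (z^k-z)/t^k\to d\}$; $\mathrm{lin}(\mathcal{T}_{\mathcal{K}}(z))$ is the largest linear subspace contained in it. Second order tangent set: $\mathcal{T}^2_{\mathcal{K}}(z,h):=\{w\in\mathcal{Y}\mid\exists t_k\downarrow0\text{ such that }\mathrm{dist}(z+t_kh+\tfrac12t_k^2w,\mathcal{K})=o(t_k^2)\}$. $\bar y^\perp:=\{z\mid\langle z,\bar y\rangle=0\}$. Conditions at a feasible point $\bar x$ of $\mathrm{P}(0,0)$. RCQ: $G'(\bar x)\mathcal{X}+\mathcal{T}_{\mathcal{K}}(G(\bar x))=\mathcal{Y}$. SRCQ with respect to $\bar y\in M(\bar x,0,0)$: $G'(\bar x)\mathcal{X}+\mathcal{T}_{\mathcal{K}}(G(\bar x))\cap\bar y^\perp=\mathcal{Y}$. Constraint non-degeneracy: $G'(\bar x)\mathcal{X}+\mathrm{lin}(\mathcal{T}_{\mathcal{K}}(G(\bar x)))=\mathcal{Y}$. Critical cone: $\mathcal{C}(\bar x):=\{d\in\mathcal{X}\mid G'(\bar x)d\in\mathcal{T}_{\mathcal{K}}(G(\bar x)),\ f'(\bar x)d\le0\}$. SOSC: $\sup_{y\in M(\bar x,0,0)}\{\langle d,\nabla^2_{xx}L(\bar x;y)d\rangle-\sigma(y,\mathcal{T}^2_{\mathcal{K}}(G(\bar x),G'(\bar x)d))\}>0$ for all $d\in\mathcal{C}(\bar x)\setminus\{0\}$. Set-valued notions. For $\Theta:\mathcal{E}\rightrightarrows\mathcal{F}$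 between finite dimensional Euclidean spaces, $\bar q\in\Theta(\bar p)$, and $\mathbb{B}_{\mathcal{F}}$ the unit ball of $\mathcal{F}$: $\Theta$ is isolated calm at $\bar p$ for $\bar q$ if there are $\kappa>0$ and open neighborhoods $\mathcal{U}$ of $\bar p$, $\mathcal{V}$ of $\bar q$ with $\Theta(p)\cap\mathcal{V}\subset\{\bar q\}+\kappa\|p-\bar p\|\mathbb{B}_{\mathcal{F}}$ for all $p\in\mathcal{U}$; robustly isolated calm if in addition, for these neighborhoods, $\Theta(p)\cap\mathcal{V}\neq\emptyset$ for every $p\in\mathcal{U}$; $\Theta$ has the Aubin property at $\bar p$ for $\bar q$ if there are $\kappa>0$ and such $\mathcal{U},\mathcal{V}$ with $\Theta(p)\cap\mathcal{V}\subset\Theta(p')+\kappa\|p-p'\|\mathbb{B}_{\mathcal{F}}$ for all $p,p'\in\mathcal{U}$. *)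

theory Defs
  imports "HOL-Analysis.Analysis" "HOL-Library.Landau_Symbols" "HOL-Library.Set_Algebras"
begin

definition C2_on :: "'a::real_normed_vector set \<Rightarrow> ('a \<Rightarrow> 'b::real_normed_vector) \<Rightarrow> bool" where
  "C2_on S g \<longleftrightarrow>
     (\<exists>(g' :: 'a \<Rightarrow> 'a \<Rightarrow>\<^sub>L 'b) (g'' :: 'a \<Rightarrow> 'a \<Rightarrow>\<^sub>L 'a \<Rightarrow>\<^sub>L 'b).
        open S \<and>
        (\<forall>x\<in>S. (g has_derivative blinfun_apply (g' x)) (at x)) \<and>
        (\<forall>x\<in>S. (g' has_derivative blinfun_apply (g'' x)) (at x)) \<and>
        continuous_on S g'')"

lemma C2_on_compose_linear:
  assumes "C2_on S g" and "linear (L :: 'b::euclidean_space \<Rightarrow> 'c::euclidean_space)"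
  shows "C2_on S (\<lambda>x. L (g x))"
proof -
  interpret L: bounded_linear L
    using assms(2) by (simp add: linear_conv_bounded_linear)
  define Lb where "Lb = Blinfun L"
  have Lb: "blinfun_apply Lb = L"
    by (simp add: Lb_def bounded_linear_Blinfun_apply L.bounded_linear_axioms)
  obtain g' g'' where g: "open S"
      "\<And>x. x \<in> S \<Longrightarrow> (g has_derivative blinfun_apply (g' x)) (at x)"
      "\<And>x. x \<in> S \<Longrightarrow> (g' has_derivative blinfun_apply (g'' x)) (at x)"
      "continuous_on S g''"
    using assms(1) by (auto simp: C2_on_def)
  interpret P: bounded_linear "\<lambda>h. Lb o\<^sub>L h"
    by (rule bounded_bilinear.bounded_linear_right[OF bounded_bilinear_blinfun_compose])
  define PL where "PL = Blinfun (\<lambda>h. Lb o\<^sub>L (h :: 'a \<Rightarrow>\<^sub>L 'b))"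
  have PL: "blinfun_apply PL = (\<lambda>h. Lb o\<^sub>L h)"
    by (simp add: PL_def bounded_linear_Blinfun_apply P.bounded_linear_axioms)
  show ?thesis
    unfolding C2_on_def
  proof (intro exI conjI ballI)
    show "open S" by fact
    show "((\<lambda>x. L (g x)) has_derivative blinfun_apply (Lb o\<^sub>L g' x)) (at x)" if "x \<in> S" for x
      using L.has_derivative[OF g(2)[OF that]] by (simp add: Lb blinfun_compose.rep_eq o_def)
    show "((\<lambda>x. Lb o\<^sub>L g' x) has_derivative blinfun_apply (PL o\<^sub>L g'' x)) (at x)" if "x \<in> S" for x
      using P.has_derivative[OF g(3)[OF that]] by (simp add: PL blinfun_compose.rep_eq o_def)
    show "continuous_on S (\<lambda>x. PL o\<^sub>L g'' x)"
      by (intro continuous_intros g(4))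
  qed
qed

abbreviation fderiv :: "('a::real_normed_vector \<Rightarrow> 'b::real_normed_vector) \<Rightarrow> 'a \<Rightarrow> 'a \<Rightarrow> 'b" where
  "fderiv g x \<equiv> frechet_derivative g (at x)"

lemma C2_on_has_fderiv:
  assumes "C2_on S g" "x \<in> S"
  shows "(g has_derivative fderiv g x) (at x)"
  using assms by (metis C2_on_def differentiable_def frechet_derivative_works)

definition gradient :: "('a::euclidean_space \<Rightarrow> real) \<Rightarrow> 'a \<Rightarrow> 'a" where
  "gradient g x = (THE v. GDERIV g x :> v)"

lemma gradient_eq: "GDERIV g x :> v \<Longrightarrow> gradient g x = v" for g :: "'a::euclidean_space \<Rightarrow> real"
  unfolding gradient_def
proof (rule the_equality)
  fix w assume a: "GDERIV g x :> v" "GDERIV g x :> w"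
  then have "(\<lambda>h. h \<bullet> v) = (\<lambda>h. h \<bullet> w)"
    unfolding gderiv_def by (rule has_derivative_unique)
  then have "\<forall>h. h \<bullet> w = h \<bullet> v"
    by (simp add: fun_eq_iff)
  then show "w = v"
    by (simp only: vector_eq_ldot)
qed

definition hessian :: "('a::euclidean_space \<Rightarrow> real) \<Rightarrow> 'a \<Rightarrow> 'a \<Rightarrow> 'a" where
  "hessian g x = fderiv (gradient g) x"

definition tangent_cone :: "'a::euclidean_space set \<Rightarrow> 'a \<Rightarrow> 'a set" where
  "tangent_cone K z =
     {d. \<exists>(w :: nat \<Rightarrow> 'a) (t :: nat \<Rightarrow> real).
           (\<forall>k. w k \<in> K) \<and> w \<longlonglongrightarrow> z \<and> (\<forall>k. t k > 0) \<and> t \<longlonglongrightarrow> 0 \<and>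
           (\<lambda>k. (w k - z) /\<^sub>R t k) \<longlonglongrightarrow> d}"

definition second_order_tangent_set :: "'a::euclidean_space set \<Rightarrow> 'a \<Rightarrow> 'a \<Rightarrow> 'a set" where
  "second_order_tangent_set K z h =
     {w. \<exists>t :: nat \<Rightarrow> real. (\<forall>k. t k > 0) \<and> t \<longlonglongrightarrow> 0 \<and>
           (\<lambda>k. infdist (z + t k *\<^sub>R h + (1/2 * (t k)\<^sup>2) *\<^sub>R w) K) \<in> o(\<lambda>k. (t k)\<^sup>2)}"

text \<open>For a convex cone the union of all linear subspaces contained in it is again a subspace,
  hence it is the largest one.\<close>

definition lineality_space :: "'a::euclidean_space set \<Rightarrow> 'a set" where
  "lineality_space C = \<Union>{S. subspace S \<and> S \<subseteq> C}"

text \<open>Extended-real valued, so that the supremum over an unbounded set is \<open>\<infinity>\<close>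
  and the supremum over the empty set is \<open>-\<infinity>\<close>.\<close>

definition support_fun :: "'a::euclidean_space \<Rightarrow> 'a set \<Rightarrow> ereal" where
  "support_fun y Z = (SUP z\<in>Z. ereal (y \<bullet> z))"

definition subdifferential :: "('a::euclidean_space \<Rightarrow> ereal) \<Rightarrow> 'a \<Rightarrow> 'a set" where
  "subdifferential \<phi> y =
     {v. \<bar>\<phi> y\<bar> \<noteq> \<infinity> \<and> (\<forall>y'. \<phi> y + ereal (v \<bullet> (y' - y)) \<le> \<phi> y')}"

lemma subdifferential_support_fun_iff:
  assumes "closed K" "convex K" "K \<noteq> {}"
  shows "v \<in> subdifferential (\<lambda>v. support_fun v K) y \<longleftrightarrow> v \<in> K \<and> (\<forall>k\<in>K. y \<bullet> (k - v) \<le> 0)"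
proof
  assume v: "v \<in> K \<and> (\<forall>k\<in>K. y \<bullet> (k - v) \<le> 0)"
  have "support_fun y K = ereal (y \<bullet> v)"
    unfolding support_fun_def
    by (rule antisym) (use v in \<open>auto intro!: SUP_least SUP_upper simp: inner_diff_right\<close>)
  moreover have "ereal (y' \<bullet> v) \<le> support_fun y' K" for y'
    unfolding support_fun_def using v by (auto intro!: SUP_upper)
  ultimately show "v \<in> subdifferential (\<lambda>v. support_fun v K) y"
    by (auto simp: subdifferential_def inner_diff_right inner_commute)
next
  assume v: "v \<in> subdifferential (\<lambda>v. support_fun v K) y"
  then obtain s where s: "support_fun y K = ereal s"
    by (auto simp: subdifferential_def)
  have sub: "ereal (s + v \<bullet> (y' - y)) \<le> support_fun y' K" for y'
    using v s by (auto simp: subdifferential_def)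
  have ub: "y \<bullet> k \<le> s" if "k \<in> K" for k
    using s that SUP_upper[of k K "\<lambda>z. ereal (y \<bullet> z)"] by (simp add: support_fun_def)
  have sle: "s \<le> v \<bullet> y"
    using sub[of 0] assms(3) by (simp add: support_fun_def)
  have "v \<in> K"
  proof (rule ccontr)
    assume "v \<notin> K"
    then obtain a b where ab: "a \<bullet> v < b" "\<And>k. k \<in> K \<Longrightarrow> a \<bullet> k > b"
      using separating_hyperplane_closed_point[OF assms(2,1)] by metis
    have "support_fun (y - a) K \<le> ereal (s - b)"
      unfolding support_fun_def
      by (rule SUP_least) (use ub ab(2) in \<open>force simp: inner_diff_left intro: diff_mono less_imp_le\<close>)
    with sub[of "y - a"] ab(1) have "ereal (s - v \<bullet> a) \<le> ereal (s - b)" 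
      by (metis (no_types, lifting) add_diff_cancel_left' add_uminus_conv_diff diff_diff_eq2 diff_self inner_minus_right minus_diff_eq order_trans uminus_add_conv_diff)
    then show False using ab(1) by (simp add: inner_commute)
  qed
  then show "v \<in> K \<and> (\<forall>k\<in>K. y \<bullet> (k - v) \<le> 0)"
    using ub sle by (force simp: inner_diff_right inner_commute)
qed

text \<open>The reduction map \<open>\<Xi>\<close> takes values in a finite dimensional space \<open>Z\<close>, which may depend
  on the point \<open>A\<close>. Since the derivative of \<open>\<Xi>\<close> at \<open>A\<close> maps the ambient space onto \<open>Z\<close>, the
  dimension of \<open>Z\<close> is at most that of the ambient space, so that \<open>Z\<close> can be represented as a
  linear subspace of the latter; \<open>cone_reducible_at_transfer\<close> below shows that nothing is lost.
  The case \<open>Z = {0}\<close> is needed for interior points of \<open>K\<close>.\<close>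

definition cone_reducible_at :: "'a::euclidean_space set \<Rightarrow> 'a \<Rightarrow> bool" where
  "cone_reducible_at K A \<longleftrightarrow>
     (\<exists>W Z Q (\<Xi> :: 'a \<Rightarrow> 'a).
        open W \<and> A \<in> W \<and>
        subspace Z \<and> Q \<subseteq> Z \<and>
        closed Q \<and> convex_cone Q \<and> lineality_space Q = {0} \<and>
        \<Xi> ` W \<subseteq> Z \<and> C2_on W \<Xi> \<and>
        \<Xi> A = 0 \<and> range (fderiv \<Xi> A) = Z \<and>
        K \<inter> W = {B \<in> W. \<Xi> B \<in> Q})"

lemma cone_reducible_at_transfer:
  fixes K :: "'a::euclidean_space set" and \<Xi> :: "'a \<Rightarrow> 'b::euclidean_space"
  assumes "open W" "A \<in> W" "subspace Z" "Q \<subseteq> Z" "closed Q" "convex_cone Q"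
    and pointed: "lineality_space Q = {0}"
    and "\<Xi> ` W \<subseteq> Z" "C2_on W \<Xi>" "\<Xi> A = 0" and onto: "range (fderiv \<Xi> A) = Z"
    and K: "K \<inter> W = {B \<in> W. \<Xi> B \<in> Q}"
  shows "cone_reducible_at K A"
proof -
  have D: "(\<Xi> has_derivative fderiv \<Xi> A) (at A)"
    using C2_on_has_fderiv assms by blast
  have "dim Z \<le> dim (UNIV :: 'a set)"
    using dim_image_le[OF has_derivative_linear[OF D], of UNIV] onto by simp
  then obtain L :: "'b \<Rightarrow> 'a" where "linear L" and iso: "\<And>z. z \<in> Z \<Longrightarrow> norm (L z) = norm z"
    using isometry_subset_subspace[OF \<open>subspace Z\<close> subspace_UNIV] by metis
  interpret L: linear L by fact
  have bl: "bounded_linear L"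
    using \<open>linear L\<close> by (simp add: linear_conv_bounded_linear)
  have inj: "inj_on L Z"
    by (rule inj_onI) (metis L.diff iso assms(3) eq_iff_diff_eq_0 norm_eq_zero subspace_diff)
  have "lineality_space (L ` Q) = {0}"
  proof
    show "{0} \<subseteq> lineality_space (L ` Q)"
    proof -
      have "0 \<in> Q" using pointed by (auto simp: lineality_space_def)
      then have "{0} \<subseteq> L ` Q" using L.zero by force
      then show ?thesis unfolding lineality_space_def using subspace_single_0 by blast
    qed
    show "lineality_space (L ` Q) \<subseteq> {0}"
    proof (clarsimp simp: lineality_space_def)
      fix S x assume S: "x \<in> S" "subspace S" "S \<subseteq> L ` Q"
      define S' where "S' = {z \<in> Z. L z \<in> S}"
      have "subspace S'"
        using S(2) assms(3) unfolding S'_def subspace_def by (auto simp: L.zero L.add L.scale)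
      moreover have "S' \<subseteq> Q"
        using S(3) inj \<open>Q \<subseteq> Z\<close> unfolding S'_def inj_on_def by blast
      ultimately have "S' \<subseteq> {0}" using pointed by (auto simp: lineality_space_def)
      moreover obtain q where "q \<in> Q" "x = L q" using S by blast
      ultimately show "x = 0" using S(1) \<open>Q \<subseteq> Z\<close> L.zero by (auto simp: S'_def)
    qed
  qed
  moreover have "closed (L ` Q)"
  proof -
    obtain g where g: "linear g" "\<And>z. z \<in> Z \<Longrightarrow> g (L z) = z"
      using linear_exists_left_inverse_on[OF \<open>linear L\<close> \<open>subspace Z\<close> inj] by metis
    have "L ` Q = L ` Z \<inter> g -` Q"
      using \<open>Q \<subseteq> Z\<close> g(2) by force
    moreover have "closed (g -` Q)"
      using \<open>closed Q\<close> linear_continuous_on[of g UNIV] g(1)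
      by (simp add: closed_vimage linear_conv_bounded_linear)
    moreover have "closed (L ` Z)"
      by (intro closed_subspace linear_subspace_image \<open>linear L\<close> \<open>subspace Z\<close>)
    ultimately show ?thesis by auto
  qed
  moreover have "convex_cone (L ` Q)"
    using convex_cone_linear_image \<open>convex_cone Q\<close> \<open>linear L\<close> by blast
  moreover have "range (fderiv (\<lambda>x. L (\<Xi> x)) A) = L ` Z"
  proof -
    have "fderiv (\<lambda>x. L (\<Xi> x)) A = (\<lambda>h. L (fderiv \<Xi> A h))"
      by (rule frechet_derivative_at[symmetric]) (rule bounded_linear.has_derivative[OF bl D])
    then show ?thesis using onto by auto
  qed
  moreover have "K \<inter> W = {B \<in> W. L (\<Xi> B) \<in> L ` Q}"
    using K assms(4,8) inj unfolding inj_on_def by blast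
  moreover have "(\<lambda>x. L (\<Xi> x)) ` W \<subseteq> L ` Z" using assms(8) by blast
  moreover have "L ` Q \<subseteq> L ` Z" using assms(4) by blast
  moreover have "subspace (L ` Z)" "C2_on W (\<lambda>x. L (\<Xi> x))" "L (\<Xi> A) = 0"
    using linear_subspace_image[OF \<open>linear L\<close> assms(3)] C2_on_compose_linear[OF assms(9) \<open>linear L\<close>]
      L.zero assms(10) by simp_all
  ultimately show ?thesis
    unfolding cone_reducible_at_def using assms(1,2)
    by (intro exI[of _ W] exI[of _ "L ` Z"] exI[of _ "L ` Q"] exI[of _ "\<lambda>x. L (\<Xi> x)"] conjI)
qed

definition C2_cone_reducible :: "'a::euclidean_space set \<Rightarrow> bool" where
  "C2_cone_reducible K \<longleftrightarrow> (\<forall>A\<in>K. cone_reducible_at K A)"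

definition feasible ::
  "('x::euclidean_space \<Rightarrow> 'y::euclidean_space) \<Rightarrow> 'y set \<Rightarrow> 'y \<Rightarrow> 'x set" where
  "feasible G K b = {x. G x + b \<in> K}"

definition locally_optimal ::
  "('x::euclidean_space \<Rightarrow> real) \<Rightarrow> ('x \<Rightarrow> 'y::euclidean_space) \<Rightarrow> 'y set \<Rightarrow> 'x \<Rightarrow> 'y \<Rightarrow> 'x \<Rightarrow> bool" where
  "locally_optimal f G K a b x \<longleftrightarrow>
     x \<in> feasible G K b \<and>
     (\<exists>\<epsilon>>0. \<forall>u \<in> feasible G K b \<inter> ball x \<epsilon>. f x - a \<bullet> x \<le> f u - a \<bullet> u)"

definition lagrangian ::
  "('x::euclidean_space \<Rightarrow> real) \<Rightarrow> ('x \<Rightarrow> 'y::euclidean_space) \<Rightarrow> 'x \<Rightarrow> 'y \<Rightarrow> real" where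
  "lagrangian f G x y = f x + y \<bullet> G x"

definition grad_L ::
  "('x::euclidean_space \<Rightarrow> real) \<Rightarrow> ('x \<Rightarrow> 'y::euclidean_space) \<Rightarrow> 'x \<Rightarrow> 'y \<Rightarrow> 'x" where
  "grad_L f G x y = gradient (\<lambda>u. lagrangian f G u y) x"

lemma grad_L_eq:
  assumes "C2_on UNIV f" "C2_on UNIV G"
  shows "grad_L f G x y = gradient f x + adjoint (fderiv G x) y"
proof -
  have f: "(f has_derivative fderiv f x) (at x)" and G: "(G has_derivative fderiv G x) (at x)"
    using assms C2_on_has_fderiv by auto
  have lf: "linear (fderiv f x)" and lG: "linear (fderiv G x)" using f G has_derivative_linear by auto
  have e: "fderiv f x = (\<lambda>h. h \<bullet> adjoint (fderiv f x) 1)"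
    using adjoint_works[OF lf, of _ 1] by (auto simp: fun_eq_iff)
  have g: "gradient f x = adjoint (fderiv f x) 1"
    by (rule gradient_eq) (use f e in \<open>simp add: gderiv_def\<close>)
  show ?thesis
    unfolding grad_L_def lagrangian_def
  proof (rule gradient_eq)
    show "GDERIV (\<lambda>u. f u + y \<bullet> G u) x :> gradient f x + adjoint (fderiv G x) y"
      unfolding gderiv_def g
      apply (rule has_derivative_eq_rhs)
       apply (rule derivative_intros f G)+
      using adjoint_works[OF lG, of _ y] e
      by (auto simp: fun_eq_iff inner_add_right inner_commute)
  qed
qed

definition hess_L ::
  "('x::euclidean_space \<Rightarrow> real) \<Rightarrow> ('x \<Rightarrow> 'y::euclidean_space) \<Rightarrow> 'x \<Rightarrow> 'y \<Rightarrow> 'x \<Rightarrow> 'x" where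
  "hess_L f G x y = hessian (\<lambda>u. lagrangian f G u y) x"

definition S_KKT ::
  "('x::euclidean_space \<Rightarrow> real) \<Rightarrow> ('x \<Rightarrow> 'y::euclidean_space) \<Rightarrow> 'y set \<Rightarrow> 'x \<times> 'y \<Rightarrow> ('x \<times> 'y) set" where
  "S_KKT f G K = (\<lambda>(a, b). {(x, y).
     a = grad_L f G x y \<and>
     b \<in> {- G x} + subdifferential (\<lambda>v. support_fun v K) y})"

definition multipliers ::
  "('x::euclidean_space \<Rightarrow> real) \<Rightarrow> ('x \<Rightarrow> 'y::euclidean_space) \<Rightarrow> 'y set \<Rightarrow> 'x \<Rightarrow> 'x \<Rightarrow> 'y \<Rightarrow> 'y set" where
  "multipliers f G K x a b = {y. (x, y) \<in> S_KKT f G K (a, b)}"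

definition linearized_KKT ::
  "('x::euclidean_space \<Rightarrow> real) \<Rightarrow> ('x \<Rightarrow> 'y::euclidean_space) \<Rightarrow> 'y set \<Rightarrow> 'x \<Rightarrow> 'y
     \<Rightarrow> 'x \<times> 'y \<Rightarrow> ('x \<times> 'y) set" where
  "linearized_KKT f G K xb yb = (\<lambda>(\<delta>1, \<delta>2). {(x, y).
     \<delta>1 = grad_L f G xb yb + hess_L f G xb yb (x - xb) + adjoint (fderiv G xb) (y - yb) \<and>
     \<delta>2 \<in> {- G xb - fderiv G xb (x - xb)} + subdifferential (\<lambda>v. support_fun v K) y})"

definition strongly_regular ::
  "('x::euclidean_space \<Rightarrow> real) \<Rightarrow> ('x \<Rightarrow> 'y::euclidean_space) \<Rightarrow> 'y set \<Rightarrow> 'x \<Rightarrow> 'y \<Rightarrow> bool" where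
  "strongly_regular f G K xb yb \<longleftrightarrow>
     (xb, yb) \<in> S_KKT f G K (0, 0) \<and>
     (\<exists>U V (s :: 'x \<times> 'y \<Rightarrow> 'x \<times> 'y) C.
        (0, 0) \<in> interior U \<and> (xb, yb) \<in> interior V \<and>
        (\<forall>\<delta>\<in>U. linearized_KKT f G K xb yb \<delta> \<inter> V = {s \<delta>}) \<and>
        C-lipschitz_on U s)"

definition normal_mapping ::
  "('x::euclidean_space \<Rightarrow> real) \<Rightarrow> ('x \<Rightarrow> 'y::euclidean_space) \<Rightarrow> 'y set \<Rightarrow> 'x \<times> 'y \<Rightarrow> 'x \<times> 'y" where
  "normal_mapping f G K = (\<lambda>(x, z).
     (gradient f x + adjoint (fderiv G x) (z - closest_point K z),
      G x - closest_point K z))"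

definition natural_mapping ::
  "('x::euclidean_space \<Rightarrow> real) \<Rightarrow> ('x \<Rightarrow> 'y::euclidean_space) \<Rightarrow> 'y set \<Rightarrow> 'x \<times> 'y \<Rightarrow> 'x \<times> 'y" where
  "natural_mapping f G K = (\<lambda>(x, y).
     (gradient f x + adjoint (fderiv G x) y,
      G x - closest_point K (G x + y)))"

definition set_inverse :: "('p \<Rightarrow> 'q) \<Rightarrow> 'q \<Rightarrow> 'p set" where
  "set_inverse h q = h -` {q}"

definition RCQ ::
  "('x::euclidean_space \<Rightarrow> 'y::euclidean_space) \<Rightarrow> 'y set \<Rightarrow> 'x \<Rightarrow> bool" where
  "RCQ G K x \<longleftrightarrow> range (fderiv G x) + tangent_cone K (G x) = UNIV"

definition SRCQ ::
  "('x::euclidean_space \<Rightarrow> 'y::euclidean_space) \<Rightarrow> 'y set \<Rightarrow> 'x \<Rightarrow> 'y \<Rightarrow> bool" where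
  "SRCQ G K x y \<longleftrightarrow>
     range (fderiv G x) + (tangent_cone K (G x) \<inter> {z. z \<bullet> y = 0}) = UNIV"

definition constraint_nondegenerate ::
  "('x::euclidean_space \<Rightarrow> 'y::euclidean_space) \<Rightarrow> 'y set \<Rightarrow> 'x \<Rightarrow> bool" where
  "constraint_nondegenerate G K x \<longleftrightarrow>
     range (fderiv G x) + lineality_space (tangent_cone K (G x)) = UNIV"

definition critical_cone ::
  "('x::euclidean_space \<Rightarrow> real) \<Rightarrow> ('x \<Rightarrow> 'y::euclidean_space) \<Rightarrow> 'y set \<Rightarrow> 'x \<Rightarrow> 'x set" where
  "critical_cone f G K x = {d. fderiv G x d \<in> tangent_cone K (G x) \<and> fderiv f x d \<le> 0}"

definition SOSC ::
  "('x::euclidean_space \<Rightarrow> real) \<Rightarrow> ('x \<Rightarrow> 'y::euclidean_space) \<Rightarrow> 'y set \<Rightarrow> 'x \<Rightarrow> bool" where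
  "SOSC f G K x \<longleftrightarrow>
     (\<forall>d \<in> critical_cone f G K x - {0}.
        (SUP y \<in> multipliers f G K x 0 0.
           ereal (d \<bullet> hess_L f G x y d)
           - support_fun y (second_order_tangent_set K (G x) (fderiv G x d))) > 0)"

definition isolated_calm_on ::
  "('p::euclidean_space \<Rightarrow> 'q::euclidean_space set) \<Rightarrow> 'p \<Rightarrow> 'q \<Rightarrow> real \<Rightarrow> 'p set \<Rightarrow> 'q set \<Rightarrow> bool" where
  "isolated_calm_on \<Theta> pb qb \<kappa> U V \<longleftrightarrow>
     \<kappa> > 0 \<and> open U \<and> pb \<in> U \<and> open V \<and> qb \<in> V \<and>
     (\<forall>p\<in>U. \<Theta> p \<inter> V \<subseteq> {qb} + cball 0 (\<kappa> * norm (p - pb)))"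

definition isolated_calm ::
  "('p::euclidean_space \<Rightarrow> 'q::euclidean_space set) \<Rightarrow> 'p \<Rightarrow> 'q \<Rightarrow> bool" where
  "isolated_calm \<Theta> pb qb \<longleftrightarrow>
     qb \<in> \<Theta> pb \<and> (\<exists>\<kappa> U V. isolated_calm_on \<Theta> pb qb \<kappa> U V)"

definition robustly_isolated_calm ::
  "('p::euclidean_space \<Rightarrow> 'q::euclidean_space set) \<Rightarrow> 'p \<Rightarrow> 'q \<Rightarrow> bool" where
  "robustly_isolated_calm \<Theta> pb qb \<longleftrightarrow>
     qb \<in> \<Theta> pb \<and>
     (\<exists>\<kappa> U V. isolated_calm_on \<Theta> pb qb \<kappa> U V \<and> (\<forall>p\<in>U. \<Theta> p \<inter> V \<noteq> {}))"

definition Aubin_property ::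
  "('p::euclidean_space \<Rightarrow> 'q::euclidean_space set) \<Rightarrow> 'p \<Rightarrow> 'q \<Rightarrow> bool" where
  "Aubin_property \<Theta> pb qb \<longleftrightarrow>
     qb \<in> \<Theta> pb \<and>
     (\<exists>\<kappa> U V. \<kappa> > 0 \<and> open U \<and> pb \<in> U \<and> open V \<and> qb \<in> V \<and>
        (\<forall>p\<in>U. \<forall>p'\<in>U. \<Theta> p \<inter> V \<subseteq> \<Theta> p' + cball 0 (\<kappa> * norm (p - p'))))"

end

theory Submission
  imports Defs
begin

text \<open>Write \<open>B\<close> for the derivative of \<open>G\<close> at the solution \<open>xb\<close>, and \<open>H\<close> for the Hessian of the
Lagrangian at \<open>(xb, yb)\<close>. Cone reducibility provides a change of variables \<open>\<Phi>\<close> of the image space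
around \<open>G xb\<close> that has the identity as its derivative there and that turns \<open>K\<close> into a closed convex
cone \<open>Q\<close> (\<open>cone_reducible_at_chart\<close>). The curved set then enters only through the second derivative
of \<open>\<Phi>\<close>: \<open>Q\<close> is the tangent cone of \<open>K\<close> at \<open>G xb\<close>, its polar is the normal cone, and the support
function of the second order tangent set in a critical direction \<open>h\<close> is \<open>- yb \<bullet> \<Phi>'' h h\<close>. With
\<open>C = Q \<inter> yb\<^sup>\<bottom>\<close>, the graph of the normal cone mapping of \<open>K\<close> has at \<open>(G xb, yb)\<close> exactly the
tangent directions \<open>(h, \<Phi>''(h)\<^sup>* yb + \<nu>)\<close> with \<open>h \<in> C\<close> and \<open>\<nu>\<close> normal to \<open>C\<close> at \<open>h\<close>
(\<open>normal_cone_graph_derivative\<close>, \<open>normal_cone_graph_realisation\<close>).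

Consequently the directions in which KKT points can leave \<open>(xb, yb)\<close> at a speed \<open>t\<close> while the
parameters are \<open>o(t)\<close> are described by the KKT pairs \<open>(d, \<nu>)\<close> of the quadratic problem of minimising
\<open>(Hred d \<bullet> d) / 2\<close> subject to \<open>B d \<in> C\<close>, where \<open>Hred\<close> is the Hessian of \<open>f + yb \<bullet> (\<Phi> \<circ> G)\<close>. SRCQ
says that \<open>B\<^sup>* \<nu> = 0\<close> has only the solution \<open>\<nu> = 0\<close> in the polar of \<open>C\<close>; it makes the multiplier
unique, and then SOSC says that the quadratic form is positive on the nonzero feasible \<open>d\<close>.

Isolated calmness means that only the zero pair exists. Under SRCQ and SOSC a pair satisfies
\<open>Hred d \<bullet> d = 0\<close>, hence \<open>d = 0\<close> and \<open>\<nu> = 0\<close>. Conversely every \<open>\<nu>\<close> violating SRCQ gives the pair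
\<open>(0, \<nu>)\<close>; and since local optimality makes the form nonnegative (\<open>second_order_necessary\<close>), a nonzero
feasible \<open>d\<close> at which it vanishes minimises it, so that the multiplier rule completes \<open>d\<close> to a pair.
Solvability of the perturbed systems is not an extra demand: SOSC makes \<open>xb\<close> a strict local minimum,
so perturbed problems have minimisers near \<open>xb\<close>, and their multipliers must tend to \<open>yb\<close>
(\<open>perturbed_KKT_solvable\<close>).

The Aubin property is stronger in two ways. It applies at multipliers near \<open>yb\<close>, in particular at
those in the relative interior of the normal cone, where first order changes of \<open>b\<close> can only be
followed if every direction is the sum of one in the range of \<open>B\<close> and one in the lineality space of
\<open>Q\<close>; this is nondegeneracy (\<open>Aubin_imp_nondegenerate\<close>). And it applies along the sequences realising
a pair \<open>(d, \<nu>)\<close>: a tilt of the objective by a small multiple of \<open>d\<close> has to be answered by a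
proportionally small change of \<open>d\<close>, which is incompatible with \<open>Hred d \<bullet> d = 0\<close> unless \<open>d = 0\<close>
(\<open>Aubin_imp_nondegenerate_SOSC\<close>).

The remaining statements are changes of variables. The inverses of the normal and of the natural
mapping are sheared copies of the KKT solution mapping, and a KKT point of the original system solves
the linearised system for a parameter moved by the linearisation error, whose Lipschitz constant is
small near \<open>(xb, yb)\<close>; a contraction then transfers the Lipschitz solvability of the linearised system.\<close>

section \<open>First and second order expansions along sequences\<close>

lemma tendsto_scaled_imp_tendsto:
  fixes z :: "nat \<Rightarrow> 'a::real_normed_vector"
  assumes "t \<longlonglongrightarrow> 0" "(\<lambda>k. (z k - x) /\<^sub>R t k) \<longlonglongrightarrow> u" "\<And>k. t k > 0"
  shows "z \<longlonglongrightarrow> x"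
proof -
  have "(\<lambda>k. x + t k *\<^sub>R ((z k - x) /\<^sub>R t k)) \<longlonglongrightarrow> x + 0 *\<^sub>R u"
    by (intro tendsto_intros assms)
  moreover have "(\<lambda>k. x + t k *\<^sub>R ((z k - x) /\<^sub>R t k)) = z"
    using assms(3) by (intro ext) (simp add: less_imp_neq[OF assms(3), symmetric])
  ultimately show ?thesis by simp
qed

lemma has_derivative_scaled_limit:
  fixes \<phi> :: "'a::real_normed_vector \<Rightarrow> 'b::real_normed_vector"
  assumes D: "(\<phi> has_derivative D) (at x)"
    and t: "\<And>k. t k > 0" "t \<longlonglongrightarrow> 0" and z: "(\<lambda>k. (z k - x) /\<^sub>R t k) \<longlonglongrightarrow> u"
  shows "(\<lambda>k. (\<phi> (z k) - \<phi> x) /\<^sub>R t k) \<longlonglongrightarrow> D u"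
proof -
  interpret D: bounded_linear D using D by (rule has_derivative_bounded_linear)
  define e where "e h = \<phi> (x + h) - \<phi> x - D h" for h
  have e: "\<phi> (x + h) = \<phi> x + D h + e h" for h by (simp add: e_def)
  have e0: "((\<lambda>h. norm (e h) / norm h) \<longlongrightarrow> 0) (at 0)"
    using D unfolding has_derivative_at e_def by simp
  have e_0: "e 0 = 0" using e[of 0] by (simp add: D.zero)
  define w where "w k = z k - x" for k
  have w: "w \<longlonglongrightarrow> 0"
    unfolding w_def[abs_def] by (rule LIM_zero[OF tendsto_scaled_imp_tendsto[OF t(2) z t(1)]])
  have "((\<lambda>h. norm (e h) / norm h) \<longlongrightarrow> (norm (e 0) / norm (0::'a))) (at 0)"
    using e0 by simp
  then have "isCont (\<lambda>h. norm (e h) / norm h) 0" by (simp only: isCont_def)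
  then have "(\<lambda>k. norm (e (w k)) / norm (w k)) \<longlonglongrightarrow> norm (e 0) / norm (0::'a)"
    using w by (rule isCont_tendsto_compose)
  moreover have "(\<lambda>k. norm (w k /\<^sub>R t k)) \<longlonglongrightarrow> norm u"
    using z by (intro tendsto_norm) (simp add: w_def)
  ultimately have "(\<lambda>k. norm (e (w k)) / norm (w k) * norm (w k /\<^sub>R t k)) \<longlonglongrightarrow> 0 * norm u"
    by (intro tendsto_mult) auto
  moreover have "norm (e (w k)) / norm (w k) * norm (w k /\<^sub>R t k) = norm (e (w k) /\<^sub>R t k)" for k
    using t(1)[of k] e_0 by (cases "w k = 0") auto
  ultimately have "(\<lambda>k. norm (e (w k) /\<^sub>R t k)) \<longlonglongrightarrow> 0" by simp
  then have "(\<lambda>k. e (w k) /\<^sub>R t k) \<longlonglongrightarrow> 0" by (rule tendsto_norm_zero_cancel)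
  moreover have "(\<lambda>k. D (w k /\<^sub>R t k)) \<longlonglongrightarrow> D u"
    using D.tendsto[OF z] by (simp add: w_def)
  ultimately have "(\<lambda>k. D (w k /\<^sub>R t k) + e (w k) /\<^sub>R t k) \<longlonglongrightarrow> D u + 0"
    by (intro tendsto_add)
  moreover have "(\<phi> (z k) - \<phi> x) /\<^sub>R t k = D (w k /\<^sub>R t k) + e (w k) /\<^sub>R t k" for k
  proof -
    have "\<phi> (z k) - \<phi> x = D (w k) + e (w k)" using e[of "w k"] by (simp add: w_def)
    then show ?thesis by (simp add: D.scaleR scaleR_add_right)
  qed
  ultimately show ?thesis by simp
qed

text \<open>Two moving end points are allowed, because the derivative at the fixed point \<open>x0\<close> is what is
known along the sequences of interest. The mean value inequality on the segment from \<open>x k\<close> to \<open>z k\<close>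
only needs \<open>\<phi>'\<close> to be differentiable at \<open>x0\<close>.\<close>

lemma second_order_expansion:
  fixes \<phi> :: "'a::real_normed_vector \<Rightarrow> 'b::real_inner" and \<phi>' :: "'a \<Rightarrow> 'a \<Rightarrow>\<^sub>L 'b"
    and \<phi>'' :: "'a \<Rightarrow>\<^sub>L 'a \<Rightarrow>\<^sub>L 'b"
  assumes S: "open S" "x0 \<in> S"
    and \<phi>': "\<And>x. x \<in> S \<Longrightarrow> (\<phi> has_derivative \<phi>' x) (at x)"
    and \<phi>'': "(\<phi>' has_derivative \<phi>'') (at x0)"
    and t: "\<And>k. t k > 0" "t \<longlonglongrightarrow> 0"
    and x: "(\<lambda>k. (x k - x0) /\<^sub>R t k) \<longlonglongrightarrow> u" and z: "(\<lambda>k. (z k - x0) /\<^sub>R t k) \<longlonglongrightarrow> v"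
  shows "(\<lambda>k. (\<phi> (z k) - \<phi> (x k) - \<phi>' x0 (z k - x k)) /\<^sub>R (t k)\<^sup>2)
     \<longlonglongrightarrow> \<phi>'' u (v - u) + (1/2) *\<^sub>R \<phi>'' (v - u) (v - u)"
proof -
  define U where "U k = (x k - x0) /\<^sub>R t k" for k
  define V where "V k = (z k - x0) /\<^sub>R t k" for k
  define w where "w k = V k - U k" for k
  have xk: "x k = x0 + t k *\<^sub>R U k" and zk: "z k = x0 + t k *\<^sub>R V k" for k
    using t(1)[of k] by (auto simp: U_def V_def)
  have lim: "U \<longlonglongrightarrow> u" "w \<longlonglongrightarrow> v - u"
    using x z unfolding U_def w_def V_def by (auto intro!: tendsto_intros)
  define q where "q k = \<phi>'' (U k) (w k) + (1/2) *\<^sub>R \<phi>'' (w k) (w k)" for k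
  define r where "r k = (\<phi> (z k) - \<phi> (x k) - \<phi>' x0 (z k - x k)) /\<^sub>R (t k)\<^sup>2" for k
  have q: "q \<longlonglongrightarrow> \<phi>'' u (v - u) + (1/2) *\<^sub>R \<phi>'' (v - u) (v - u)"
    unfolding q_def by (intro tendsto_intros lim)
  obtain MU Mw where M: "\<And>k. norm (U k) \<le> MU" "\<And>k. norm (w k) \<le> Mw" "MU > 0" "Mw > 0"
    using convergent_imp_Bseq[of U] convergent_imp_Bseq[of w] lim
    by (metis Bseq_def convergentI)
  define M where "M = (MU + Mw) * Mw"
  have Mpos: "M > 0" using M by (simp add: M_def)
  have sw: "s * norm (w k) \<le> Mw" if "0 \<le> s" "s \<le> 1" for s k
    using mult_mono[of s 1 "norm (w k)" Mw] M(2)[of k] M(4) that by simp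
  have bound: "norm (U k + s *\<^sub>R w k) * norm (w k) \<le> M" if "0 < s" "s < 1" for k s
  proof -
    have "norm (U k + s *\<^sub>R w k) \<le> MU + 1 * Mw"
      using norm_triangle_ineq[of "U k" "s *\<^sub>R w k"] M(1)[of k] sw[of s k] that by auto
    then show ?thesis
      unfolding M_def using M(2)[of k] M(3,4) by (intro mult_mono) auto
  qed
  have "(\<lambda>k. r k - q k) \<longlonglongrightarrow> 0"
  proof (rule LIMSEQ_I)
    fix e :: real assume "e > 0"
    define e' where "e' = e / (2 * M)"
    have "e' > 0" using \<open>e > 0\<close> Mpos by (simp add: e'_def)
    then obtain d1 where d1: "d1 > 0"
      "\<And>y. norm (y - x0) < d1 \<Longrightarrow> norm (\<phi>' y - \<phi>' x0 - \<phi>'' (y - x0)) \<le> e' * norm (y - x0)"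
      using \<phi>''[unfolded has_derivative_at_alt] by blast
    obtain d2 where d2: "d2 > 0" "ball x0 d2 \<subseteq> S" using S openE by metis
    have "eventually (\<lambda>k. t k < min d1 d2 / (MU + Mw)) sequentially"
      using t(2) M d1(1) d2(1) by (intro order_tendstoD(2)[of t 0]) auto
    then obtain N where N: "\<And>k. k \<ge> N \<Longrightarrow> t k < min d1 d2 / (MU + Mw)"
      by (auto simp: eventually_sequentially)
    have "norm (r k - q k - 0) < e" if "k \<ge> N" for k
    proof -
      define p where "p s = x0 + t k *\<^sub>R (U k + s *\<^sub>R w k)" for s
      have pd: "norm (p s - x0) < min d1 d2" if "0 \<le> s" "s \<le> 1" for s
      proof -
        have "norm (U k + s *\<^sub>R w k) \<le> MU + 1 * Mw"
          using norm_triangle_ineq[of "U k" "s *\<^sub>R w k"] M(1)[of k] sw[of s k] that by auto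
        then have "norm (p s - x0) \<le> t k * (MU + Mw)"
          using t(1)[of k] unfolding p_def by (simp add: mult_left_mono)
        also have "\<dots> < min d1 d2" using N[OF \<open>k \<ge> N\<close>] M by (simp add: pos_less_divide_eq)
        finally show ?thesis .
      qed
      \<comment> \<open>\<open>\<psi>\<close> is \<open>\<phi>\<close> along the segment minus its quadratic model; its derivative is \<open>t k\<close> times the first order
        remainder of \<open>\<phi>'\<close> at \<open>x0\<close>, hence \<open>o((t k)\<^sup>2)\<close>.\<close>
      define \<psi> where "\<psi> s = \<phi> (p s) - s *\<^sub>R (t k *\<^sub>R \<phi>' x0 (w k))
          - (t k)\<^sup>2 *\<^sub>R (s *\<^sub>R \<phi>'' (U k) (w k) + (s\<^sup>2 / 2) *\<^sub>R \<phi>'' (w k) (w k))" for s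
      define \<psi>' where "\<psi>' s = t k *\<^sub>R ((\<phi>' (p s) - \<phi>' x0 - \<phi>'' (p s - x0)) (w k))" for s
      have der: "(\<psi> has_derivative (\<lambda>h. h *\<^sub>R \<psi>' s)) (at s)" if "0 \<le> s" "s \<le> 1" for s
      proof -
        have "p s \<in> S" using pd[OF that] d2 by (auto simp: dist_norm norm_minus_commute)
        have "(p has_derivative (\<lambda>h. h *\<^sub>R (t k *\<^sub>R w k))) (at s)"
          unfolding p_def[abs_def] by (auto intro!: derivative_eq_intros simp: algebra_simps)
        note [derivative_intros] = has_derivative_compose[OF this \<phi>'[OF \<open>p s \<in> S\<close>]]
        have "p s - x0 = t k *\<^sub>R U k + (t k * s) *\<^sub>R w k" by (simp add: p_def scaleR_add_right)
        then show ?thesis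
          unfolding \<psi>_def[abs_def] \<psi>'_def
          by (auto intro!: derivative_eq_intros
              simp: fun_eq_iff blinfun.bilinear_simps power2_eq_square algebra_simps)
      qed
      have "\<exists>s\<in>{0<..<1}. norm (\<psi> 1 - \<psi> 0) \<le> norm ((1 - 0) *\<^sub>R \<psi>' s)"
        by (rule mvt_general)
          (auto intro!: der continuous_at_imp_continuous_on has_derivative_continuous[OF der])
      then obtain s where s: "0 < s" "s < 1" "norm (\<psi> 1 - \<psi> 0) \<le> norm (\<psi>' s)" by auto
      have "norm (\<psi>' s) \<le> t k * (norm (\<phi>' (p s) - \<phi>' x0 - \<phi>'' (p s - x0)) * norm (w k))"
        unfolding \<psi>'_def using t(1)[of k] by (simp add: norm_blinfun mult_left_mono)
      also have "\<dots> \<le> t k * ((e' * norm (p s - x0)) * norm (w k))"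
        using t(1)[of k] d1(2)[of "p s"] pd[of s] s
        by (intro mult_left_mono mult_right_mono) auto
      also have "\<dots> = (t k)\<^sup>2 * e' * (norm (U k + s *\<^sub>R w k) * norm (w k))"
        using t(1)[of k] by (simp add: p_def power2_eq_square)
      also have "\<dots> \<le> (t k)\<^sup>2 * e' * M"
        using \<open>e' > 0\<close> bound[OF s(1,2)] by (intro mult_left_mono) auto
      finally have est: "norm (\<psi> 1 - \<psi> 0) \<le> (t k)\<^sup>2 * e' * M" using s(3) by linarith
      have "z k - x k = t k *\<^sub>R w k"
        unfolding xk zk w_def by (simp add: algebra_simps)
      then have "\<psi> 1 - \<psi> 0 = (t k)\<^sup>2 *\<^sub>R (r k - q k)"
        using t(1)[of k] unfolding r_def q_def \<psi>_def p_def
        by (simp add: xk zk w_def algebra_simps blinfun.bilinear_simps)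
      then have "(t k)\<^sup>2 * norm (r k - q k) \<le> (t k)\<^sup>2 * (e' * M)"
        using est t(1)[of k] by simp
      then have "norm (r k - q k) \<le> e' * M"
        using t(1)[of k] by (simp add: mult_le_cancel_left_pos)
      also have "\<dots> < e" using \<open>e > 0\<close> Mpos by (simp add: e'_def)
      finally show ?thesis by simp
    qed
    then show "\<exists>N. \<forall>k\<ge>N. norm (r k - q k - 0) < e" by blast
  qed
  from tendsto_add[OF this q] show ?thesis by (simp add: r_def)
qed

text \<open>Going from \<open>0\<close> to \<open>v\<close> directly or through \<open>u\<close> must produce the same increment of \<open>\<phi>\<close>, and the
quadratic terms of the expansion along the two routes differ by half of \<open>\<phi>'' u v - \<phi>'' v u\<close>.\<close>

lemma second_derivative_symmetric:
  fixes \<phi> :: "'a::real_normed_vector \<Rightarrow> 'b::real_inner" and \<phi>' :: "'a \<Rightarrow> 'a \<Rightarrow>\<^sub>L 'b"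
    and \<phi>'' :: "'a \<Rightarrow>\<^sub>L 'a \<Rightarrow>\<^sub>L 'b"
  assumes S: "open S" "x0 \<in> S"
    and \<phi>': "\<And>x. x \<in> S \<Longrightarrow> (\<phi> has_derivative \<phi>' x) (at x)"
    and \<phi>'': "(\<phi>' has_derivative \<phi>'') (at x0)"
  shows "\<phi>'' u v = \<phi>'' v u"
proof -
  define t where "t k = inverse (real (Suc k))" for k
  have t: "\<And>k. t k > 0" "t \<longlonglongrightarrow> 0"
    unfolding t_def using LIMSEQ_inverse_real_of_nat by auto
  have ray: "(\<lambda>k. (x0 + t k *\<^sub>R w - x0) /\<^sub>R t k) \<longlonglongrightarrow> w" for w
  proof -
    have "(x0 + t k *\<^sub>R w - x0) /\<^sub>R t k = w" for k using t(1)[of k] by simp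
    then show ?thesis by simp
  qed
  note E = second_order_expansion[OF S \<phi>' \<phi>'' t ray ray]
  define I where "I a b = \<phi>'' a (b - a) + (1/2) *\<^sub>R \<phi>'' (b - a) (b - a)" for a b
  have "(\<lambda>k. (\<phi> (x0 + t k *\<^sub>R v) - \<phi> (x0 + t k *\<^sub>R u) - \<phi>' x0 (x0 + t k *\<^sub>R v - (x0 + t k *\<^sub>R u))) /\<^sub>R (t k)\<^sup>2
     + (\<phi> (x0 + t k *\<^sub>R u) - \<phi> (x0 + t k *\<^sub>R 0) - \<phi>' x0 (x0 + t k *\<^sub>R u - (x0 + t k *\<^sub>R 0))) /\<^sub>R (t k)\<^sup>2)
     \<longlonglongrightarrow> I u v + I 0 u"
    unfolding I_def by (intro tendsto_add E)
  moreover have "(\<lambda>k. (\<phi> (x0 + t k *\<^sub>R v) - \<phi> (x0 + t k *\<^sub>R 0) - \<phi>' x0 (x0 + t k *\<^sub>R v - (x0 + t k *\<^sub>R 0))) /\<^sub>R (t k)\<^sup>2)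
     \<longlonglongrightarrow> I 0 v"
    unfolding I_def by (intro E)
  moreover have "(\<phi> (x0 + t k *\<^sub>R v) - \<phi> (x0 + t k *\<^sub>R u) - \<phi>' x0 (x0 + t k *\<^sub>R v - (x0 + t k *\<^sub>R u))) /\<^sub>R (t k)\<^sup>2
     + (\<phi> (x0 + t k *\<^sub>R u) - \<phi> (x0 + t k *\<^sub>R 0) - \<phi>' x0 (x0 + t k *\<^sub>R u - (x0 + t k *\<^sub>R 0))) /\<^sub>R (t k)\<^sup>2
     = (\<phi> (x0 + t k *\<^sub>R v) - \<phi> (x0 + t k *\<^sub>R 0) - \<phi>' x0 (x0 + t k *\<^sub>R v - (x0 + t k *\<^sub>R 0))) /\<^sub>R (t k)\<^sup>2" for k
    unfolding scaleR_add_right[symmetric] by (simp add: blinfun.bilinear_simps)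
  ultimately have "I u v + I 0 u = I 0 v"
    using LIMSEQ_unique by simp
  then have "(1/2) *\<^sub>R (\<phi>'' u v) = (1/2) *\<^sub>R (\<phi>'' v u)"
    unfolding I_def by (simp add: algebra_simps blinfun.bilinear_simps)
      (metis (no_types, opaque_lifting) add.commute add_diff_cancel_left' diff_diff_eq2 scaleR_half_double scaleR_right_distrib)
  then show ?thesis by simp
qed

section \<open>Normal cones and metric regularity\<close>

definition normal_cone :: "'a::real_inner set \<Rightarrow> 'a \<Rightarrow> 'a set" where
  "normal_cone K z = {n. z \<in> K \<and> (\<forall>k\<in>K. n \<bullet> (k - z) \<le> 0)}"

lemma normal_coneD: "n \<in> normal_cone K z \<Longrightarrow> k \<in> K \<Longrightarrow> n \<bullet> (k - z) \<le> 0"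
  and normal_cone_point: "n \<in> normal_cone K z \<Longrightarrow> z \<in> K"
  by (auto simp: normal_cone_def)

lemma scaleR_normal_cone: "n \<in> normal_cone K z \<Longrightarrow> c \<ge> 0 \<Longrightarrow> c *\<^sub>R n \<in> normal_cone K z"
  by (auto simp: normal_cone_def mult_nonneg_nonpos)

lemma normal_cone_limit:
  assumes "closed K" "\<And>k. n k \<in> normal_cone K (A k)" "n \<longlonglongrightarrow> m" "A \<longlonglongrightarrow> B"
  shows "m \<in> normal_cone K B"
proof -
  have "B \<in> K"
    by (rule closed_sequentially[OF assms(1) _ assms(4)]) (rule normal_cone_point[OF assms(2)])
  moreover have "m \<bullet> (z - B) \<le> 0" if "z \<in> K" for z
  proof (rule LIMSEQ_le_const2)
    show "(\<lambda>k. n k \<bullet> (z - A k)) \<longlonglongrightarrow> m \<bullet> (z - B)" by (intro tendsto_intros assms)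
    show "\<exists>N. \<forall>k\<ge>N. n k \<bullet> (z - A k) \<le> 0"
      using normal_coneD[OF assms(2) that] by auto
  qed
  ultimately show ?thesis by (simp add: normal_cone_def)
qed

lemma nearest_point_normal:
  assumes "closed K" "convex K" "P \<in> K" "dist a P = infdist a K"
  shows "a - P \<in> normal_cone K P"
  using any_closest_point_dot[OF assms(2,1,3)] assms(3,4) by (auto simp: normal_cone_def infdist_le)

lemma closest_point_eq_iff_normal_cone:
  fixes K :: "'a::euclidean_space set"
  assumes "closed K" "convex K" "K \<noteq> {}"
  shows "closest_point K a = z \<longleftrightarrow> a - z \<in> normal_cone K z"
proof
  assume "closest_point K a = z"
  then show "a - z \<in> normal_cone K z"
    using closest_point_in_set[OF assms(1,3)] closest_point_dot[OF assms(2,1)]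
    by (auto simp: normal_cone_def)
next
  assume n: "a - z \<in> normal_cone K z"
  have "dist a z \<le> dist a k" if "k \<in> K" for k
  proof -
    have "(norm (a - k))\<^sup>2 = (norm (a - z))\<^sup>2 + (norm (z - k))\<^sup>2 - 2 * ((a - z) \<bullet> (k - z))"
      unfolding power2_norm_eq_inner by (simp add: algebra_simps inner_commute)
    then have "(norm (a - z))\<^sup>2 \<le> (norm (a - k))\<^sup>2"
      using normal_coneD[OF n that] zero_le_power2[of "norm (z - k)"] by linarith
    then show ?thesis by (simp add: dist_norm)
  qed
  then show "closest_point K a = z"
    using closest_point_unique[OF assms(2,1) normal_cone_point[OF n], of a] by auto
qed

lemma adjoint_blinfun:
  fixes L :: "'a::euclidean_space \<Rightarrow>\<^sub>L 'b::euclidean_space"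
  shows "adjoint L n \<bullet> v = n \<bullet> L v"
  by (simp add: adjoint_clauses(2) bounded_linear.linear blinfun.bounded_linear_right)

lemma tendsto_adjoint:
  fixes L :: "nat \<Rightarrow> 'a::euclidean_space \<Rightarrow>\<^sub>L 'b::euclidean_space"
  assumes "L \<longlonglongrightarrow> M" "n \<longlonglongrightarrow> m"
  shows "(\<lambda>k. adjoint (L k) (n k)) \<longlonglongrightarrow> adjoint M m"
proof (subst tendsto_componentwise_iff, intro ballI)
  fix b :: 'a
  have "(\<lambda>k. n k \<bullet> L k b) \<longlonglongrightarrow> m \<bullet> M b"
    by (rule tendsto_inner[OF assms(2) blinfun.tendsto[OF assms(1) tendsto_const]])
  then show "(\<lambda>k. adjoint (L k) (n k) \<bullet> b) \<longlonglongrightarrow> adjoint M m \<bullet> b"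
    by (simp add: adjoint_blinfun)
qed

text \<open>Injectivity of \<open>g'(x0)\<^sup>*\<close> on the normal cone at one point is an open condition: unit normals at
nearby points that are almost annihilated would accumulate, by compactness of the sphere and
closedness of the normal cone mapping, at an annihilated unit normal at the reference point. The
quantitative form bounds multipliers and serves as the slope in the proof of metric regularity.\<close>

lemma uniform_regularity:
  fixes g' :: "'x::euclidean_space \<Rightarrow> 'x \<Rightarrow>\<^sub>L 'y::euclidean_space"
  assumes "closed K" "isCont g' x0"
    and reg: "\<And>n. n \<in> normal_cone K z0 \<Longrightarrow> (\<And>v. n \<bullet> g' x0 v = 0) \<Longrightarrow> n = 0"
  obtains c e where "c > 0" "e > 0"
    "\<And>x z n. dist x x0 \<le> e \<Longrightarrow> dist z z0 \<le> e \<Longrightarrow> n \<in> normal_cone K z \<Longrightarrow> c * norm n \<le> norm (adjoint (g' x) n)"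
proof -
  define e where "e k = inverse (real (Suc k))" for k
  have e: "\<And>k. e k > 0" "e \<longlonglongrightarrow> 0"
    unfolding e_def using LIMSEQ_inverse_real_of_nat by auto
  have "\<exists>k. \<forall>x z n. dist x x0 \<le> e k \<longrightarrow> dist z z0 \<le> e k \<longrightarrow> n \<in> normal_cone K z \<longrightarrow> e k * norm n \<le> norm (adjoint (g' x) n)"
  proof (rule ccontr)
    assume "\<not> ?thesis"
    then have ex: "\<forall>k. \<exists>p. dist (fst p) x0 \<le> e k \<and> dist (fst (snd p)) z0 \<le> e k \<and>
        snd (snd p) \<in> normal_cone K (fst (snd p)) \<and>
        norm (adjoint (g' (fst p)) (snd (snd p))) < e k * norm (snd (snd p))"
      by (simp add: not_le)
    then obtain p where p: "\<forall>k. dist (fst (p k)) x0 \<le> e k \<and> dist (fst (snd (p k))) z0 \<le> e k \<and>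
        snd (snd (p k)) \<in> normal_cone K (fst (snd (p k))) \<and>
        norm (adjoint (g' (fst (p k))) (snd (snd (p k)))) < e k * norm (snd (snd (p k)))"
      using choice[OF ex] by (elim exE) (rule that)
    define x z n where "x k = fst (p k)" and "z k = fst (snd (p k))" and "n k = snd (snd (p k))" for k
    have xzn: "dist (x k) x0 \<le> e k" "dist (z k) z0 \<le> e k"
      "n k \<in> normal_cone K (z k)" "norm (adjoint (g' (x k)) (n k)) < e k * norm (n k)" for k
      using p by (simp_all add: x_def z_def n_def)
    have n0: "norm (n k) > 0" for k
      using order.strict_trans1[OF norm_ge_zero xzn(4)[of k]] e(1)[of k]
      by (simp add: zero_less_mult_iff)
    define m where "m k = n k /\<^sub>R norm (n k)" for k
    have m: "norm (m k) = 1" "m k \<in> normal_cone K (z k)" "norm (adjoint (g' (x k)) (m k)) \<le> e k" for k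
    proof -
      show "norm (m k) = 1" "m k \<in> normal_cone K (z k)"
        unfolding m_def using n0[of k] by (simp_all add: scaleR_normal_cone xzn(3))
      have "adjoint (g' (x k)) (m k) = adjoint (g' (x k)) (n k) /\<^sub>R norm (n k)"
        unfolding m_def
        by (rule linear_scale[OF adjoint_linear[OF bounded_linear.linear[OF blinfun.bounded_linear_right]]])
      then have "norm (adjoint (g' (x k)) (m k)) = norm (adjoint (g' (x k)) (n k)) / norm (n k)"
        using n0[of k] by (simp add: divide_inverse mult.commute)
      then show "norm (adjoint (g' (x k)) (m k)) \<le> e k"
        using xzn(4)[of k] n0[of k] by (simp add: pos_divide_le_eq)
    qed
    have "bounded (range m)" using m(1) by (auto simp: bounded_iff)
    then obtain l r where r: "strict_mono r" "(m \<circ> r) \<longlonglongrightarrow> l"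
      using bounded_imp_convergent_subsequence[of m] by auto
    have x: "x \<longlonglongrightarrow> x0" and z: "z \<longlonglongrightarrow> z0"
      by (rule iffD2[OF tendsto_dist_iff], rule Lim_null_comparison[OF _ e(2)], simp add: xzn(1,2))+
    have "(\<lambda>k. norm ((m \<circ> r) k)) \<longlonglongrightarrow> norm l" by (rule tendsto_norm[OF r(2)])
    then have l1: "norm l = 1" by (simp add: m(1) LIMSEQ_const_iff)
    have "l \<in> normal_cone K z0"
      by (rule normal_cone_limit[OF assms(1) _ r(2) LIMSEQ_subseq_LIMSEQ[OF z r(1)]]) (simp add: m(2))
    moreover have "adjoint (g' x0) l = 0"
    proof -
      have "(\<lambda>k. g' ((x \<circ> r) k)) \<longlonglongrightarrow> g' x0"
        by (rule isCont_tendsto_compose[OF assms(2) LIMSEQ_subseq_LIMSEQ[OF x r(1)]])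
      then have "(\<lambda>k. adjoint (g' ((x \<circ> r) k)) ((m \<circ> r) k)) \<longlonglongrightarrow> adjoint (g' x0) l"
        by (rule tendsto_adjoint[OF _ r(2)])
      moreover have "(\<lambda>k. adjoint (g' ((x \<circ> r) k)) ((m \<circ> r) k)) \<longlonglongrightarrow> 0"
        by (rule Lim_null_comparison[OF _ LIMSEQ_subseq_LIMSEQ[OF e(2) r(1)]]) (simp add: m(3))
      ultimately show ?thesis by (rule LIMSEQ_unique)
    qed
    then have "l \<bullet> g' x0 v = 0" for v using adjoint_blinfun[of "g' x0" l v] by simp
    ultimately have "l = 0" by (rule reg)
    then show False using l1 by simp
  qed
  then obtain k where "\<forall>x z n. dist x x0 \<le> e k \<longrightarrow> dist z z0 \<le> e k \<longrightarrow> n \<in> normal_cone K z \<longrightarrow> e k * norm n \<le> norm (adjoint (g' x) n)"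
    by blast
  then show ?thesis by (intro that[OF e(1)[of k] e(1)[of k]]) simp
qed

text \<open>Minimise the residual \<open>infdist (g u + b) K\<close> plus \<open>c/2\<close> times the distance to \<open>x\<close>. The minimiser \<open>u\<close>
is as close to \<open>x\<close> as claimed, with constant \<open>2 / c\<close>. If its residual were positive, a step along
\<open>- g'(u)\<^sup>* n\<close>, with \<open>n\<close> the unit normal at the nearest point, would decrease the residual by at least
\<open>c\<close> per unit length, which beats the penalty \<open>c/2\<close>.\<close>

lemma metric_regularity:
  fixes g :: "'x::euclidean_space \<Rightarrow> 'y::euclidean_space" and g' :: "'x \<Rightarrow> 'x \<Rightarrow>\<^sub>L 'y"
  assumes K: "closed K" "convex K" "g x0 \<in> K" and S: "open S" "x0 \<in> S"
    and g': "\<And>x. x \<in> S \<Longrightarrow> (g has_derivative g' x) (at x)" and cont: "isCont g' x0"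
    and reg: "\<And>n. n \<in> normal_cone K (g x0) \<Longrightarrow> (\<And>v. n \<bullet> g' x0 v = 0) \<Longrightarrow> n = 0"
  shows "\<exists>\<kappa>>0. \<exists>\<delta>>0. \<forall>x b. dist x x0 < \<delta> \<longrightarrow> norm b < \<delta> \<longrightarrow>
    (\<exists>x'\<in>S. g x' + b \<in> K \<and> dist x' x \<le> \<kappa> * infdist (g x + b) K)"
proof -
  obtain c e where ce: "c > 0" "e > 0"
    "\<And>x z n. dist x x0 \<le> e \<Longrightarrow> dist z (g x0) \<le> e \<Longrightarrow> n \<in> normal_cone K z \<Longrightarrow> c * norm n \<le> norm (adjoint (g' x) n)"
    using uniform_regularity[OF K(1) cont reg] by metis
  have gcont: "continuous_on S g"
    using g' by (meson continuous_at_imp_continuous_on has_derivative_continuous)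
  obtain e1 where e1: "e1 > 0" "e1 \<le> e" "cball x0 e1 \<subseteq> S"
    "\<And>x. dist x x0 \<le> e1 \<Longrightarrow> dist (g x) (g x0) \<le> e / 4"
  proof -
    obtain d1 where d1: "d1 > 0" "cball x0 d1 \<subseteq> S" using S open_contains_cball by metis
    have "isCont g x0" using g'[OF S(2)] has_derivative_continuous by blast
    then obtain d2 where d2: "d2 > 0" "\<And>x. dist x x0 < d2 \<Longrightarrow> dist (g x) (g x0) < e / 4"
      using ce(2) unfolding continuous_at_eps_delta by (metis zero_less_divide_iff zero_less_numeral)
    show ?thesis
      by (rule that[of "min e (min d1 (d2/2))"]) (use d1 d2 ce(2) in \<open>auto intro: less_imp_le order_trans[OF subset_cball]\<close>)
  qed
  \<comment> \<open>Residuals below \<open>r0\<close> force the minimiser to stay in the interior of the ball of radius \<open>e1\<close>.\<close>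
  define r0 where "r0 = min (e/4) (c * e1 / 8)"
  have r0: "r0 > 0" "r0 \<le> e/4" "2 * r0 / c \<le> e1 / 4"
    using ce e1 by (auto simp: r0_def field_simps min_def)
  obtain \<delta> where \<delta>: "\<delta> > 0" "\<delta> \<le> e1/4" "\<delta> \<le> r0/2"
    "\<And>x. dist x x0 < \<delta> \<Longrightarrow> dist (g x) (g x0) < r0/2"
  proof -
    have "isCont g x0" using g'[OF S(2)] has_derivative_continuous by blast
    then obtain d2 where d2: "d2 > 0" "\<And>x. dist x x0 < d2 \<Longrightarrow> dist (g x) (g x0) < r0 / 2"
      using r0(1) unfolding continuous_at_eps_delta by (metis zero_less_divide_iff zero_less_numeral)
    show ?thesis
      by (rule that[of "min d2 (min (e1/4) (r0/2))"]) (use d2(1) e1(1) r0(1) in \<open>auto dest: d2(2)\<close>)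
  qed
  have main: "\<exists>x'\<in>S. g x' + b \<in> K \<and> dist x' x \<le> (2 / c) * infdist (g x + b) K"
    if x: "dist x x0 < \<delta>" and b: "norm b < \<delta>" for x b
  proof -
    define \<psi> where "\<psi> u = infdist (g u + b) K + (c/2) * dist u x" for u
    have "continuous_on (cball x0 e1) \<psi>"
      unfolding \<psi>_def by (intro continuous_intros continuous_on_subset[OF gcont e1(3)])
    then obtain u where u: "u \<in> cball x0 e1" "\<And>v. v \<in> cball x0 e1 \<Longrightarrow> \<psi> u \<le> \<psi> v"
      using continuous_attains_inf[of "cball x0 e1" \<psi>] e1(1) by (metis compact_cball cball_eq_empty less_le_not_le linear)
    have "x \<in> cball x0 e1" using x \<delta>(2) e1(1) by (simp add: dist_commute)
    then have le: "infdist (g u + b) K + (c/2) * dist u x \<le> infdist (g x + b) K"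
      using u(2)[of x] by (simp add: \<psi>_def)
    have "infdist (g x + b) K \<le> dist (g x + b) (g x0)" using K(3) by (rule infdist_le)
    also have "\<dots> \<le> dist (g x) (g x0) + norm b"
      using norm_triangle_ineq[of "g x - g x0" b] by (simp add: dist_norm algebra_simps)
    also have "\<dots> < r0" using \<delta>(3) \<delta>(4)[OF x] b by linarith
    finally have r: "infdist (g x + b) K < r0" .
    have "(c/2) * dist u x < r0" using le r infdist_nonneg[of "g u + b" K] by linarith
    then have "dist u x < 2 * r0 / c" using ce(1) by (simp add: field_simps)
    then have ux0: "dist u x0 < e1"
      using r0(3) x \<delta>(2) e1(1) dist_triangle[of u x0 x] by linarith
    have uS: "u \<in> S" using e1(3) u(1) by blast
    have "g u + b \<in> K"
    proof (rule ccontr)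
      assume nK: "g u + b \<notin> K"
      obtain P where P: "P \<in> K" "infdist (g u + b) K = dist (g u + b) P"
        using infdist_attains_inf[OF K(1)] K(3) by (metis empty_iff)
      define n where "n = sgn (g u + b - P)"
      have ne: "g u + b - P \<noteq> 0" using nK P by auto
      have nn: "n \<in> normal_cone K P" "norm n = 1"
        using nearest_point_normal[OF K(1,2) P(1) P(2)[symmetric]] ne
        by (auto simp: n_def sgn_div_norm intro: scaleR_normal_cone)
      have "dist P (g x0) \<le> dist (g u + b) P + dist (g u) (g x0) + norm b"
        using dist_triangle[of P "g x0" "g u + b"] norm_triangle_ineq[of "g u - g x0" b]
        by (simp add: dist_norm norm_minus_commute algebra_simps)
      also have "\<dots> \<le> e"
      proof -
        have "dist (g u + b) P < r0" using P(2) le r mult_nonneg_nonneg[of "c/2" "dist u x"] ce(1) zero_le_dist[of u x] by linarith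
        moreover have "dist (g u) (g x0) \<le> e/4" using e1(4) ux0 by simp
        moreover have "norm b < e/4" using b \<delta>(3) r0 ce(2) by linarith
        ultimately show ?thesis using r0(2) ce(2) by linarith
      qed
      finally have Pe: "dist P (g x0) \<le> e" .
      define w where "w = adjoint (g' u) n"
      have wc: "c \<le> norm w"
        using ce(3)[OF _ Pe nn(1), of u] nn(2) ux0 e1(2) by (simp add: w_def)
      \<comment> \<open>The nearest point \<open>P\<close> is kept fixed, so that \<open>h\<close> is differentiable and bounds the objective from above.\<close>
      define h where "h s = norm (g (u + s *\<^sub>R (- w)) + b - P) + (c/2) * s * norm w" for s :: real
      have der: "(h has_derivative (\<lambda>s. s * ((c/2) * norm w - (norm w)\<^sup>2))) (at 0)"
      proof -
        have "((\<lambda>s. u + s *\<^sub>R (- w)) has_derivative (\<lambda>s. s *\<^sub>R (- w))) (at 0)"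
          by (auto intro!: derivative_eq_intros)
        then have "((\<lambda>s. g (u + s *\<^sub>R (- w))) has_derivative (\<lambda>s. g' u (s *\<^sub>R (- w)))) (at 0)"
          by (rule has_derivative_compose) (use g'[OF uS] in simp)
        then have "((\<lambda>s. g (u + s *\<^sub>R (- w)) + b - P) has_derivative (\<lambda>s. g' u (s *\<^sub>R (- w)))) (at 0)"
          by (auto intro!: derivative_eq_intros)
        then have "((\<lambda>s. norm (g (u + s *\<^sub>R (- w)) + b - P)) has_derivative (\<lambda>s. g' u (s *\<^sub>R (- w)) \<bullet> n)) (at 0)"
          using has_derivative_compose[where f="\<lambda>s. g (u + s *\<^sub>R (- w)) + b - P" and g=norm and x=0 and s=UNIV
              and g'="\<lambda>h. h \<bullet> sgn (g u + b - P)"] has_derivative_norm[OF ne] by (simp add: n_def)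
        moreover have "g' u (s *\<^sub>R (- w)) \<bullet> n = - s * (norm w)\<^sup>2" for s
          using adjoint_blinfun[of "g' u" n w]
          by (simp add: blinfun.bilinear_simps inner_commute w_def power2_norm_eq_inner)
        ultimately show ?thesis
          unfolding h_def by (auto intro!: derivative_eq_intros simp: algebra_simps)
      qed
      have "(c/2) * norm w - (norm w)\<^sup>2 < 0"
      proof -
        have "c * norm w \<le> norm w * norm w" using wc by (intro mult_right_mono) auto
        moreover have "norm w * norm w > 0" using wc ce(1) by (intro mult_pos_pos) linarith+
        ultimately show ?thesis by (simp add: power2_eq_square)
      qed
      then obtain d where d: "d > 0" "\<And>s. 0 < s \<Longrightarrow> s < d \<Longrightarrow> h s < h 0"
      proof -
        have "DERIV h 0 :> (c/2) * norm w - (norm w)\<^sup>2"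
          unfolding has_field_derivative_def
          by (rule has_derivative_eq_rhs[OF der]) (simp add: fun_eq_iff mult.commute)
        from DERIV_neg_dec_right[OF this \<open>_ < 0\<close>] show ?thesis using that by auto
      qed
      define s where "s = min (d/2) ((e1 - dist u x0) / (norm w + 1))"
      have s: "0 < s" "s < d" using d(1) ux0 by (auto simp: s_def add_nonneg_pos)
      have sw: "s * norm w \<le> e1 - dist u x0"
      proof -
        have "s * norm w \<le> s * (norm w + 1)" using s by simp
        also have "\<dots> \<le> ((e1 - dist u x0) / (norm w + 1)) * (norm w + 1)"
          unfolding s_def by (intro mult_right_mono) auto
        also have "\<dots> = e1 - dist u x0" using add_nonneg_pos[OF norm_ge_zero[of w] zero_less_one] by simp
        finally show ?thesis .
      qed
      define v where "v = u + s *\<^sub>R (- w)"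
      have duv: "dist u v = s * norm w" using s by (simp add: v_def dist_norm)
      have "v \<in> cball x0 e1"
        using sw duv dist_triangle[of x0 v u] by (simp add: dist_commute)
      then have "\<psi> u \<le> \<psi> v" by (rule u(2))
      moreover have "\<psi> v \<le> h s + (c/2) * dist u x"
      proof -
        have "infdist (g v + b) K \<le> norm (g v + b - P)"
          using infdist_le[OF P(1), of "g v + b"] by (simp add: dist_norm)
        moreover have "(c/2) * dist v x \<le> (c/2) * (dist u x + s * norm w)"
          using duv dist_triangle[of v x u] ce(1) by (intro mult_left_mono) (auto simp: dist_commute)
        ultimately show ?thesis unfolding \<psi>_def h_def v_def by (simp add: algebra_simps)
      qed
      moreover have "\<psi> u = h 0 + (c/2) * dist u x"
        by (simp add: \<psi>_def h_def P(2) dist_norm)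
      ultimately show False using d(2)[OF s] by simp
    qed
    moreover have "dist u x \<le> (2/c) * infdist (g x + b) K"
      using le infdist_nonneg[of "g u + b" K] ce(1) by (simp add: field_simps)
    ultimately show ?thesis using uS by blast
  qed
  have "2 / c > 0" using ce(1) by simp
  with \<delta>(1) main show ?thesis by blast
qed

text \<open>Quadratic penalties produce the multiplier: at a minimiser \<open>x k\<close> of the objective with penalty
weight \<open>k\<close> the vector \<open>k (g (x k) - P k)\<close>, with \<open>P k\<close> the nearest point of \<open>K\<close>, is a normal of \<open>K\<close>
at \<open>P k\<close> and satisfies the stationarity equation. The added term \<open>(norm (x - x0))\<^sup>2 / 2\<close> forces the
minimisers to converge to \<open>x0\<close>, and the constraint qualification keeps these normals bounded.\<close>

lemma lagrange_multiplier_rule: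
  fixes g :: "'x::euclidean_space \<Rightarrow> 'y::euclidean_space" and g' :: "'x \<Rightarrow> 'x \<Rightarrow>\<^sub>L 'y"
    and \<phi> :: "'x \<Rightarrow> real"
  assumes K: "closed K" "convex K" "g x0 \<in> K" and S: "open S" "x0 \<in> S"
    and g': "\<And>x. x \<in> S \<Longrightarrow> (g has_derivative g' x) (at x)" and cont: "isCont g' x0"
    and \<phi>': "\<And>x. x \<in> S \<Longrightarrow> (\<phi> has_derivative (\<lambda>v. d\<phi> x \<bullet> v)) (at x)" and dcont: "isCont d\<phi> x0"
    and reg: "\<And>n. n \<in> normal_cone K (g x0) \<Longrightarrow> (\<And>v. n \<bullet> g' x0 v = 0) \<Longrightarrow> n = 0"
    and opt: "\<And>x. x \<in> S \<Longrightarrow> g x \<in> K \<Longrightarrow> \<phi> x0 \<le> \<phi> x"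
  shows "\<exists>y\<in>normal_cone K (g x0). d\<phi> x0 + adjoint (g' x0) y = 0"
proof -
  obtain c e where ce: "c > 0" "e > 0"
    "\<And>x z n. dist x x0 \<le> e \<Longrightarrow> dist z (g x0) \<le> e \<Longrightarrow> n \<in> normal_cone K z \<Longrightarrow> c * norm n \<le> norm (adjoint (g' x) n)"
    using uniform_regularity[OF K(1) cont reg] by metis
  obtain \<rho> where \<rho>: "\<rho> > 0" "cball x0 \<rho> \<subseteq> S" using S open_contains_cball by metis
  have gcont: "continuous_on S g" and pcont: "continuous_on S \<phi>"
    using g' \<phi>' by (meson continuous_at_imp_continuous_on has_derivative_continuous)+
  note [continuous_intros] = continuous_on_subset[OF gcont \<rho>(2)] continuous_on_subset[OF pcont \<rho>(2)]
  define \<psi> where "\<psi> k x = \<phi> x + (norm (x - x0))\<^sup>2 / 2 + (real k / 2) * (infdist (g x) K)\<^sup>2" for k :: nat and x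
  have "\<exists>x\<in>cball x0 \<rho>. \<forall>z\<in>cball x0 \<rho>. \<psi> k x \<le> \<psi> k z" for k
    unfolding \<psi>_def using \<rho>(1) by (intro continuous_attains_inf compact_cball) (auto intro!: continuous_intros)
  then obtain x where x: "\<And>k. x k \<in> cball x0 \<rho>" "\<And>k z. z \<in> cball x0 \<rho> \<Longrightarrow> \<psi> k (x k) \<le> \<psi> k z"
    by metis
  have "\<exists>P. P \<in> K \<and> infdist (g (x k)) K = dist (g (x k)) P" for k
    using infdist_attains_inf[OF K(1)] K(3) by (metis empty_iff)
  then obtain P where P: "\<And>k. P k \<in> K" "\<And>k. infdist (g (x k)) K = dist (g (x k)) (P k)" by metis
  have psi_le: "\<phi> (x k) + (norm (x k - x0))\<^sup>2 / 2 + (real k / 2) * (dist (g (x k)) (P k))\<^sup>2 \<le> \<phi> x0" for k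
    using x(2)[of x0 k] \<rho>(1) K(3) P(2)[of k] by (simp add: \<psi>_def)
  obtain m where m: "\<And>z. z \<in> cball x0 \<rho> \<Longrightarrow> m \<le> \<phi> z"
  proof -
    have "\<exists>z\<in>cball x0 \<rho>. \<forall>w\<in>cball x0 \<rho>. \<phi> z \<le> \<phi> w"
      using \<rho>(1) by (intro continuous_attains_inf compact_cball) (auto intro!: continuous_intros)
    then show ?thesis using that by blast
  qed
  have "bounded (range x)"
    by (rule bounded_subset[OF bounded_cball[of x0 \<rho>]]) (use x(1) in auto)
  then obtain l r where r: "strict_mono r" "(x \<circ> r) \<longlonglongrightarrow> l"
    using bounded_imp_convergent_subsequence[of x] by auto
  have xr: "(\<lambda>k. x (r k)) \<longlonglongrightarrow> l" using r(2) by (simp add: o_def)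
  have l\<rho>: "l \<in> cball x0 \<rho>"
    by (rule closed_sequentially[OF closed_cball _ xr]) (rule x(1))
  then have lS: "l \<in> S" using \<rho>(2) by blast
  have cg: "isCont g z" and cp: "isCont \<phi> z" if "z \<in> S" for z
    using g'[OF that] \<phi>'[OF that] has_derivative_continuous by blast+
  have dist0: "(\<lambda>k. (dist (g (x (r k))) (P (r k)))\<^sup>2) \<longlonglongrightarrow> 0"
  proof (rule Lim_null_comparison)
    have "(\<lambda>k. 2 * (\<phi> x0 - m) / real k) \<longlonglongrightarrow> 0" by (rule lim_const_over_n)
    from LIMSEQ_subseq_LIMSEQ[OF this r(1)]
    show "(\<lambda>k. 2 * (\<phi> x0 - m) / real (r k)) \<longlonglongrightarrow> 0" by (simp add: o_def)
    show "\<forall>\<^sub>F k in sequentially. norm ((dist (g (x (r k))) (P (r k)))\<^sup>2) \<le> 2 * (\<phi> x0 - m) / real (r k)"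
    proof (rule eventually_sequentiallyI[of 1])
      fix k :: nat assume "1 \<le> k"
      then have rk: "0 < real (r k)" using seq_suble[OF r(1), of k] by linarith
      have "(real (r k) / 2) * (dist (g (x (r k))) (P (r k)))\<^sup>2 \<le> \<phi> x0 - m"
        using psi_le[of "r k"] m[OF x(1)[of "r k"]] zero_le_power2[of "norm (x (r k) - x0)"] by linarith
      then show "norm ((dist (g (x (r k))) (P (r k)))\<^sup>2) \<le> 2 * (\<phi> x0 - m) / real (r k)"
        using rk by (simp add: field_simps)
    qed
  qed
  have "(\<lambda>k. sqrt ((dist (g (x (r k))) (P (r k)))\<^sup>2)) \<longlonglongrightarrow> sqrt 0"
    by (rule tendsto_real_sqrt[OF dist0])
  then have dist0': "(\<lambda>k. dist (g (x (r k))) (P (r k))) \<longlonglongrightarrow> 0" by simp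
  have gl: "(\<lambda>k. g (x (r k))) \<longlonglongrightarrow> g l" by (rule isCont_tendsto_compose[OF cg[OF lS] xr])
  have "(\<lambda>k. g (x (r k)) - P (r k)) \<longlonglongrightarrow> 0"
    using dist0' by (simp add: dist_norm tendsto_norm_zero_iff)
  from tendsto_diff[OF gl this] have Pl: "(\<lambda>k. P (r k)) \<longlonglongrightarrow> g l" by simp
  have glK: "g l \<in> K" by (rule closed_sequentially[OF K(1) _ Pl]) (rule P(1))
  have "\<phi> l + (norm (l - x0))\<^sup>2 / 2 \<le> \<phi> x0"
  proof (rule LIMSEQ_le_const2)
    show "(\<lambda>k. \<phi> (x (r k)) + (norm (x (r k) - x0))\<^sup>2 / 2) \<longlonglongrightarrow> \<phi> l + (norm (l - x0))\<^sup>2 / 2"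
      by (intro tendsto_intros isCont_tendsto_compose[OF cp[OF lS] xr] xr) auto
    have "\<phi> (x (r k)) + (norm (x (r k) - x0))\<^sup>2 / 2 \<le> \<phi> x0" for k
    proof -
      have "0 \<le> real (r k) / 2 * (dist (g (x (r k))) (P (r k)))\<^sup>2" by simp
      then show ?thesis using psi_le[of "r k"] by linarith
    qed
    then show "\<exists>N. \<forall>k\<ge>N. \<phi> (x (r k)) + (norm (x (r k) - x0))\<^sup>2 / 2 \<le> \<phi> x0" by blast
  qed
  moreover have "\<phi> x0 \<le> \<phi> l" by (rule opt[OF lS glK])
  ultimately have "(norm (l - x0))\<^sup>2 \<le> 0" by linarith
  then have l: "l = x0" by simp
  define y where "y k = real (r k) *\<^sub>R (g (x (r k)) - P (r k))" for k
  have yN: "y k \<in> normal_cone K (P (r k))" for k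
    unfolding y_def
    by (intro scaleR_normal_cone nearest_point_normal[OF K(1,2)] P(1) P(2)[symmetric]) simp
  have "\<forall>\<^sub>F k in sequentially. dist (x (r k)) x0 < min \<rho> e"
    using xr \<rho>(1) ce(2) unfolding l by (intro tendstoD) auto
  moreover have "\<forall>\<^sub>F k in sequentially. dist (P (r k)) (g x0) < e"
    using Pl ce(2) unfolding l by (intro tendstoD) auto
  ultimately obtain N where N: "\<And>k. k \<ge> N \<Longrightarrow> dist (x (r k)) x0 < min \<rho> e \<and> dist (P (r k)) (g x0) < e"
    using eventually_conj unfolding eventually_sequentially
    by (metis (mono_tags, lifting) le_trans nle_le)
  have stat: "d\<phi> (x (r k)) + (x (r k) - x0) + adjoint (g' (x (r k))) (y k) = 0" if "k \<ge> N" for k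
  proof -
    let ?u = "x (r k)" and ?P = "P (r k)"
    \<comment> \<open>Replacing the distance to \<open>K\<close> by the distance to the point \<open>P (r k)\<close> keeps the minimiser and makes
      the objective differentiable.\<close>
    define h where "h z = \<phi> z + (norm (z - x0))\<^sup>2 / 2 + (real (r k) / 2) * (norm (g z - ?P))\<^sup>2" for z
    have uS: "?u \<in> S" using x(1) \<rho>(2) by blast
    have der: "(h has_derivative (\<lambda>v. d\<phi> ?u \<bullet> v + (?u - x0) \<bullet> v + real (r k) * ((g ?u - ?P) \<bullet> g' ?u v))) (at ?u)"
      unfolding h_def power2_norm_eq_inner
      by (auto intro!: derivative_eq_intros \<phi>'[OF uS] g'[OF uS] simp: fun_eq_iff inner_commute field_simps)
    have "h ?u \<le> h z" if "z \<in> ball x0 \<rho>" for z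
    proof -
      have "h ?u = \<psi> (r k) ?u" by (simp add: h_def \<psi>_def P(2) dist_norm)
      also have "\<dots> \<le> \<psi> (r k) z" using that by (intro x(2)) auto
      also have "\<dots> \<le> h z"
        unfolding h_def \<psi>_def using infdist_le[OF P(1)[of "r k"], of "g z"]
        by (intro add_left_mono mult_left_mono power_mono) (auto simp: dist_norm infdist_nonneg)
      finally show ?thesis .
    qed
    moreover have "?u \<in> ball x0 \<rho>" using N[OF that] by (simp add: dist_commute)
    ultimately have "(\<lambda>v. d\<phi> ?u \<bullet> v + (?u - x0) \<bullet> v + real (r k) * ((g ?u - ?P) \<bullet> g' ?u v)) = (\<lambda>v. 0)"
      using differential_zero_maxmin[OF _ open_ball der] by blast
    then have "(d\<phi> ?u + (?u - x0) + adjoint (g' ?u) (y k)) \<bullet> v = 0" for v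
      by (simp add: fun_eq_iff inner_add_left adjoint_blinfun y_def)
    then show ?thesis by (metis inner_eq_zero_iff)
  qed
  have cd: "(\<lambda>k. d\<phi> (x (r k)) + (x (r k) - x0)) \<longlonglongrightarrow> d\<phi> x0 + (x0 - x0)"
    using xr l by (intro tendsto_intros isCont_tendsto_compose[OF dcont]) auto
  then obtain B where B: "\<And>k. norm (d\<phi> (x (r k)) + (x (r k) - x0)) \<le> B"
    using convergent_imp_Bseq[OF convergentI[OF cd]] unfolding Bseq_def by blast
  have bd: "norm (y (k + N)) \<le> B / c" for k
  proof -
    have "c * norm (y (k + N)) \<le> norm (adjoint (g' (x (r (k + N)))) (y (k + N)))"
      using N[of "k + N"] by (intro ce(3)[OF _ _ yN]) auto
    also have "adjoint (g' (x (r (k + N)))) (y (k + N)) = - (d\<phi> (x (r (k + N))) + (x (r (k + N)) - x0))"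
      using stat[of "k + N"] by (simp only: eq_neg_iff_add_eq_0 add.commute le_add2)
    finally have "c * norm (y (k + N)) \<le> B" using B[of "k + N"] by (simp only: norm_minus_cancel)
    then show ?thesis using ce(1) by (simp add: field_simps)
  qed
  then have "bounded (range (\<lambda>k. y (k + N)))" by (auto simp: bounded_iff)
  then obtain yy s where s: "strict_mono s" "((\<lambda>k. y (k + N)) \<circ> s) \<longlonglongrightarrow> yy"
    using bounded_imp_convergent_subsequence[of "\<lambda>k. y (k + N)"] by auto
  define q where "q k = s k + N" for k
  have q: "strict_mono q" using s(1) by (simp add: q_def strict_mono_def)
  have yl: "(\<lambda>k. y (q k)) \<longlonglongrightarrow> yy" using s(2) by (simp add: o_def q_def)
  have Pq: "(\<lambda>k. P (r (q k))) \<longlonglongrightarrow> g x0" using LIMSEQ_subseq_LIMSEQ[OF Pl q] l by (simp add: o_def)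
  have xq: "(\<lambda>k. x (r (q k))) \<longlonglongrightarrow> x0" using LIMSEQ_subseq_LIMSEQ[OF xr q] l by (simp add: o_def)
  have "(\<lambda>k. d\<phi> (x (r (q k))) + (x (r (q k)) - x0) + adjoint (g' (x (r (q k)))) (y (q k)))
      \<longlonglongrightarrow> d\<phi> x0 + (x0 - x0) + adjoint (g' x0) yy"
    by (intro tendsto_intros tendsto_adjoint isCont_tendsto_compose[OF dcont xq]
        isCont_tendsto_compose[OF cont xq] xq yl)
  moreover have "d\<phi> (x (r (q k))) + (x (r (q k)) - x0) + adjoint (g' (x (r (q k)))) (y (q k)) = 0" for k
    by (rule stat) (simp add: q_def)
  ultimately have "d\<phi> x0 + adjoint (g' x0) yy = 0" by (simp add: LIMSEQ_const_iff)
  moreover have "yy \<in> normal_cone K (g x0)"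
    by (rule normal_cone_limit[OF K(1) _ yl Pq]) (rule yN)
  ultimately show ?thesis by blast
qed

section \<open>Gradients and Hessians\<close>

lemma C2_on_D:
  assumes "C2_on S g"
  obtains g' :: "'a::real_normed_vector \<Rightarrow> 'a \<Rightarrow>\<^sub>L 'b::real_normed_vector" and g'' where
    "\<And>x. x \<in> S \<Longrightarrow> (g has_derivative g' x) (at x)"
    "\<And>x. x \<in> S \<Longrightarrow> (g' has_derivative blinfun_apply (g'' x)) (at x)"
    "continuous_on S g'" "continuous_on S g''"
proof -
  obtain g' g'' where g: "\<forall>x\<in>S. (g has_derivative blinfun_apply (g' x)) (at x)"
    "\<forall>x\<in>S. (g' has_derivative blinfun_apply (g'' x)) (at x)" "continuous_on S g''"
    using assms by (auto simp: C2_on_def)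
  have "continuous_on S g'"
    using g(2) by (meson continuous_at_imp_continuous_on has_derivative_continuous)
  with g show ?thesis by (intro that[of g' g'']) auto
qed

lemma C2_on_add:
  assumes "C2_on S g" "C2_on S h"
  shows "C2_on S (\<lambda>x. g x + h x)"
proof -
  obtain g' g'' where g: "\<And>x. x \<in> S \<Longrightarrow> (g has_derivative blinfun_apply (g' x)) (at x)"
    "\<And>x. x \<in> S \<Longrightarrow> (g' has_derivative blinfun_apply (g'' x)) (at x)" "continuous_on S g''"
    using C2_on_D[OF assms(1)] by metis
  obtain h' h'' where h: "\<And>x. x \<in> S \<Longrightarrow> (h has_derivative blinfun_apply (h' x)) (at x)"
    "\<And>x. x \<in> S \<Longrightarrow> (h' has_derivative blinfun_apply (h'' x)) (at x)" "continuous_on S h''"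
    using C2_on_D[OF assms(2)] by metis
  show ?thesis
    unfolding C2_on_def
  proof (intro exI conjI ballI)
    show "open S" using assms(1) by (auto simp: C2_on_def)
    show "((\<lambda>x. g x + h x) has_derivative blinfun_apply (g' x + h' x)) (at x)" if "x \<in> S" for x
      using has_derivative_add[OF g(1) h(1), OF that that] by (simp add: plus_blinfun.rep_eq)
    show "((\<lambda>x. g' x + h' x) has_derivative blinfun_apply (g'' x + h'' x)) (at x)" if "x \<in> S" for x
      using has_derivative_add[OF g(2) h(2), OF that that] by (simp add: plus_blinfun.rep_eq)
    show "continuous_on S (\<lambda>x. g'' x + h'' x)" by (intro continuous_intros g h)
  qed
qed

text \<open>The derivative as an element of the space of bounded linear maps, where its continuity and
differentiability in the base point can be expressed.\<close>

definition bderiv :: "('a::euclidean_space \<Rightarrow> 'b::euclidean_space) \<Rightarrow> 'a \<Rightarrow> 'a \<Rightarrow>\<^sub>L 'b" where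
  "bderiv g x = Blinfun (fderiv g x)"

lemma C2_bderiv:
  assumes "C2_on UNIV g"
  shows "(g has_derivative bderiv g x) (at x)" "blinfun_apply (bderiv g x) = fderiv g x"
    "\<exists>g''. (bderiv g has_derivative blinfun_apply (g'' x)) (at x)" "isCont (bderiv g) x"
proof -
  obtain g' g'' where g: "\<And>x. (g has_derivative blinfun_apply (g' x)) (at x)"
    "\<And>x. (g' has_derivative blinfun_apply (g'' x)) (at x)"
    using C2_on_D[OF assms] by (metis UNIV_I)
  have "fderiv g x = blinfun_apply (g' x)" for x using frechet_derivative_at[OF g(1)] by simp
  then have "bderiv g x = g' x" for x by (simp add: bderiv_def blinfun_apply_inverse)
  then have eq: "bderiv g = g'" by (simp add: fun_eq_iff)
  show "(g has_derivative bderiv g x) (at x)" using g(1) by (simp add: eq)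
  show "blinfun_apply (bderiv g x) = fderiv g x" using frechet_derivative_at[OF g(1)] by (simp add: eq)
  show "\<exists>g''. (bderiv g has_derivative blinfun_apply (g'' x)) (at x)" unfolding eq using g(2) by blast
  show "isCont (bderiv g) x" unfolding eq using has_derivative_continuous[OF g(2)] .
qed

lemma C2_gradient:
  fixes \<phi> :: "'a::euclidean_space \<Rightarrow> real"
  assumes "C2_on UNIV \<phi>"
  shows "(\<phi> has_derivative (\<lambda>v. gradient \<phi> x \<bullet> v)) (at x)"
    and "(gradient \<phi> has_derivative bderiv (gradient \<phi>) x) (at x)"
    and "continuous_on UNIV (bderiv (gradient \<phi>))"
    and "blinfun_apply (bderiv (gradient \<phi>) x) = hessian \<phi> x"
    and "hessian \<phi> x u \<bullet> v = hessian \<phi> x v \<bullet> u"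
proof -
  obtain p' :: "'a \<Rightarrow> 'a \<Rightarrow>\<^sub>L real" and p'' where p: "\<And>x. (\<phi> has_derivative p' x) (at x)"
    "\<And>x. (p' has_derivative blinfun_apply (p'' x)) (at x)" "continuous_on UNIV p''"
    using C2_on_D[OF assms] by (metis UNIV_I)
  define R where "R l = (\<Sum>b\<in>Basis. blinfun_apply l b *\<^sub>R b)" for l :: "'a \<Rightarrow>\<^sub>L real"
  have blR: "bounded_linear R"
    unfolding R_def[abs_def]
    by (intro bounded_linear_sum bounded_linear_compose[OF bounded_linear_scaleR_left] blinfun.bounded_linear_left)
  have R: "R l \<bullet> v = l v" for l v
  proof -
    have "l v = l (\<Sum>b\<in>Basis. (v \<bullet> b) *\<^sub>R b)" by (simp add: euclidean_representation)
    also have "\<dots> = (\<Sum>b\<in>Basis. (v \<bullet> b) * l b)"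
      by (simp add: blinfun.sum_right blinfun.scaleR_right)
    finally show ?thesis by (simp add: R_def inner_sum_left inner_commute[of v] mult.commute)
  qed
  have grad: "gradient \<phi> x = R (p' x)" for x
  proof (rule gradient_eq)
    have "blinfun_apply (p' x) = (\<lambda>h. h \<bullet> R (p' x))" by (simp add: fun_eq_iff R inner_commute[of _ "R (p' x)"])
    then show "GDERIV \<phi> x :> R (p' x)" unfolding gderiv_def using p(1)[of x] by simp
  qed
  define D where "D x = Blinfun R o\<^sub>L p'' x" for x
  have D: "D x u = R (p'' x u)" for x u
    by (simp add: D_def bounded_linear_Blinfun_apply[OF blR])
  show "(\<phi> has_derivative (\<lambda>v. gradient \<phi> x \<bullet> v)) (at x)"
    using p(1)[of x] by (simp add: grad R)
  have "gradient \<phi> = (\<lambda>x. R (p' x))" by (simp add: fun_eq_iff grad)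
  moreover have "blinfun_apply (D x) = (\<lambda>u. R (p'' x u))" for x by (simp add: fun_eq_iff D)
  ultimately have D_deriv: "(gradient \<phi> has_derivative D x) (at x)" for x
    using bounded_linear.has_derivative[OF blR p(2)[of x]] by simp
  have fD: "fderiv (gradient \<phi>) x = blinfun_apply (D x)" for x
    using frechet_derivative_at[OF D_deriv] by simp
  have bD: "bderiv (gradient \<phi>) = D"
    by (rule ext) (simp add: bderiv_def fD blinfun_apply_inverse)
  show "(gradient \<phi> has_derivative bderiv (gradient \<phi>) x) (at x)" using D_deriv by (simp add: bD)
  show "continuous_on UNIV (bderiv (gradient \<phi>))"
    unfolding bD D_def by (intro continuous_intros p(3))
  show "blinfun_apply (bderiv (gradient \<phi>) x) = hessian \<phi> x"
    by (simp add: bD fD hessian_def)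
  show "hessian \<phi> x u \<bullet> v = hessian \<phi> x v \<bullet> u"
    using second_derivative_symmetric[OF open_UNIV _ p(1) p(2), of x u v] by (simp add: hessian_def fD D R)
qed

text \<open>A difference of two values near \<open>x0\<close> is linearised at \<open>x0\<close> itself, at neither of the two points:
this gives Lipschitz bounds for linearisation errors.\<close>

lemma strictly_differentiable:
  fixes \<phi> :: "'a::real_normed_vector \<Rightarrow> 'b::real_normed_vector" and \<phi>' :: "'a \<Rightarrow> 'a \<Rightarrow>\<^sub>L 'b"
  assumes S: "open S" "x0 \<in> S" and \<phi>': "\<And>x. x \<in> S \<Longrightarrow> (\<phi> has_derivative \<phi>' x) (at x)"
    and cont: "isCont \<phi>' x0" and "e > 0"
  obtains \<delta> where "\<delta> > 0" "\<And>x z. dist x x0 < \<delta> \<Longrightarrow> dist z x0 < \<delta> \<Longrightarrow>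
    norm (\<phi> x - \<phi> z - \<phi>' x0 (x - z)) \<le> e * norm (x - z)"
proof -
  obtain d1 where d1: "d1 > 0" "ball x0 d1 \<subseteq> S" using S openE by metis
  obtain d2 where d2: "d2 > 0" "\<And>x. dist x x0 < d2 \<Longrightarrow> dist (\<phi>' x) (\<phi>' x0) < e"
    using cont \<open>e > 0\<close> unfolding continuous_at_eps_delta by blast
  define d where "d = min d1 d2"
  show ?thesis
  proof (rule that)
    show "d > 0" using d1 d2 by (simp add: d_def)
    fix x z assume xz: "dist x x0 < d" "dist z x0 < d"
    have "norm ((\<lambda>u. \<phi> u - \<phi>' x0 u) x - (\<lambda>u. \<phi> u - \<phi>' x0 u) z) \<le> e * norm (x - z)"
    proof (rule differentiable_bound[OF convex_ball[of x0 d]])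
      fix u assume u: "u \<in> ball x0 d"
      then have "u \<in> S" using d1 by (auto simp: d_def)
      show "((\<lambda>u. \<phi> u - \<phi>' x0 u) has_derivative blinfun_apply (\<phi>' u - \<phi>' x0)) (at u within ball x0 d)"
        using has_derivative_at_withinI[OF \<phi>'[OF \<open>u \<in> S\<close>]]
        by (auto intro!: derivative_eq_intros simp: fun_eq_iff blinfun.diff_left)
      show "onorm (blinfun_apply (\<phi>' u - \<phi>' x0)) \<le> e"
        using d2(2)[of u] u by (simp add: norm_blinfun.rep_eq[symmetric] dist_norm d_def norm_minus_commute)
    qed (use xz in \<open>auto simp: dist_commute\<close>)
    then show "norm (\<phi> x - \<phi> z - \<phi>' x0 (x - z)) \<le> e * norm (x - z)"
      by (simp add: blinfun.diff_right algebra_simps)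
  qed
qed

section \<open>Cone charts\<close>

lemma normal_cone_convex_cone:
  assumes "convex_cone Q"
  shows "n \<in> normal_cone Q q \<longleftrightarrow> q \<in> Q \<and> (\<forall>c\<in>Q. n \<bullet> c \<le> 0) \<and> n \<bullet> q = 0"
proof
  assume n: "n \<in> normal_cone Q q"
  then have q: "q \<in> Q" by (rule normal_cone_point)
  have "n \<bullet> (0 - q) \<le> 0" "n \<bullet> (2 *\<^sub>R q - q) \<le> 0"
    using normal_coneD[OF n convex_cone_contains_0[OF assms]]
      normal_coneD[OF n convex_cone_scaleR[OF assms _ q, of 2]] by simp_all
  then have nq: "n \<bullet> q = 0" by (simp add: scaleR_2)
  moreover have "n \<bullet> c \<le> 0" if "c \<in> Q" for c
    using normal_coneD[OF n that] nq by (simp add: inner_diff_right)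
  ultimately show "q \<in> Q \<and> (\<forall>c\<in>Q. n \<bullet> c \<le> 0) \<and> n \<bullet> q = 0" using q by blast
qed (auto simp: normal_cone_def inner_diff_right)

lemma positive_null_sequence:
  obtains t :: "nat \<Rightarrow> real" where "\<And>k. t k > 0" "t \<longlonglongrightarrow> 0" "\<And>k. t k \<le> 1"
proof
  show "inverse (real (Suc k)) > 0" "inverse (real (Suc k)) \<le> 1" for k
    by (simp_all add: inverse_le_1_iff)
qed (rule LIMSEQ_inverse_real_of_nat)

text \<open>A chart that straightens \<open>K\<close> near \<open>A0\<close> to the cone \<open>Q\<close> in the same space. Normalising the derivative
at \<open>A0\<close> to the identity makes \<open>Q\<close> the tangent cone of \<open>K\<close> and leaves \<open>\<Phi>''\<close> as the only trace of
curvature.\<close>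

locale cone_chart =
  fixes K Q W V :: "'y::euclidean_space set" and A0 :: 'y and \<Phi> \<Psi> :: "'y \<Rightarrow> 'y"
    and \<Phi>' :: "'y \<Rightarrow> 'y \<Rightarrow>\<^sub>L 'y" and \<Phi>'' :: "'y \<Rightarrow>\<^sub>L 'y \<Rightarrow>\<^sub>L 'y"
  assumes K: "closed K" "convex K" and A0: "A0 \<in> W" "\<Phi> A0 = 0"
    and Q: "closed Q" "convex_cone Q"
    and W: "open W" and V: "open V" and hom: "homeomorphism W V \<Phi> \<Psi>"
    and \<Phi>': "\<And>A. A \<in> W \<Longrightarrow> (\<Phi> has_derivative \<Phi>' A) (at A)"
    and \<Phi>'': "(\<Phi>' has_derivative \<Phi>'') (at A0)" and \<Phi>'_A0: "\<Phi>' A0 = id_blinfun"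
    and \<Psi>': "\<And>A. A \<in> W \<Longrightarrow> \<exists>D. (\<Psi> has_derivative D) (at (\<Phi> A)) \<and> (\<forall>v. \<Phi>' A (D v) = v)"
    and K_iff: "\<And>A. A \<in> W \<Longrightarrow> A \<in> K \<longleftrightarrow> \<Phi> A \<in> Q"
begin

lemma Phi_Psi: "q \<in> V \<Longrightarrow> \<Phi> (\<Psi> q) = q" "q \<in> V \<Longrightarrow> \<Psi> q \<in> W"
  and Psi_Phi: "A \<in> W \<Longrightarrow> \<Psi> (\<Phi> A) = A" "A \<in> W \<Longrightarrow> \<Phi> A \<in> V"
  using hom by (auto simp: homeomorphism_def)

lemma zero_V: "0 \<in> V"
  using Psi_Phi(2)[OF A0(1)] A0(2) by simp

lemma Psi_0: "\<Psi> 0 = A0"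
  using Psi_Phi(1)[OF A0(1)] A0(2) by simp

lemma Psi_in_K: "q \<in> V \<Longrightarrow> q \<in> Q \<Longrightarrow> \<Psi> q \<in> K"
  using K_iff[OF Phi_Psi(2)] Phi_Psi(1) by simp

lemma zero_Q: "0 \<in> Q" using Q(2) by (rule convex_cone_contains_0)

lemma A0_K: "A0 \<in> K" using K_iff[OF A0(1)] A0(2) zero_Q by simp

lemma scale_Q: "0 \<le> c \<Longrightarrow> q \<in> Q \<Longrightarrow> c *\<^sub>R q \<in> Q"
  using Q(2) by (rule convex_cone_scaleR)

lemma add_Q: "p \<in> Q \<Longrightarrow> q \<in> Q \<Longrightarrow> p + q \<in> Q"
  using Q(2) by (rule convex_cone_add)

lemma Phi_deriv_A0: "(\<Phi> has_derivative (\<lambda>v. v)) (at A0)"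
  using \<Phi>'[OF A0(1)] by (simp add: \<Phi>'_A0 id_blinfun.rep_eq)

lemma Psi_deriv_0: "(\<Psi> has_derivative (\<lambda>v. v)) (at 0)"
proof -
  obtain D where D: "(\<Psi> has_derivative D) (at 0)" "\<And>v. D v = v"
    using \<Psi>'[OF A0(1)] by (auto simp: A0(2) \<Phi>'_A0 id_blinfun.rep_eq)
  then have "D = (\<lambda>v. v)" by auto
  then show ?thesis using D(1) by simp
qed

lemma Phi_scaled_limit:
  assumes "\<And>k. t k > 0" "t \<longlonglongrightarrow> 0" "(\<lambda>k. (A k - A0) /\<^sub>R t k) \<longlonglongrightarrow> h"
  shows "(\<lambda>k. \<Phi> (A k) /\<^sub>R t k) \<longlonglongrightarrow> h"
  using has_derivative_scaled_limit[OF Phi_deriv_A0 assms] by (simp add: A0(2))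

lemma Psi_scaled_limit:
  assumes "\<And>k. t k > 0" "t \<longlonglongrightarrow> 0" "(\<lambda>k. q k /\<^sub>R t k) \<longlonglongrightarrow> h"
  shows "(\<lambda>k. (\<Psi> (q k) - A0) /\<^sub>R t k) \<longlonglongrightarrow> h"
  using has_derivative_scaled_limit[OF Psi_deriv_0 assms(1,2), of q h] assms(3) by (simp add: Psi_0)

lemma eventually_W:
  assumes "\<And>k. t k > 0" "t \<longlonglongrightarrow> 0" "(\<lambda>k. (A k - A0) /\<^sub>R t k) \<longlonglongrightarrow> h"
  shows "\<forall>\<^sub>F k in sequentially. A k \<in> W"
  by (rule topological_tendstoD[OF tendsto_scaled_imp_tendsto[OF assms(2,3,1)] W A0(1)])

lemma eventually_V:
  assumes "\<And>k. t k > 0" "t \<longlonglongrightarrow> 0" "(\<lambda>k. q k /\<^sub>R t k) \<longlonglongrightarrow> h"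
  shows "\<forall>\<^sub>F k in sequentially. q k \<in> V"
  using topological_tendstoD[OF tendsto_scaled_imp_tendsto[of t q 0 h] V zero_V] assms by simp

lemma tangent_direction_in_Q:
  assumes "\<And>k. t k > 0" "t \<longlonglongrightarrow> 0" "(\<lambda>k. (A k - A0) /\<^sub>R t k) \<longlonglongrightarrow> h" "\<And>k. A k \<in> K"
  shows "h \<in> Q"
proof (rule Lim_in_closed_set[OF Q(1) _ _ Phi_scaled_limit[OF assms(1-3)]])
  show "\<forall>\<^sub>F k in sequentially. \<Phi> (A k) /\<^sub>R t k \<in> Q"
    using eventually_W[OF assms(1-3)]
  proof eventually_elim
    case (elim k)
    then have "\<Phi> (A k) \<in> Q" using K_iff[OF elim] assms(4) by simp
    then show ?case using assms(1)[of k] by (intro scale_Q) auto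
  qed
qed simp

lemma Q_direction_realised:
  assumes "h \<in> Q" and t: "\<And>k. t k > 0" "t \<longlonglongrightarrow> 0"
  shows "\<forall>\<^sub>F k in sequentially. \<Psi> (t k *\<^sub>R h) \<in> K"
    and "(\<lambda>k. (\<Psi> (t k *\<^sub>R h) - A0) /\<^sub>R t k) \<longlonglongrightarrow> h"
proof -
  have "(t k *\<^sub>R h) /\<^sub>R t k = h" for k using t(1)[of k] by simp
  then have lim: "(\<lambda>k. (t k *\<^sub>R h) /\<^sub>R t k) \<longlonglongrightarrow> h" by simp
  show "(\<lambda>k. (\<Psi> (t k *\<^sub>R h) - A0) /\<^sub>R t k) \<longlonglongrightarrow> h" by (rule Psi_scaled_limit[OF t lim])
  show "\<forall>\<^sub>F k in sequentially. \<Psi> (t k *\<^sub>R h) \<in> K"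
    using eventually_V[OF t lim]
  proof eventually_elim
    case (elim k)
    then show ?case using t(1)[of k] assms(1) by (intro Psi_in_K scale_Q) auto
  qed
qed

lemma tangent_cone_eq: "tangent_cone K A0 = Q"
proof (intro set_eqI iffI)
  fix h assume "h \<in> tangent_cone K A0"
  then obtain A t where "\<forall>k. A k \<in> K" "\<forall>k::nat. t k > 0" "t \<longlonglongrightarrow> 0" "(\<lambda>k. (A k - A0) /\<^sub>R t k) \<longlonglongrightarrow> h"
    by (auto simp: tangent_cone_def)
  then show "h \<in> Q" by (intro tangent_direction_in_Q[of t A h]) auto
next
  fix h assume h: "h \<in> Q"
  obtain t :: "nat \<Rightarrow> real" where t: "\<And>k. t k > 0" "t \<longlonglongrightarrow> 0"
    using positive_null_sequence by metis
  obtain N where N: "\<And>k. k \<ge> N \<Longrightarrow> \<Psi> (t k *\<^sub>R h) \<in> K"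
    using Q_direction_realised(1)[OF h t] by (auto simp: eventually_sequentially)
  define A where "A k = \<Psi> (t (k + N) *\<^sub>R h)" for k
  have "\<forall>k. A k \<in> K" "\<forall>k. t (k + N) > 0" using N t by (auto simp: A_def)
  moreover have "(\<lambda>k. t (k + N)) \<longlonglongrightarrow> 0" using t(2) by (rule LIMSEQ_ignore_initial_segment)
  moreover have lim: "(\<lambda>k. (A k - A0) /\<^sub>R t (k + N)) \<longlonglongrightarrow> h"
    using LIMSEQ_ignore_initial_segment[OF Q_direction_realised(2)[OF h t], of N] by (simp add: A_def)
  moreover have "A \<longlonglongrightarrow> A0"
    by (rule tendsto_scaled_imp_tendsto[OF LIMSEQ_ignore_initial_segment[OF t(2)] lim t(1)])
  ultimately show "h \<in> tangent_cone K A0"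
    unfolding tangent_cone_def by (intro CollectI exI[of _ A] exI[of _ "\<lambda>k. t (k + N)"]) simp
qed

lemma normal_cone_eq: "normal_cone K A0 = {y. \<forall>q\<in>Q. y \<bullet> q \<le> 0}"
proof (intro set_eqI iffI, safe)
  fix y q assume y: "y \<in> normal_cone K A0" and q: "q \<in> Q"
  then have "q \<in> tangent_cone K A0" by (simp add: tangent_cone_eq)
  then obtain A t where "\<forall>k. A k \<in> K" "\<forall>k::nat. t k > 0" and lim: "(\<lambda>k. (A k - A0) /\<^sub>R t k) \<longlonglongrightarrow> q"
    by (auto simp: tangent_cone_def)
  then have At: "A k \<in> K" "t k > 0" for k by auto
  show "y \<bullet> q \<le> 0"
  proof (rule LIMSEQ_le_const2)
    show "(\<lambda>k. y \<bullet> ((A k - A0) /\<^sub>R t k)) \<longlonglongrightarrow> y \<bullet> q" by (intro tendsto_intros lim)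
    have "y \<bullet> ((A k - A0) /\<^sub>R t k) \<le> 0" for k
      using normal_coneD[OF y At(1)[of k]] At(2)[of k] by (simp add: mult_le_0_iff)
    then show "\<exists>N. \<forall>k\<ge>N. y \<bullet> ((A k - A0) /\<^sub>R t k) \<le> 0" by simp
  qed
next
  fix y assume y: "\<forall>q\<in>Q. y \<bullet> q \<le> 0"
  obtain t :: "nat \<Rightarrow> real" where t: "\<And>k. t k > 0" "t \<longlonglongrightarrow> 0" "\<And>k. t k \<le> 1"
    using positive_null_sequence by metis
  have "y \<bullet> (B - A0) \<le> 0" if B: "B \<in> K" for B
  proof -
    have "(A0 + t k *\<^sub>R (B - A0) - A0) /\<^sub>R t k = B - A0" for k using t(1)[of k] by simp
    then have "(\<lambda>k. (A0 + t k *\<^sub>R (B - A0) - A0) /\<^sub>R t k) \<longlonglongrightarrow> B - A0" by simp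
    moreover have "A0 + t k *\<^sub>R (B - A0) \<in> K" for k
      using convexD_alt[OF K(2) A0_K B, of "t k"] t(1,3)[of k] by (simp add: algebra_simps)
    ultimately have "B - A0 \<in> Q" by (intro tangent_direction_in_Q[OF t(1,2)])
    then show ?thesis using y by blast
  qed
  then show "y \<in> normal_cone K A0" by (simp add: normal_cone_def A0_K)
qed

text \<open>A convex set is star shaped around \<open>A\<close>, so the inequality for all of \<open>K\<close> follows from the
infinitesimal one along segments, which stay in the domain of the chart.\<close>

lemma normal_cone_pullback:
  assumes A: "A \<in> W" and \<mu>: "\<mu> \<in> normal_cone Q (\<Phi> A)"
  shows "adjoint (\<Phi>' A) \<mu> \<in> normal_cone K A"
proof -
  have AK: "A \<in> K" using K_iff[OF A] normal_cone_point[OF \<mu>] by simp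
  obtain t :: "nat \<Rightarrow> real" where t: "\<And>k. t k > 0" "t \<longlonglongrightarrow> 0" "\<And>k. t k \<le> 1"
    using positive_null_sequence by metis
  have "adjoint (\<Phi>' A) \<mu> \<bullet> (B - A) \<le> 0" if B: "B \<in> K" for B
  proof -
    define z where "z k = A + t k *\<^sub>R (B - A)" for k
    have zK: "z k \<in> K" for k
      using convexD_alt[OF K(2) AK B, of "t k"] t(1,3)[of k] by (simp add: algebra_simps z_def)
    have "(z k - A) /\<^sub>R t k = B - A" for k using t(1)[of k] by (simp add: z_def)
    then have lim: "(\<lambda>k. (z k - A) /\<^sub>R t k) \<longlonglongrightarrow> B - A" by simp
    have "\<mu> \<bullet> \<Phi>' A (B - A) \<le> 0"
    proof (rule tendsto_upperbound)
      show "(\<lambda>k. \<mu> \<bullet> ((\<Phi> (z k) - \<Phi> A) /\<^sub>R t k)) \<longlonglongrightarrow> \<mu> \<bullet> \<Phi>' A (B - A)"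
        by (intro tendsto_intros has_derivative_scaled_limit[OF \<Phi>'[OF A] t(1,2) lim])
      have "\<forall>\<^sub>F k in sequentially. z k \<in> W"
        by (rule topological_tendstoD[OF tendsto_scaled_imp_tendsto[OF t(2) lim t(1)] W A])
      then show "\<forall>\<^sub>F k in sequentially. \<mu> \<bullet> ((\<Phi> (z k) - \<Phi> A) /\<^sub>R t k) \<le> 0"
      proof eventually_elim
        case (elim k)
        then have "\<mu> \<bullet> (\<Phi> (z k) - \<Phi> A) \<le> 0" using normal_coneD[OF \<mu>] zK K_iff by blast
        then show ?case using t(1)[of k] by (simp add: mult_le_0_iff)
      qed
    qed simp
    then show ?thesis by (simp add: adjoint_blinfun)
  qed
  then show ?thesis by (simp add: normal_cone_def AK)
qed

text \<open>The inverse chart maps the segment from \<open>\<Phi> A\<close> in direction \<open>c\<close> to a curve in \<open>K\<close> whose initial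
velocity \<open>v\<close> satisfies \<open>\<Phi>' A v = c\<close>. Testing normals with such velocities avoids a representation
of all normals of \<open>K\<close> through normals of \<open>Q\<close>.\<close>

lemma normal_cone_test_direction:
  assumes A: "A \<in> W" and y: "y \<in> normal_cone K A" and r: "r > 0"
    and feas: "\<And>s. 0 < s \<Longrightarrow> s \<le> r \<Longrightarrow> \<Phi> A + s *\<^sub>R c \<in> Q"
  obtains v where "\<Phi>' A v = c" "y \<bullet> v \<le> 0"
proof -
  obtain D where D: "(\<Psi> has_derivative D) (at (\<Phi> A))" "\<And>v. \<Phi>' A (D v) = v"
    using \<Psi>'[OF A] by auto
  obtain t' :: "nat \<Rightarrow> real" where t': "\<And>k. t' k > 0" "t' \<longlonglongrightarrow> 0" "\<And>k. t' k \<le> 1"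
    using positive_null_sequence by metis
  define t where "t k = r * t' k" for k
  have t: "t k > 0" "t k \<le> r" for k
    using mult_pos_pos[OF r t'(1)] mult_left_mono[OF t'(3), of r k] r by (simp_all add: t_def)
  have t0: "t \<longlonglongrightarrow> 0"
    unfolding t_def using tendsto_mult_left[OF t'(2), of r] by simp
  define q where "q k = \<Phi> A + t k *\<^sub>R c" for k
  have "(q k - \<Phi> A) /\<^sub>R t k = c" for k using t(1)[of k] by (simp add: q_def)
  then have lim: "(\<lambda>k. (q k - \<Phi> A) /\<^sub>R t k) \<longlonglongrightarrow> c" by simp
  have "y \<bullet> D c \<le> 0"
  proof (rule tendsto_upperbound)
    show "(\<lambda>k. y \<bullet> ((\<Psi> (q k) - \<Psi> (\<Phi> A)) /\<^sub>R t k)) \<longlonglongrightarrow> y \<bullet> D c"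
      by (intro tendsto_intros has_derivative_scaled_limit[OF D(1) t(1) t0 lim])
    have "\<forall>\<^sub>F k in sequentially. q k \<in> V"
      by (rule topological_tendstoD[OF tendsto_scaled_imp_tendsto[OF t0 lim t(1)] V Psi_Phi(2)[OF A]])
    then show "\<forall>\<^sub>F k in sequentially. y \<bullet> ((\<Psi> (q k) - \<Psi> (\<Phi> A)) /\<^sub>R t k) \<le> 0"
    proof eventually_elim
      case (elim k)
      have "\<Psi> (q k) \<in> K" using elim feas[OF t(1,2)] by (intro Psi_in_K) (auto simp: q_def)
      then have "y \<bullet> (\<Psi> (q k) - \<Psi> (\<Phi> A)) \<le> 0" using normal_coneD[OF y] by (simp add: Psi_Phi(1)[OF A])
      then show ?case using t(1)[of k] by (simp add: mult_le_0_iff)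
    qed
  qed simp
  then show ?thesis using that D(2) by blast
qed

end

text \<open>The reduction \<open>\<Xi>\<close> has values in a space \<open>Z\<close> of possibly smaller dimension. With \<open>D = \<Xi>' A0\<close> and a
right inverse \<open>S\<close> of \<open>D\<close> on \<open>Z\<close>, the map \<open>\<Phi> A = S (\<Xi> A) + (A - A0) - S (D (A - A0))\<close> completes it by
the affine coordinates along the kernel of \<open>D\<close>. Its derivative at \<open>A0\<close> is the identity, so that the
inverse function theorem applies, and \<open>D (\<Phi> A) = \<Xi> A\<close>, so that \<open>K\<close> corresponds to the preimage of the
cone of \<open>\<Xi>\<close> under \<open>D\<close>.\<close>

lemma cone_reducible_at_chart:
  fixes K :: "'y::euclidean_space set"
  assumes K: "closed K" "convex K" "A0 \<in> K" and red: "cone_reducible_at K A0"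
  obtains Q W V \<Phi> \<Psi> \<Phi>' \<Phi>'' where "cone_chart K Q W V A0 \<Phi> \<Psi> \<Phi>' \<Phi>''"
proof -
  obtain U Z P and \<Xi> :: "'y \<Rightarrow> 'y" where U: "open U" "A0 \<in> U" and Z: "subspace Z" "P \<subseteq> Z"
    and P: "closed P" "convex_cone P" and \<Xi>: "\<Xi> ` U \<subseteq> Z" "C2_on U \<Xi>" "\<Xi> A0 = 0"
    and onto: "range (fderiv \<Xi> A0) = Z" and KU: "K \<inter> U = {B \<in> U. \<Xi> B \<in> P}"
    using red unfolding cone_reducible_at_def by (elim exE conjE) (rule that)
  obtain \<Xi>' :: "'y \<Rightarrow> 'y \<Rightarrow>\<^sub>L 'y" and \<Xi>'' where \<Xi>': "\<And>A. A \<in> U \<Longrightarrow> (\<Xi> has_derivative blinfun_apply (\<Xi>' A)) (at A)"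
    and \<Xi>'': "\<And>A. A \<in> U \<Longrightarrow> (\<Xi>' has_derivative blinfun_apply (\<Xi>'' A)) (at A)"
    and cont: "continuous_on U \<Xi>'"
    using C2_on_D[OF \<Xi>(2)] by metis
  define D where "D = \<Xi>' A0"
  have D_range: "range D = Z"
    using onto frechet_derivative_at[OF \<Xi>'[OF U(2)]] by (simp add: D_def)
  have "linear D" by (simp add: bounded_linear.linear blinfun.bounded_linear_right)
  then obtain S0 where S0: "linear S0" "\<And>z. z \<in> Z \<Longrightarrow> D (S0 z) = z"
    using linear_exists_right_inverse_on[of D UNIV] D_range subspace_UNIV by metis
  define S where "S = Blinfun S0"
  have S: "blinfun_apply S = S0"
    using S0(1) by (simp add: S_def bounded_linear_Blinfun_apply linear_conv_bounded_linear)
  define \<Phi> where "\<Phi> A = S (\<Xi> A) + (A - A0) - S (D (A - A0))" for A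
  define \<Phi>' where "\<Phi>' A = (S o\<^sub>L \<Xi>' A) + (id_blinfun - (S o\<^sub>L D))" for A
  define L where "L = Blinfun (\<lambda>T :: 'y \<Rightarrow>\<^sub>L 'y. S o\<^sub>L T)"
  have L: "blinfun_apply L = (\<lambda>T. S o\<^sub>L T)"
    unfolding L_def
    by (rule bounded_linear_Blinfun_apply)
      (rule bounded_bilinear.bounded_linear_right[OF bounded_bilinear_blinfun_compose])
  have d1: "(\<Phi> has_derivative \<Phi>' A) (at A)" if "A \<in> U" for A
  proof -
    have h1: "((\<lambda>A. S (\<Xi> A)) has_derivative (\<lambda>v. S (\<Xi>' A v))) (at A)"
      by (rule bounded_linear.has_derivative[OF blinfun.bounded_linear_right \<Xi>'[OF that]])
    have h2: "((\<lambda>A. S (D (A - A0))) has_derivative (\<lambda>v. S (D v))) (at A)"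
      by (intro bounded_linear.has_derivative[OF blinfun.bounded_linear_right])
         (auto intro!: derivative_eq_intros)
    have "((\<lambda>A. A - A0) has_derivative (\<lambda>v. v)) (at A)"
      by (auto intro!: derivative_eq_intros)
    from has_derivative_diff[OF has_derivative_add[OF h1 this] h2]
    have "(\<Phi> has_derivative (\<lambda>v. S (\<Xi>' A v) + v - S (D v))) (at A)"
      unfolding \<Phi>_def[abs_def] .
    moreover have "blinfun_apply (\<Phi>' A) = (\<lambda>v. S (\<Xi>' A v) + v - S (D v))"
      by (simp add: fun_eq_iff \<Phi>'_def blinfun.bilinear_simps blinfun_compose.rep_eq)
    ultimately show ?thesis by simp
  qed
  have d2: "(\<Phi>' has_derivative blinfun_apply (L o\<^sub>L \<Xi>'' A0)) (at A0)"
  proof -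
    have "((\<lambda>A. L (\<Xi>' A)) has_derivative (\<lambda>v. L (\<Xi>'' A0 v))) (at A0)"
      by (rule bounded_linear.has_derivative[OF blinfun.bounded_linear_right \<Xi>''[OF U(2)]])
    from has_derivative_add[OF this has_derivative_const[of "id_blinfun - (S o\<^sub>L D)"]]
    have "(\<Phi>' has_derivative (\<lambda>v. L (\<Xi>'' A0 v))) (at A0)"
      by (simp add: L \<Phi>'_def[abs_def])
    moreover have "blinfun_apply (L o\<^sub>L \<Xi>'' A0) = (\<lambda>v. L (\<Xi>'' A0 v))"
      by (simp add: fun_eq_iff blinfun_compose.rep_eq)
    ultimately show ?thesis by simp
  qed
  have \<Phi>'_cont: "continuous_on U \<Phi>'" unfolding \<Phi>'_def by (intro continuous_intros cont)
  have \<Phi>'_A0: "\<Phi>' A0 = id_blinfun" by (simp add: \<Phi>'_def D_def)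
  have "id_blinfun o\<^sub>L \<Phi>' A0 = id_blinfun" by (rule blinfun_eqI) (simp add: \<Phi>'_A0)
  then obtain W V \<Psi> \<Psi>' where W: "open W" "W \<subseteq> U" "A0 \<in> W" and V: "open V"
    and hom: "homeomorphism W V \<Phi> \<Psi>"
    and dPsi: "\<And>q. q \<in> V \<Longrightarrow> (\<Psi> has_derivative \<Psi>' q) (at q)"
      "\<And>q. q \<in> V \<Longrightarrow> \<Psi>' q = inv (blinfun_apply (\<Phi>' (\<Psi> q)))"
      "\<And>q. q \<in> V \<Longrightarrow> bij (blinfun_apply (\<Phi>' (\<Psi> q)))"
    using inverse_function_theorem[OF U(1) d1 \<Phi>'_cont U(2)] by metis
  have D_Phi: "D (\<Phi> A) = \<Xi> A" if "A \<in> U" for A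
  proof -
    have "\<Xi> A \<in> Z" "D (A - A0) \<in> Z" using \<Xi>(1) that D_range by auto
    then show ?thesis by (simp add: \<Phi>_def blinfun.bilinear_simps S S0(2))
  qed
  define Q where "Q = blinfun_apply D -` P"
  have "cone_chart K Q W V A0 \<Phi> \<Psi> \<Phi>' (L o\<^sub>L \<Xi>'' A0)"
  proof
    show "closed Q" unfolding Q_def by (intro closed_vimage P continuous_intros)
    show "convex_cone Q"
      using convex_cone_contains_0[OF P(2)] convex_cone_add[OF P(2)] convex_cone_scaleR[OF P(2)]
      unfolding Q_def convex_cone_iff by (auto simp: blinfun.bilinear_simps)
    show "\<Phi> A0 = 0" by (simp add: \<Phi>_def \<Xi>(3) blinfun.bilinear_simps)
    fix A assume A: "A \<in> W"
    show "(\<Phi> has_derivative blinfun_apply (\<Phi>' A)) (at A)" using d1 W A by blast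
    have "\<Phi> A \<in> V" "\<Psi> (\<Phi> A) = A" using hom A by (auto simp: homeomorphism_def)
    then show "\<exists>E. (\<Psi> has_derivative E) (at (\<Phi> A)) \<and> (\<forall>v. blinfun_apply (\<Phi>' A) (E v) = v)"
      using dPsi[of "\<Phi> A"] by (intro exI[of _ "\<Psi>' (\<Phi> A)"]) (simp add: bij_is_surj surj_f_inv_f)
    have "A \<in> U" using A W(2) by blast
    moreover from this have "A \<in> K \<longleftrightarrow> \<Xi> A \<in> P" using KU by blast
    ultimately show "A \<in> K \<longleftrightarrow> \<Phi> A \<in> Q" by (simp add: Q_def D_Phi)
  qed (use K W V hom d2 \<Phi>'_A0 in auto)
  then show ?thesis by (rule that)
qed

section \<open>Second order behaviour of the normal cone at a chart point\<close>

locale charted_normal = cone_chart K Q W V A0 \<Phi> \<Psi> \<Phi>' \<Phi>''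
  for K Q W V :: "'y::euclidean_space set" and A0 \<Phi> \<Psi> \<Phi>' \<Phi>'' +
  fixes yb :: 'y
  assumes yb: "yb \<in> normal_cone K A0"
begin

text \<open>The image space counterpart of the critical cone: a direction \<open>d\<close> is critical for the optimisation
problem exactly if \<open>G'(xb) d\<close> belongs to this set.\<close>

definition critical :: "'y set" where "critical = {h \<in> Q. h \<bullet> yb = 0}"

text \<open>The Hessian of \<open>A \<mapsto> yb \<bullet> \<Phi> A\<close> at \<open>A0\<close>, as an operator.\<close>

definition curv :: "'y \<Rightarrow> 'y" where "curv h = adjoint (\<Phi>'' h) yb"

lemma inner_curv: "curv h \<bullet> v = yb \<bullet> \<Phi>'' h v"
  by (simp add: curv_def adjoint_blinfun)

lemma inner_curv_sym: "curv u \<bullet> v = curv v \<bullet> u"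
  using second_derivative_symmetric[OF W A0(1) \<Phi>' \<Phi>'', of u v] by (simp add: inner_curv)

lemma linear_curv: "linear curv"
proof (rule linearI)
  have "curv (u + v) \<bullet> w = (curv u + curv v) \<bullet> w" for u v w
    by (simp add: inner_curv inner_add_left blinfun.bilinear_simps inner_add_right)
  then show "curv (u + v) = curv u + curv v" for u v by (rule iffD1[OF vector_eq_rdot, OF allI])
  have "curv (c *\<^sub>R u) \<bullet> w = (c *\<^sub>R curv u) \<bullet> w" for u c w
    by (simp add: inner_curv blinfun.bilinear_simps)
  then show "curv (c *\<^sub>R u) = c *\<^sub>R curv u" for c u by (rule iffD1[OF vector_eq_rdot, OF allI])
qed

lemma yb_polar: "q \<in> Q \<Longrightarrow> yb \<bullet> q \<le> 0"
  using yb by (simp add: normal_cone_eq)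

lemma closed_critical: "closed critical"
proof -
  have "closed (Q \<inter> {h. yb \<bullet> h = 0})" by (intro closed_Int Q(1) closed_hyperplane)
  moreover have "critical = Q \<inter> {h. yb \<bullet> h = 0}" by (auto simp: critical_def inner_commute)
  ultimately show ?thesis by simp
qed

lemma convex_cone_critical: "convex_cone critical"
  unfolding convex_cone_iff critical_def by (simp add: inner_add_left zero_Q add_Q scale_Q)

text \<open>Test the normals \<open>y k\<close> with velocities \<open>v k\<close> for which \<open>\<Phi>' (A k) (v k) = c\<close>. Because
\<open>\<Phi>' (A k) = id + t k \<Phi>'' h + o(t k)\<close>, dividing the difference of \<open>y k \<bullet> v k \<le> 0\<close> and
\<open>0 \<le> yb \<bullet> c\<close> by \<open>t k\<close> yields \<open>\<eta> \<bullet> c \<le> curv h \<bullet> c\<close>. The choice of any critical \<open>c\<close> gives the polarity of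
\<open>\<eta> - curv h\<close>. For its orthogonality to \<open>h\<close> the direction \<open>- h\<close> is needed; it is the limit of the
feasible directions \<open>- \<Phi> (A k) / t k\<close>, which shrink the point of the cone towards the origin.\<close>

lemma normal_cone_graph_derivative:
  assumes t: "\<And>k. t k > 0" "t \<longlonglongrightarrow> 0"
    and A: "(\<lambda>k. (A k - A0) /\<^sub>R t k) \<longlonglongrightarrow> h" and y: "(\<lambda>k. (y k - yb) /\<^sub>R t k) \<longlonglongrightarrow> \<eta>"
    and N: "\<And>k. y k \<in> normal_cone K (A k)"
  shows "h \<in> critical" "\<eta> - curv h \<in> normal_cone critical h"
proof -
  have AK: "A k \<in> K" for k using N by (rule normal_cone_point)
  have hQ: "h \<in> Q" by (rule tangent_direction_in_Q[OF t A AK])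
  have ylim: "y \<longlonglongrightarrow> yb" by (rule tendsto_scaled_imp_tendsto[OF t(2) y t(1)])
  have "0 \<le> yb \<bullet> h"
  proof (rule LIMSEQ_le_const)
    show "(\<lambda>k. y k \<bullet> ((A k - A0) /\<^sub>R t k)) \<longlonglongrightarrow> yb \<bullet> h" by (intro tendsto_intros ylim A)
    have "0 \<le> y k \<bullet> ((A k - A0) /\<^sub>R t k)" for k
      using normal_coneD[OF N[of k] A0_K] t(1)[of k] by (simp add: inner_diff_right)
    then show "\<exists>N. \<forall>k\<ge>N. 0 \<le> y k \<bullet> ((A k - A0) /\<^sub>R t k)" by simp
  qed
  then have ybh: "yb \<bullet> h = 0" using yb_polar[OF hQ] by simp
  then show h: "h \<in> critical" using hQ by (simp add: critical_def inner_commute)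
  define E where "E k = (\<Phi>' (A k) - id_blinfun) /\<^sub>R t k" for k
  have E: "E \<longlonglongrightarrow> \<Phi>'' h"
    unfolding E_def using has_derivative_scaled_limit[OF \<Phi>'' t A] by (simp add: \<Phi>'_A0)
  have \<Phi>'_E: "\<Phi>' (A k) v = v + t k *\<^sub>R E k v" for k v
    using t(1)[of k] by (simp add: E_def blinfun.bilinear_simps)
  have key: "\<eta> \<bullet> c \<le> curv h \<bullet> c"
    if c: "cs \<longlonglongrightarrow> c" and pos: "\<And>k. A k \<in> W \<Longrightarrow> yb \<bullet> cs k \<ge> 0"
      and feas: "\<And>k. A k \<in> W \<Longrightarrow> \<exists>r>0. \<forall>s. 0 < s \<longrightarrow> s \<le> r \<longrightarrow> \<Phi> (A k) + s *\<^sub>R cs k \<in> Q" for c cs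
  proof -
    have "\<exists>v. A k \<in> W \<longrightarrow> \<Phi>' (A k) v = cs k \<and> y k \<bullet> v \<le> 0" for k
    proof (cases "A k \<in> W")
      case True
      obtain r where r: "r > 0" "\<And>s. 0 < s \<Longrightarrow> s \<le> r \<Longrightarrow> \<Phi> (A k) + s *\<^sub>R cs k \<in> Q"
        using feas[OF True] by auto
      obtain v where "\<Phi>' (A k) v = cs k" "y k \<bullet> v \<le> 0"
        by (rule normal_cone_test_direction[OF True N[of k] r])
      then show ?thesis by blast
    qed simp
    then obtain v where v: "\<And>k. A k \<in> W \<Longrightarrow> \<Phi>' (A k) (v k) = cs k \<and> y k \<bullet> v k \<le> 0" by metis
    obtain ME where ME: "ME > 0" "\<And>k. norm (E k) \<le> ME"
      using convergent_imp_Bseq[OF convergentI[OF E]] unfolding Bseq_def by blast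
    obtain MC where MC: "MC > 0" "\<And>k. norm (cs k) \<le> MC"
      using convergent_imp_Bseq[OF convergentI[OF c]] unfolding Bseq_def by blast
    have "\<forall>\<^sub>F k in sequentially. t k < 1 / (2 * ME)"
      using ME(1) by (intro order_tendstoD(2)[OF t(2)]) simp
    \<comment> \<open>The bound on \<open>t k\<close> makes \<open>\<Phi>' (A k)\<close> close enough to the identity to bound \<open>v k\<close> by \<open>cs k\<close>.\<close>
    then have ev: "\<forall>\<^sub>F k in sequentially. A k \<in> W \<and> t k < 1 / (2 * ME)"
      using eventually_W[OF t A] by (rule eventually_conj[rotated])
    have vc: "(\<lambda>k. v k - cs k) \<longlonglongrightarrow> 0"
    proof (rule Lim_null_comparison)
      show "\<forall>\<^sub>F k in sequentially. norm (v k - cs k) \<le> t k * (2 * ME * MC)"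
        using ev
      proof eventually_elim
        case (elim k)
        then have "v k - cs k = - (t k *\<^sub>R E k (v k))" using v[of k] \<Phi>'_E[of k "v k"] by (simp add: algebra_simps)
        then have "norm (v k - cs k) = t k * norm (E k (v k))" using t(1)[of k] by simp
        also have "\<dots> \<le> t k * (ME * norm (v k))"
          using order_trans[OF norm_blinfun mult_right_mono[OF ME(2) norm_ge_zero]] t(1)[of k]
          by (intro mult_left_mono) auto
        finally have est: "norm (v k - cs k) \<le> t k * (ME * norm (v k))" .
        have "t k * (ME * norm (v k)) \<le> 1 / (2 * ME) * (ME * norm (v k))"
          using elim ME(1) by (intro mult_right_mono) auto
        also have "\<dots> = norm (v k) / 2" using ME(1) by simp
        finally have "norm (v k - cs k) \<le> norm (v k) / 2" using est by simp
        then have "norm (v k) \<le> 2 * MC"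
          using norm_triangle_ineq[of "v k - cs k" "cs k"] MC(2)[of k] by simp
        then have "t k * (ME * norm (v k)) \<le> t k * (ME * (2 * MC))"
          using ME(1) t(1)[of k] by (intro mult_left_mono) auto
        then show ?case using est by (simp add: mult_ac)
      qed
      show "(\<lambda>k. t k * (2 * ME * MC)) \<longlonglongrightarrow> 0" using tendsto_mult_right[OF t(2)] by simp
    qed
    have vl: "v \<longlonglongrightarrow> c" using tendsto_add[OF vc c] by simp
    have "\<eta> \<bullet> c \<le> yb \<bullet> \<Phi>'' h c"
    proof (rule tendsto_le[OF _ _ _])
      show "(\<lambda>k. ((y k - yb) /\<^sub>R t k) \<bullet> v k) \<longlonglongrightarrow> \<eta> \<bullet> c" by (intro tendsto_intros y vl)
      show "(\<lambda>k. yb \<bullet> E k (v k)) \<longlonglongrightarrow> yb \<bullet> \<Phi>'' h c" by (intro tendsto_intros E vl)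
      show "\<forall>\<^sub>F k in sequentially. ((y k - yb) /\<^sub>R t k) \<bullet> v k \<le> yb \<bullet> E k (v k)"
        using ev
      proof eventually_elim
        case (elim k)
        then have "cs k = v k + t k *\<^sub>R E k (v k)" using v[of k] \<Phi>'_E[of k "v k"] by simp
        then have "yb \<bullet> v k + t k * (yb \<bullet> E k (v k)) \<ge> 0"
          using pos[of k] elim by (simp add: inner_add_right)
        moreover have "y k \<bullet> v k \<le> 0" using v elim by blast
        ultimately have "(y k - yb) \<bullet> v k \<le> t k * (yb \<bullet> E k (v k))" by (simp add: inner_diff_left)
        then have "((y k - yb) \<bullet> v k) / t k \<le> yb \<bullet> E k (v k)"
          using t(1)[of k] by (simp add: pos_divide_le_eq mult.commute)
        then show ?case by (simp add: divide_inverse mult.commute)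
      qed
    qed simp
    then show ?thesis by (simp add: inner_curv)
  qed
  have le: "(\<eta> - curv h) \<bullet> c \<le> 0" if "c \<in> critical" for c
  proof -
    have "\<eta> \<bullet> c \<le> curv h \<bullet> c"
    proof (rule key[OF tendsto_const])
      show "yb \<bullet> c \<ge> 0" using that by (simp add: critical_def inner_commute)
      fix k assume "A k \<in> W"
      then have "\<Phi> (A k) \<in> Q" using AK K_iff by blast
      then show "\<exists>r>0. \<forall>s. 0 < s \<longrightarrow> s \<le> r \<longrightarrow> \<Phi> (A k) + s *\<^sub>R c \<in> Q"
        using that by (intro exI[of _ 1]) (simp add: add_Q scale_Q critical_def)
    qed
    then show ?thesis by (simp add: inner_diff_left)
  qed
  have "\<eta> \<bullet> (- h) \<le> curv h \<bullet> (- h)"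
  proof (rule key)
    show "(\<lambda>k. - (\<Phi> (A k) /\<^sub>R t k)) \<longlonglongrightarrow> - h" by (intro tendsto_intros Phi_scaled_limit[OF t A])
    fix k assume "A k \<in> W"
    then have q: "\<Phi> (A k) \<in> Q" using AK K_iff by blast
    show "yb \<bullet> - (\<Phi> (A k) /\<^sub>R t k) \<ge> 0"
      using yb_polar[OF q] t(1)[of k] by (simp add: mult_nonneg_nonpos)
    have "\<Phi> (A k) + s *\<^sub>R - (\<Phi> (A k) /\<^sub>R t k) \<in> Q" if "0 < s" "s \<le> t k" for s
    proof -
      have "\<Phi> (A k) + s *\<^sub>R - (\<Phi> (A k) /\<^sub>R t k) = (1 - s / t k) *\<^sub>R \<Phi> (A k)"
        by (simp add: algebra_simps divide_inverse)
      then show ?thesis using scale_Q[OF _ q, of "1 - s / t k"] that t(1)[of k] by simp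
    qed
    then show "\<exists>r>0. \<forall>s. 0 < s \<longrightarrow> s \<le> r \<longrightarrow> \<Phi> (A k) + s *\<^sub>R - (\<Phi> (A k) /\<^sub>R t k) \<in> Q"
      using t(1)[of k] by (intro exI[of _ "t k"]) simp
  qed
  then have "(\<eta> - curv h) \<bullet> h \<ge> 0" by (simp add: inner_diff_left)
  then show "\<eta> - curv h \<in> normal_cone critical h"
    unfolding normal_cone_convex_cone[OF convex_cone_critical] using le[OF h] le h by auto
qed

text \<open>Project \<open>yb + t (h + \<nu>)\<close> onto \<open>Q\<close>: the projection \<open>p\<close> and the remainder \<open>\<mu>\<close> form a point and a
normal of the cone, and along a sequence \<open>t \<rightarrow> 0\<close> the quotient \<open>p / t\<close> tends to \<open>h\<close> because \<open>h\<close> is the projection of \<open>h + \<nu>\<close> onto the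
critical cone. The chart carries \<open>(p, \<mu>)\<close> to \<open>K\<close>, where the pullback of \<open>\<mu>\<close> adds the term \<open>curv h\<close>.\<close>

lemma normal_cone_graph_realisation:
  assumes h: "h \<in> critical" and \<nu>: "\<nu> \<in> normal_cone critical h"
  obtains t A y where "\<And>k::nat. t k > 0" "t \<longlonglongrightarrow> 0" "\<And>k. y k \<in> normal_cone K (A k)"
    "(\<lambda>k. (A k - A0) /\<^sub>R t k) \<longlonglongrightarrow> h" "(\<lambda>k. (y k - yb) /\<^sub>R t k) \<longlonglongrightarrow> \<nu> + curv h"
proof -
  have \<nu>': "\<And>c. c \<in> critical \<Longrightarrow> \<nu> \<bullet> c \<le> 0" "\<nu> \<bullet> h = 0"
    using \<nu> unfolding normal_cone_convex_cone[OF convex_cone_critical] by auto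
  obtain t0 :: "nat \<Rightarrow> real" where t0: "\<And>k. t0 k > 0" "t0 \<longlonglongrightarrow> 0"
    using positive_null_sequence by metis
  define p where "p k = closest_point Q (yb + t0 k *\<^sub>R (h + \<nu>))" for k
  define \<mu> where "\<mu> k = yb + t0 k *\<^sub>R (h + \<nu>) - p k" for k
  have \<mu>N: "\<mu> k \<in> normal_cone Q (p k)" for k
    using closest_point_eq_iff_normal_cone[OF Q(1), of "yb + t0 k *\<^sub>R (h + \<nu>)" "p k"] Q(2)
    by (auto simp: p_def \<mu>_def convex_cone_def)
  have pQ: "p k \<in> Q" and \<mu>c: "\<And>c. c \<in> Q \<Longrightarrow> \<mu> k \<bullet> c \<le> 0" and \<mu>p: "\<mu> k \<bullet> p k = 0" for k
    using \<mu>N[of k] unfolding normal_cone_convex_cone[OF Q(2)] by auto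
  define c where "c k = p k /\<^sub>R t0 k" for k
  have cQ: "c k \<in> Q" for k unfolding c_def using pQ t0(1)[of k] by (intro scale_Q) auto
  have \<mu>_c: "\<mu> k = yb + t0 k *\<^sub>R (h + \<nu> - c k)" for k
    using t0(1)[of k] by (simp add: \<mu>_def c_def algebra_simps)
  have yc: "yb \<bullet> c k + t0 k * ((h + \<nu> - c k) \<bullet> c k) = 0" for k
  proof -
    have "p k = t0 k *\<^sub>R c k" using t0(1)[of k] by (simp add: c_def)
    then have "\<mu> k \<bullet> (t0 k *\<^sub>R c k) = 0" using \<mu>p[of k] by simp
    then have "\<mu> k \<bullet> c k = 0" using t0(1)[of k] by simp
    then show ?thesis unfolding \<mu>_c by (simp add: inner_add_left)
  qed
  have ge: "(h + \<nu> - c k) \<bullet> c k \<ge> 0" for k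
  proof -
    have "t0 k * ((h + \<nu> - c k) \<bullet> c k) \<ge> 0" using yc[of k] yb_polar[OF cQ[of k]] by linarith
    then show ?thesis using t0(1)[of k] by (simp add: zero_le_mult_iff)
  qed
  have cb: "norm (c k) \<le> norm (h + \<nu>)" for k
  proof (cases "c k = 0")
    case False
    have "norm (c k) * norm (c k) \<le> (h + \<nu>) \<bullet> c k"
      using ge[of k] by (simp add: inner_diff_left norm_eq_sqrt_inner)
    also have "\<dots> \<le> norm (h + \<nu>) * norm (c k)" by (rule norm_cauchy_schwarz)
    finally show ?thesis using False by (simp add: mult_le_cancel_right)
  qed simp
  then have "bounded (range c)" by (auto simp: bounded_iff)
  then obtain d r where r: "strict_mono r" and dl: "(c \<circ> r) \<longlonglongrightarrow> d"
    using bounded_imp_convergent_subsequence[of c] by auto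
  define t where "t k = t0 (r k)" for k
  have t: "\<And>k. t k > 0" "t \<longlonglongrightarrow> 0"
    using t0(1) LIMSEQ_subseq_LIMSEQ[OF t0(2) r] by (simp_all add: t_def[abs_def] o_def)
  have cr: "(\<lambda>k. c (r k)) \<longlonglongrightarrow> d" using dl by (simp add: o_def)
  have dQ: "d \<in> Q" by (rule closed_sequentially[OF Q(1) _ cr]) (rule cQ)
  have "(\<lambda>k. yb \<bullet> c (r k) + t k * ((h + \<nu> - c (r k)) \<bullet> c (r k))) \<longlonglongrightarrow> yb \<bullet> d + 0 * ((h + \<nu> - d) \<bullet> d)"
    by (intro tendsto_intros t cr)
  moreover have "yb \<bullet> c (r k) + t k * ((h + \<nu> - c (r k)) \<bullet> c (r k)) = 0" for k
    using yc[of "r k"] by (simp add: t_def)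
  ultimately have "yb \<bullet> d = 0" by (simp add: LIMSEQ_const_iff)
  then have dC: "d \<in> critical" using dQ by (simp add: critical_def inner_commute)
  have ge': "0 \<le> (h + \<nu> - d) \<bullet> d"
  proof (rule LIMSEQ_le_const)
    show "(\<lambda>k. (h + \<nu> - c (r k)) \<bullet> c (r k)) \<longlonglongrightarrow> (h + \<nu> - d) \<bullet> d" by (intro tendsto_intros cr)
  qed (use ge in auto)
  have le': "(h + \<nu> - d) \<bullet> h \<le> 0"
  proof (rule LIMSEQ_le_const2)
    show "(\<lambda>k. (h + \<nu> - c (r k)) \<bullet> h) \<longlonglongrightarrow> (h + \<nu> - d) \<bullet> h" by (intro tendsto_intros cr)
    have "(h + \<nu> - c (r k)) \<bullet> h \<le> 0" for k
    proof -
      have "h \<in> Q" "yb \<bullet> h = 0" using h by (simp_all add: critical_def inner_commute)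
      then have "t0 (r k) * ((h + \<nu> - c (r k)) \<bullet> h) \<le> 0"
        using \<mu>c[of h "r k"] unfolding \<mu>_c by (simp add: inner_add_left)
      then show ?thesis using t0(1)[of "r k"] by (simp add: mult_le_0_iff)
    qed
    then show "\<exists>N. \<forall>k\<ge>N. (h + \<nu> - c (r k)) \<bullet> h \<le> 0" by simp
  qed
  \<comment> \<open>The limit \<open>d\<close> satisfies the variational inequality for the projection of \<open>h + \<nu>\<close>, tested at \<open>h\<close>.\<close>
  have "(h - d) \<bullet> (h - d) = (h + \<nu> - d) \<bullet> h - (h + \<nu> - d) \<bullet> d + \<nu> \<bullet> d - \<nu> \<bullet> h"
    by (simp add: algebra_simps)
  also have "\<dots> \<le> 0" using ge' le' \<nu>'(1)[OF dC] \<nu>'(2) by linarith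
  finally have "(norm (h - d))\<^sup>2 \<le> 0" by (simp only: power2_norm_eq_inner)
  then have d: "d = h" by simp
  have p_c: "p (r k) = t k *\<^sub>R c (r k)" for k using t0(1)[of "r k"] by (simp add: c_def t_def)
  have pt: "(\<lambda>k. p (r k) /\<^sub>R t k) \<longlonglongrightarrow> h"
  proof -
    have "p (r k) /\<^sub>R t k = c (r k)" for k by (simp add: c_def t_def)
    then show ?thesis using cr d by simp
  qed
  define A where "A k = \<Psi> (p (r k))" for k
  define y where "y k = adjoint (\<Phi>' (A k)) (\<mu> (r k))" for k
  have Alim: "(\<lambda>k. (A k - A0) /\<^sub>R t k) \<longlonglongrightarrow> h" unfolding A_def by (rule Psi_scaled_limit[OF t pt])
  define E where "E k = (\<Phi>' (A k) - id_blinfun) /\<^sub>R t k" for k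
  have E: "E \<longlonglongrightarrow> \<Phi>'' h"
    unfolding E_def using has_derivative_scaled_limit[OF \<Phi>'' t Alim] by (simp add: \<Phi>'_A0)
  have \<Phi>'_E: "\<Phi>' (A k) v = v + t k *\<^sub>R E k v" for k v
    using t(1)[of k] by (simp add: E_def blinfun.bilinear_simps)
  have ylim: "(\<lambda>k. (y k - yb) /\<^sub>R t k) \<longlonglongrightarrow> \<nu> + curv h"
  proof (subst tendsto_componentwise_iff, intro ballI)
    fix b :: 'y assume "b \<in> Basis"
    have "(\<lambda>k. (h + \<nu> - c (r k)) \<bullet> (b + t k *\<^sub>R E k b) + yb \<bullet> E k b)
       \<longlonglongrightarrow> (h + \<nu> - d) \<bullet> (b + 0 *\<^sub>R \<Phi>'' h b) + yb \<bullet> \<Phi>'' h b"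
      by (intro tendsto_intros cr t E)
    moreover have "(h + \<nu> - c (r k)) \<bullet> (b + t k *\<^sub>R E k b) + yb \<bullet> E k b = ((y k - yb) /\<^sub>R t k) \<bullet> b" for k
    proof -
      have "y k \<bullet> b = \<mu> (r k) \<bullet> (b + t k *\<^sub>R E k b)"
        by (simp add: y_def adjoint_blinfun \<Phi>'_E)
      also have "\<dots> = yb \<bullet> b + t k * (yb \<bullet> E k b) + t k * ((h + \<nu> - c (r k)) \<bullet> (b + t k *\<^sub>R E k b))"
        unfolding \<mu>_c t_def by (simp add: inner_add_left inner_add_right distrib_left)
      finally have "(y k - yb) \<bullet> b = t k * (yb \<bullet> E k b + (h + \<nu> - c (r k)) \<bullet> (b + t k *\<^sub>R E k b))"
        by (simp add: inner_diff_left distrib_left)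
      then have "((y k - yb) \<bullet> b) / t k = yb \<bullet> E k b + (h + \<nu> - c (r k)) \<bullet> (b + t k *\<^sub>R E k b)"
        using t(1)[of k] by simp
      then show ?thesis by (simp add: divide_inverse mult.commute)
    qed
    ultimately show "(\<lambda>k. ((y k - yb) /\<^sub>R t k) \<bullet> b) \<longlonglongrightarrow> (\<nu> + curv h) \<bullet> b"
      by (simp add: d inner_add_left inner_curv)
  qed
  obtain M where M: "\<And>k. k \<ge> M \<Longrightarrow> p (r k) \<in> V"
    using eventually_V[OF t pt] by (auto simp: eventually_sequentially)
  show ?thesis
  proof (rule that[of "\<lambda>k. t (k + M)" "\<lambda>k. y (k + M)" "\<lambda>k. A (k + M)"])
    show "t (k + M) > 0" for k by (rule t(1))
    show "y (k + M) \<in> normal_cone K (A (k + M))" for k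
      unfolding y_def
    proof (rule normal_cone_pullback)
      have "p (r (k + M)) \<in> V" by (rule M) simp
      then show "A (k + M) \<in> W" "\<mu> (r (k + M)) \<in> normal_cone Q (\<Phi> (A (k + M)))"
        unfolding A_def using \<mu>N by (simp_all add: Phi_Psi)
    qed
  qed (rule LIMSEQ_ignore_initial_segment[OF t(2)] LIMSEQ_ignore_initial_segment[OF Alim]
      LIMSEQ_ignore_initial_segment[OF ylim])+
qed

text \<open>Along \<open>z k = A0 + t k h + (t k)\<^sup>2 w / 2\<close> the chart expands to \<open>t k h + (t k)\<^sup>2 (w + \<Phi>'' h h) / 2\<close> up to
\<open>o((t k)\<^sup>2)\<close>. Up to this order the expansion is a point of \<open>Q\<close>, on which \<open>yb\<close> is nonpositive, and
\<open>yb \<bullet> h = 0\<close>; this is the upper bound. It is attained at \<open>w = - \<Phi>'' h h\<close>, the second order term of the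
curve \<open>\<Psi> (t h)\<close>.\<close>

lemma support_fun_second_order_tangent_set:
  assumes h: "h \<in> critical"
  shows "support_fun yb (second_order_tangent_set K A0 h) = ereal (- (yb \<bullet> \<Phi>'' h h))"
proof (rule antisym)
  have ybh: "yb \<bullet> h = 0" using h by (simp add: critical_def inner_commute)
  have zero_lim: "(\<lambda>k. (A0 - A0) /\<^sub>R t k) \<longlonglongrightarrow> 0" for t :: "nat \<Rightarrow> real" by simp
  show "support_fun yb (second_order_tangent_set K A0 h) \<le> ereal (- (yb \<bullet> \<Phi>'' h h))"
    unfolding support_fun_def
  proof (rule SUP_least)
    fix w assume "w \<in> second_order_tangent_set K A0 h"
    then obtain t where t: "\<And>k::nat. t k > 0" "t \<longlonglongrightarrow> 0" and
      o: "(\<lambda>k. infdist (A0 + t k *\<^sub>R h + (1/2 * (t k)\<^sup>2) *\<^sub>R w) K) \<in> o(\<lambda>k. (t k)\<^sup>2)"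
      unfolding second_order_tangent_set_def by auto
    define z where "z k = A0 + t k *\<^sub>R h + (1/2 * (t k)\<^sup>2) *\<^sub>R w" for k
    have "\<exists>P. P \<in> K \<and> infdist (z k) K = dist (z k) P" for k
      using infdist_attains_inf[OF K(1)] A0_K by (metis empty_iff)
    then obtain P where P: "\<And>k. P k \<in> K" "\<And>k. infdist (z k) K = dist (z k) (P k)" by metis
    have "(\<lambda>k. infdist (z k) K / (t k)\<^sup>2) \<longlonglongrightarrow> 0"
      using smalloD_tendsto[OF o] by (simp add: z_def)
    moreover have "(\<lambda>k. infdist (z k) K / (t k)\<^sup>2) = (\<lambda>k. norm ((P k - z k) /\<^sub>R (t k)\<^sup>2))"
      by (simp add: P(2) dist_norm norm_minus_commute divide_inverse mult.commute)
    ultimately have "(\<lambda>k. norm ((P k - z k) /\<^sub>R (t k)\<^sup>2)) \<longlonglongrightarrow> 0" by (simp only:)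
    then have e: "(\<lambda>k. (P k - z k) /\<^sub>R (t k)\<^sup>2) \<longlonglongrightarrow> 0" by (rule tendsto_norm_zero_cancel)
    have "(\<lambda>k. h + t k *\<^sub>R ((1/2) *\<^sub>R w + (P k - z k) /\<^sub>R (t k)\<^sup>2)) \<longlonglongrightarrow> h + 0 *\<^sub>R ((1/2) *\<^sub>R w + 0)"
      by (intro tendsto_intros t e)
    moreover have "h + t k *\<^sub>R ((1/2) *\<^sub>R w + (P k - z k) /\<^sub>R (t k)\<^sup>2) = (P k - A0) /\<^sub>R t k" for k
    proof (rule scaleR_left_imp_eq[of "t k"])
      have "t k *\<^sub>R (h + t k *\<^sub>R ((1/2) *\<^sub>R w + (P k - z k) /\<^sub>R (t k)\<^sup>2))
          = t k *\<^sub>R h + (1/2 * (t k)\<^sup>2) *\<^sub>R w + (t k)\<^sup>2 *\<^sub>R ((P k - z k) /\<^sub>R (t k)\<^sup>2)"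
        by (simp only: scaleR_add_right scaleR_scaleR power2_eq_square mult_ac add_ac)
      also have "\<dots> = t k *\<^sub>R ((P k - A0) /\<^sub>R t k)"
        using t(1)[of k] by (simp add: z_def)
      finally show "t k *\<^sub>R (h + t k *\<^sub>R ((1/2) *\<^sub>R w + (P k - z k) /\<^sub>R (t k)\<^sup>2)) = t k *\<^sub>R ((P k - A0) /\<^sub>R t k)" .
    qed (use t(1)[of k] in simp)
    ultimately have Pt: "(\<lambda>k. (P k - A0) /\<^sub>R t k) \<longlonglongrightarrow> h" by simp
    have X: "(\<lambda>k. (\<Phi> (P k) - \<Phi> A0 - \<Phi>' A0 (P k - A0)) /\<^sub>R (t k)\<^sup>2) \<longlonglongrightarrow> \<Phi>'' 0 (h - 0) + (1/2) *\<^sub>R \<Phi>'' (h - 0) (h - 0)"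
      by (rule second_order_expansion[OF W A0(1) \<Phi>' \<Phi>'' t zero_lim Pt])
    have "(1/2) * (yb \<bullet> \<Phi>'' h h) + (1/2) * (yb \<bullet> w) \<le> 0"
    proof (rule tendsto_upperbound)
      have "(\<lambda>k. yb \<bullet> ((\<Phi> (P k) - \<Phi> A0 - \<Phi>' A0 (P k - A0)) /\<^sub>R (t k)\<^sup>2) + yb \<bullet> ((1/2) *\<^sub>R w + (P k - z k) /\<^sub>R (t k)\<^sup>2))
        \<longlonglongrightarrow> yb \<bullet> (\<Phi>'' 0 (h - 0) + (1/2) *\<^sub>R \<Phi>'' (h - 0) (h - 0)) + yb \<bullet> ((1/2) *\<^sub>R w + 0)"
        by (intro tendsto_intros X e)
      moreover have "yb \<bullet> ((\<Phi> (P k) - \<Phi> A0 - \<Phi>' A0 (P k - A0)) /\<^sub>R (t k)\<^sup>2) + yb \<bullet> ((1/2) *\<^sub>R w + (P k - z k) /\<^sub>R (t k)\<^sup>2)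
        = yb \<bullet> \<Phi> (P k) / (t k)\<^sup>2" for k
      proof -
        have "P k - A0 = t k *\<^sub>R h + ((1/2 * (t k)\<^sup>2) *\<^sub>R w + (P k - z k))" by (simp add: z_def)
        then have "yb \<bullet> (P k - A0) = yb \<bullet> ((1/2 * (t k)\<^sup>2) *\<^sub>R w + (P k - z k))"
          by (simp only: inner_add_right inner_scaleR_right ybh mult_zero_right add_0_left)
        then have "inverse ((t k)\<^sup>2) * (yb \<bullet> (P k - A0))
            = yb \<bullet> (inverse ((t k)\<^sup>2) *\<^sub>R ((1/2 * (t k)\<^sup>2) *\<^sub>R w + (P k - z k)))"
          by simp
        also have "inverse ((t k)\<^sup>2) *\<^sub>R ((1/2 * (t k)\<^sup>2) *\<^sub>R w + (P k - z k)) = (1/2) *\<^sub>R w + (P k - z k) /\<^sub>R (t k)\<^sup>2"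
          using t(1)[of k] by (simp add: scaleR_add_right)
        finally have "yb \<bullet> ((1/2) *\<^sub>R w + (P k - z k) /\<^sub>R (t k)\<^sup>2) = inverse ((t k)\<^sup>2) * (yb \<bullet> (P k - A0))" by simp
        then have "yb \<bullet> ((\<Phi> (P k) - \<Phi> A0 - \<Phi>' A0 (P k - A0)) /\<^sub>R (t k)\<^sup>2) + yb \<bullet> ((1/2) *\<^sub>R w + (P k - z k) /\<^sub>R (t k)\<^sup>2)
            = inverse ((t k)\<^sup>2) * (yb \<bullet> (\<Phi> (P k) - (P k - A0)) + yb \<bullet> (P k - A0))"
          by (simp only: A0(2) \<Phi>'_A0 id_blinfun.rep_eq inner_scaleR_right distrib_left diff_0_right)
        also have "\<dots> = yb \<bullet> \<Phi> (P k) / (t k)\<^sup>2"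
          by (simp only: inner_add_right[symmetric] diff_add_cancel divide_inverse mult.commute)
        finally show ?thesis .
      qed
      ultimately show "(\<lambda>k. yb \<bullet> \<Phi> (P k) / (t k)\<^sup>2) \<longlonglongrightarrow> (1/2) * (yb \<bullet> \<Phi>'' h h) + (1/2) * (yb \<bullet> w)"
        by (simp add: inner_add_right)
      show "\<forall>\<^sub>F k in sequentially. yb \<bullet> \<Phi> (P k) / (t k)\<^sup>2 \<le> 0"
        using eventually_W[OF t Pt]
      proof eventually_elim
        case (elim k)
        then have "\<Phi> (P k) \<in> Q" using P(1) K_iff by blast
        then show ?case using yb_polar by (simp add: divide_nonpos_nonneg)
      qed
    qed simp
    then show "ereal (yb \<bullet> w) \<le> ereal (- (yb \<bullet> \<Phi>'' h h))" by simp
  qed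
  show "ereal (- (yb \<bullet> \<Phi>'' h h)) \<le> support_fun yb (second_order_tangent_set K A0 h)"
  proof -
    define w where "w = - \<Phi>'' h h"
    obtain t :: "nat \<Rightarrow> real" where t: "\<And>k. t k > 0" "t \<longlonglongrightarrow> 0"
      using positive_null_sequence by metis
    define z where "z k = A0 + t k *\<^sub>R h + (1/2 * (t k)\<^sup>2) *\<^sub>R w" for k
    define B where "B k = \<Psi> (t k *\<^sub>R h)" for k
    have hQ: "h \<in> Q" using h by (simp add: critical_def)
    have Bt: "(\<lambda>k. (B k - A0) /\<^sub>R t k) \<longlonglongrightarrow> h" and BK: "\<forall>\<^sub>F k in sequentially. B k \<in> K"
      unfolding B_def using Q_direction_realised[OF hQ t] by auto
    have "(\<lambda>k. h + (1/2 * t k) *\<^sub>R w) \<longlonglongrightarrow> h + (1/2 * 0) *\<^sub>R w" by (intro tendsto_intros t)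
    moreover have "h + (1/2 * t k) *\<^sub>R w = (z k - A0) /\<^sub>R t k" for k
      using t(1)[of k] by (simp add: z_def scaleR_add_right power2_eq_square)
    ultimately have zt: "(\<lambda>k. (z k - A0) /\<^sub>R t k) \<longlonglongrightarrow> h" by simp
    have X1: "(\<lambda>k. (\<Phi> (z k) - \<Phi> A0 - \<Phi>' A0 (z k - A0)) /\<^sub>R (t k)\<^sup>2) \<longlonglongrightarrow> \<Phi>'' 0 (h - 0) + (1/2) *\<^sub>R \<Phi>'' (h - 0) (h - 0)"
      by (rule second_order_expansion[OF W A0(1) \<Phi>' \<Phi>'' t zero_lim zt])
    have X2: "(\<lambda>k. (\<Phi> (B k) - \<Phi> (z k) - \<Phi>' A0 (B k - z k)) /\<^sub>R (t k)\<^sup>2) \<longlonglongrightarrow> \<Phi>'' h (h - h) + (1/2) *\<^sub>R \<Phi>'' (h - h) (h - h)"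
      by (rule second_order_expansion[OF W A0(1) \<Phi>' \<Phi>'' t zt Bt])
    have "(\<lambda>k. (\<Phi> (z k) - \<Phi> A0 - \<Phi>' A0 (z k - A0)) /\<^sub>R (t k)\<^sup>2 + (\<Phi> (B k) - \<Phi> (z k) - \<Phi>' A0 (B k - z k)) /\<^sub>R (t k)\<^sup>2)
      \<longlonglongrightarrow> (\<Phi>'' 0 (h - 0) + (1/2) *\<^sub>R \<Phi>'' (h - 0) (h - 0)) + (\<Phi>'' h (h - h) + (1/2) *\<^sub>R \<Phi>'' (h - h) (h - h))"
      by (intro tendsto_add X1 X2)
    moreover have "(\<Phi> (z k) - \<Phi> A0 - \<Phi>' A0 (z k - A0)) /\<^sub>R (t k)\<^sup>2 + (\<Phi> (B k) - \<Phi> (z k) - \<Phi>' A0 (B k - z k)) /\<^sub>R (t k)\<^sup>2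
        = (\<Phi> (B k) - (B k - A0)) /\<^sub>R (t k)\<^sup>2" for k
      unfolding scaleR_add_right[symmetric]
      by (simp add: A0(2) \<Phi>'_A0 id_blinfun.rep_eq)
    ultimately have "(\<lambda>k. (\<Phi> (B k) - (B k - A0)) /\<^sub>R (t k)\<^sup>2) \<longlonglongrightarrow> (1/2) *\<^sub>R \<Phi>'' h h"
      by (simp only: blinfun.zero_left blinfun.zero_right diff_self diff_0_right add_0_left add_0_right scaleR_zero_right)
    moreover have "\<forall>\<^sub>F k in sequentially. \<Phi> (B k) = t k *\<^sub>R h"
    proof -
      have "(t k *\<^sub>R h) /\<^sub>R t k = h" for k using t(1)[of k] by simp
      then have "\<forall>\<^sub>F k in sequentially. t k *\<^sub>R h \<in> V" using eventually_V[OF t, of "\<lambda>k. t k *\<^sub>R h" h] by simp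
      then show ?thesis by eventually_elim (simp add: B_def Phi_Psi)
    qed
    then have "\<forall>\<^sub>F k in sequentially. (\<Phi> (B k) - (B k - A0)) /\<^sub>R (t k)\<^sup>2 = (z k - B k) /\<^sub>R (t k)\<^sup>2 - (1/2) *\<^sub>R w"
    proof eventually_elim
      case (elim k)
      have "z k - B k = (\<Phi> (B k) - (B k - A0)) + (1/2 * (t k)\<^sup>2) *\<^sub>R w" by (simp add: elim z_def)
      then have "(z k - B k) /\<^sub>R (t k)\<^sup>2 = (\<Phi> (B k) - (B k - A0)) /\<^sub>R (t k)\<^sup>2 + (1/2) *\<^sub>R w"
        using t(1)[of k] by (simp only: scaleR_add_right scaleR_scaleR) simp
      then show ?case by simp
    qed
    ultimately have "(\<lambda>k. (z k - B k) /\<^sub>R (t k)\<^sup>2 - (1/2) *\<^sub>R w) \<longlonglongrightarrow> (1/2) *\<^sub>R \<Phi>'' h h"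
      by (rule Lim_transform_eventually)
    from tendsto_add[OF this tendsto_const[of "(1/2) *\<^sub>R w"]]
    have "(\<lambda>k. (z k - B k) /\<^sub>R (t k)\<^sup>2) \<longlonglongrightarrow> 0" by (simp add: w_def)
    then have nz: "(\<lambda>k. norm ((z k - B k) /\<^sub>R (t k)\<^sup>2)) \<longlonglongrightarrow> 0" by (rule tendsto_norm_zero)
    have "(\<lambda>k. infdist (z k) K / (t k)\<^sup>2) \<longlonglongrightarrow> 0"
    proof (rule Lim_null_comparison[OF _ nz])
      show "\<forall>\<^sub>F k in sequentially. norm (infdist (z k) K / (t k)\<^sup>2) \<le> norm ((z k - B k) /\<^sub>R (t k)\<^sup>2)"
        using BK
      proof eventually_elim
        case (elim k)
        from infdist_le[OF this, of "z k"] show ?case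
          by (simp add: infdist_nonneg dist_norm divide_inverse mult.commute mult_right_mono)
      qed
    qed
    then have "(\<lambda>k. infdist (z k) K) \<in> o(\<lambda>k. (t k)\<^sup>2)"
      by (rule smalloI_tendsto) (use t(1) in \<open>simp add: less_imp_neq[symmetric]\<close>)
    then have "w \<in> second_order_tangent_set K A0 h"
      unfolding second_order_tangent_set_def z_def using t by auto
    then have "ereal (yb \<bullet> w) \<le> support_fun yb (second_order_tangent_set K A0 h)"
      unfolding support_fun_def by (rule SUP_upper)
    then show ?thesis by (simp add: w_def)
  qed
qed

end

section \<open>The KKT system along converging sequences\<close>

lemma mem_singleton_plus_cball:
  "z \<in> {q} + cball 0 r \<longleftrightarrow> norm (z - q) \<le> r" for z q :: "'a::real_normed_vector"
proof
  assume "norm (z - q) \<le> r"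
  then have "q + (z - q) \<in> {q} + cball 0 r" by (intro set_plus_intro) simp_all
  then show "z \<in> {q} + cball 0 r" by simp
qed (auto elim!: set_plus_elim)

lemma S_KKT_iff:
  fixes G :: "'x::euclidean_space \<Rightarrow> 'y::euclidean_space"
  assumes "closed K" "convex K" "K \<noteq> {}"
  shows "(x, y) \<in> S_KKT f G K (a, b) \<longleftrightarrow> a = grad_L f G x y \<and> y \<in> normal_cone K (G x + b)"
proof -
  have "b \<in> {- G x} + subdifferential (\<lambda>v. support_fun v K) y \<longleftrightarrow>
      G x + b \<in> subdifferential (\<lambda>v. support_fun v K) y"
  proof
    assume "b \<in> {- G x} + subdifferential (\<lambda>v. support_fun v K) y"
    then obtain s where "s \<in> subdifferential (\<lambda>v. support_fun v K) y" "b = - G x + s"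
      by (auto simp: set_plus_def)
    then show "G x + b \<in> subdifferential (\<lambda>v. support_fun v K) y" by simp
  next
    assume "G x + b \<in> subdifferential (\<lambda>v. support_fun v K) y"
    from set_plus_intro[OF singletonI this, of "- G x"]
    show "b \<in> {- G x} + subdifferential (\<lambda>v. support_fun v K) y" by simp
  qed
  then show ?thesis
    unfolding S_KKT_def using subdifferential_support_fun_iff[OF assms, of "G x + b" y]
    by (auto simp: normal_cone_def)
qed

locale kkt_problem =
  fixes f :: "'x::euclidean_space \<Rightarrow> real" and G :: "'x \<Rightarrow> 'y::euclidean_space" and K :: "'y set"
    and xb :: 'x and yb :: 'y
  assumes f: "C2_on UNIV f" and G: "C2_on UNIV G"
    and K_closed: "closed K" and K_convex: "convex K"
    and mult: "yb \<in> multipliers f G K xb 0 0"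
begin

abbreviation "G' \<equiv> bderiv G"
abbreviation "B \<equiv> bderiv G xb"
abbreviation "H \<equiv> hess_L f G xb yb"

lemma K_ne: "K \<noteq> {}"
proof
  assume "K = {}"
  then have "support_fun yb K = - \<infinity>" by (simp add: support_fun_def bot_ereal_def)
  then show False
    using mult unfolding multipliers_def S_KKT_def subdifferential_def by (auto simp: set_plus_def)
qed

lemmas KKT_iff = S_KKT_iff[OF K_closed K_convex K_ne]

lemma mult_iff: "y \<in> multipliers f G K xb 0 0 \<longleftrightarrow> grad_L f G xb y = 0 \<and> y \<in> normal_cone K (G xb)"
  unfolding multipliers_def using KKT_iff[of xb y f G 0 0] by auto

lemma grad_L_0: "grad_L f G xb yb = 0" and yb_normal: "yb \<in> normal_cone K (G xb)"
  using mult mult_iff by auto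

lemma feasible_xb: "G xb \<in> K" using normal_cone_point[OF yb_normal] .

lemma fderiv_G: "fderiv G x = blinfun_apply (G' x)"
  by (rule C2_bderiv(2)[OF G, symmetric])

lemma linear_adjoint: "linear (adjoint (blinfun_apply L))" for L :: "'x \<Rightarrow>\<^sub>L 'y"
  by (rule adjoint_linear[OF bounded_linear.linear[OF blinfun.bounded_linear_right]])

lemma adjoint_diff: "adjoint (blinfun_apply L) (u - v) = adjoint L u - adjoint L v" for L :: "'x \<Rightarrow>\<^sub>L 'y"
  by (rule linear_diff[OF linear_adjoint])

lemma adjoint_add: "adjoint (blinfun_apply L) (u + v) = adjoint L u + adjoint L v" for L :: "'x \<Rightarrow>\<^sub>L 'y"
  by (rule linear_add[OF linear_adjoint])

lemma adjoint_scaleR: "adjoint (blinfun_apply L) (c *\<^sub>R u) = c *\<^sub>R adjoint L u" for L :: "'x \<Rightarrow>\<^sub>L 'y"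
  by (rule linear_scale[OF linear_adjoint])

lemma grad_L_split: "grad_L f G x y = grad_L f G x yb + adjoint (G' x) (y - yb)"
  unfolding grad_L_eq[OF f G] fderiv_G adjoint_diff by simp

lemma grad_L_gradient: "grad_L f G x y = gradient f x + adjoint (G' x) y"
  unfolding grad_L_eq[OF f G] fderiv_G by simp

lemma C2_lagrangian: "C2_on UNIV (\<lambda>u. lagrangian f G u yb)"
proof -
  have "linear (\<lambda>z. yb \<bullet> z)" by (simp add: linear_conv_bounded_linear bounded_linear_inner_right)
  then have "C2_on UNIV (\<lambda>u. f u + yb \<bullet> G u)"
    by (intro C2_on_add f C2_on_compose_linear[OF G])
  then show ?thesis by (simp add: lagrangian_def[abs_def])
qed

lemma grad_L_fun: "(\<lambda>u. grad_L f G u yb) = gradient (\<lambda>u. lagrangian f G u yb)"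
  by (simp add: grad_L_def[abs_def])

text \<open>The Hessian of the Lagrangian at a general first argument, the multiplier being fixed at \<open>yb\<close>.\<close>

abbreviation "HL \<equiv> bderiv (\<lambda>u. grad_L f G u yb)"

lemma lagrangian_deriv: "((\<lambda>u. lagrangian f G u yb) has_derivative (\<lambda>v. grad_L f G x yb \<bullet> v)) (at x)"
  unfolding grad_L_def by (rule C2_gradient(1)[OF C2_lagrangian])

lemma grad_L_deriv: "((\<lambda>u. grad_L f G u yb) has_derivative HL x) (at x)"
  unfolding grad_L_fun by (rule C2_gradient(2)[OF C2_lagrangian])

lemma continuous_HL: "continuous_on UNIV HL"
  unfolding grad_L_fun by (rule C2_gradient(3)[OF C2_lagrangian])

lemma HL_xb: "blinfun_apply (HL xb) = H"
  unfolding grad_L_fun hess_L_def by (rule C2_gradient(4)[OF C2_lagrangian])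

lemma H_deriv: "((\<lambda>u. grad_L f G u yb) has_derivative H) (at xb)"
  using grad_L_deriv[of xb] by (simp only: HL_xb)

lemma H_sym: "H u \<bullet> v = H v \<bullet> u"
  unfolding hess_L_def by (rule C2_gradient(5)[OF C2_lagrangian])

lemma linear_H: "linear H" using has_derivative_linear[OF H_deriv] .

lemma lagrangian_expansion:
  assumes t: "\<And>k. t k > 0" "t \<longlonglongrightarrow> 0" and x: "(\<lambda>k. (x k - xb) /\<^sub>R t k) \<longlonglongrightarrow> d"
  shows "(\<lambda>k. (lagrangian f G (x k) yb - lagrangian f G xb yb) / (t k)\<^sup>2) \<longlonglongrightarrow> (1/2) * (H d \<bullet> d)"
proof -
  define R where "R = Blinfun (blinfun_inner_right :: 'x \<Rightarrow> 'x \<Rightarrow>\<^sub>L real)"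
  have R: "blinfun_apply R = blinfun_inner_right"
    unfolding R_def by (rule bounded_linear_Blinfun_apply[OF bounded_linear_blinfun_inner_right])
  have 1: "((\<lambda>u. lagrangian f G u yb) has_derivative blinfun_apply (R (grad_L f G x yb))) (at x)" for x
    using lagrangian_deriv[of x] by (simp add: R)
  have 2: "((\<lambda>u. R (grad_L f G u yb)) has_derivative blinfun_apply (R o\<^sub>L HL xb)) (at xb)"
    using bounded_linear.has_derivative[OF blinfun.bounded_linear_right[of R] grad_L_deriv[of xb]]
    by (simp add: blinfun_compose.rep_eq o_def)
  have 0: "(\<lambda>k. (xb - xb) /\<^sub>R t k) \<longlonglongrightarrow> 0" by simp
  have X: "(\<lambda>k. (lagrangian f G (x k) yb - lagrangian f G xb yb - R (grad_L f G xb yb) (x k - xb)) /\<^sub>R (t k)\<^sup>2)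
      \<longlonglongrightarrow> (R o\<^sub>L HL xb) 0 (d - 0) + (1/2) *\<^sub>R (R o\<^sub>L HL xb) (d - 0) (d - 0)"
    by (rule second_order_expansion[OF open_UNIV UNIV_I 1 2 t 0 x])
  have RH: "blinfun_apply (R o\<^sub>L HL xb) u = blinfun_inner_right (H u)" for u
    unfolding blinfun_apply_blinfun_compose R HL_xb ..
  have "(R o\<^sub>L HL xb) 0 (d - 0) + (1/2) *\<^sub>R (R o\<^sub>L HL xb) (d - 0) (d - 0) = (1/2) * (H d \<bullet> d)"
    unfolding blinfun.zero_right blinfun.zero_left diff_0_right RH by simp
  moreover have "(lagrangian f G (x k) yb - lagrangian f G xb yb - R (grad_L f G xb yb) (x k - xb)) /\<^sub>R (t k)\<^sup>2
      = (lagrangian f G (x k) yb - lagrangian f G xb yb) / (t k)\<^sup>2" for k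
    unfolding grad_L_0 R by (simp add: divide_inverse_commute)
  ultimately show ?thesis using X by (simp only:)
qed

lemma G_scaled_limit:
  assumes "\<And>k. t k > 0" "t \<longlonglongrightarrow> 0" "(\<lambda>k. (x k - xb) /\<^sub>R t k) \<longlonglongrightarrow> d"
  shows "(\<lambda>k. (G (x k) - G xb) /\<^sub>R t k) \<longlonglongrightarrow> B d"
  by (rule has_derivative_scaled_limit[OF C2_bderiv(1)[OF G] assms])

lemma grad_L_scaled_limit:
  assumes t: "\<And>k. t k > 0" "t \<longlonglongrightarrow> 0" and x: "(\<lambda>k. (x k - xb) /\<^sub>R t k) \<longlonglongrightarrow> d"
    and y: "(\<lambda>k. (y k - yb) /\<^sub>R t k) \<longlonglongrightarrow> \<eta>"
  shows "(\<lambda>k. grad_L f G (x k) (y k) /\<^sub>R t k) \<longlonglongrightarrow> H d + adjoint B \<eta>"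
proof -
  have "(\<lambda>k. (grad_L f G (x k) yb - grad_L f G xb yb) /\<^sub>R t k) \<longlonglongrightarrow> H d"
    by (rule has_derivative_scaled_limit[OF H_deriv t x])
  moreover have "(\<lambda>k. adjoint (G' (x k)) ((y k - yb) /\<^sub>R t k)) \<longlonglongrightarrow> adjoint B \<eta>"
    by (intro tendsto_adjoint y isCont_tendsto_compose[OF C2_bderiv(4)[OF G]]
        tendsto_scaled_imp_tendsto[OF t(2) x t(1)])
  ultimately have "(\<lambda>k. (grad_L f G (x k) yb - grad_L f G xb yb) /\<^sub>R t k
      + adjoint (G' (x k)) ((y k - yb) /\<^sub>R t k)) \<longlonglongrightarrow> H d + adjoint B \<eta>"
    by (rule tendsto_add)
  moreover have "(grad_L f G (x k) yb - grad_L f G xb yb) /\<^sub>R t k + adjoint (G' (x k)) ((y k - yb) /\<^sub>R t k)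
      = grad_L f G (x k) (y k) /\<^sub>R t k" for k
    unfolding adjoint_scaleR grad_L_split[of "x k" "y k"] by (simp add: grad_L_0 scaleR_add_right)
  ultimately show ?thesis by simp
qed

end

locale kkt_chart = kkt_problem f G K xb yb + charted_normal K Q W V "G xb" \<Phi> \<Psi> \<Phi>' \<Phi>'' yb
  for f :: "'x::euclidean_space \<Rightarrow> real" and G :: "'x \<Rightarrow> 'y::euclidean_space" and K xb yb Q W V \<Phi> \<Psi> \<Phi>' \<Phi>''
begin

text \<open>The Hessian at \<open>xb\<close> of \<open>x \<mapsto> f x + yb \<bullet> \<Phi> (G x)\<close>, a function that differs from the Lagrangian at \<open>yb\<close>
by a constant and second order terms only.\<close>

definition Hred :: "'x \<Rightarrow> 'x" where "Hred d = H d + adjoint B (curv (B d))"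

text \<open>The KKT pairs of the homogeneous quadratic problem that minimises \<open>(Hred d \<bullet> d) / 2\<close> over \<open>B d \<in> critical\<close>.\<close>

definition kkt_direction :: "'x \<Rightarrow> 'y \<Rightarrow> bool" where
  "kkt_direction d \<nu> \<longleftrightarrow> B d \<in> critical \<and> \<nu> \<in> normal_cone critical (B d) \<and> Hred d + adjoint B \<nu> = 0"

lemma inner_Hred: "Hred u \<bullet> v = H u \<bullet> v + yb \<bullet> \<Phi>'' (B u) (B v)"
  by (simp add: Hred_def inner_add_left adjoint_blinfun inner_curv)

lemma Hred_sym: "Hred u \<bullet> v = Hred v \<bullet> u"
  using inner_curv_sym[of "B u" "B v"] H_sym[of u v]
  by (simp add: Hred_def inner_add_left adjoint_blinfun)

lemma linear_Hred: "linear Hred"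
  unfolding Hred_def[abs_def]
  by (intro linear_compose_add linear_H linear_compose[OF _ linear_adjoint, unfolded o_def]
      linear_compose[OF _ linear_curv, unfolded o_def] bounded_linear.linear[OF blinfun.bounded_linear_right])

text \<open>A first order limit of KKT points solves the quadratic KKT system with \<open>\<alpha>\<close> as right-hand side. The
parameter \<open>a\<close> may have order \<open>t\<close>, which is used for tilted problems; \<open>b\<close> is of smaller order.\<close>

lemma kkt_sequence_limit:
  assumes t: "\<And>k. t k > 0" "t \<longlonglongrightarrow> 0"
    and kkt: "\<And>k. (x k, y k) \<in> S_KKT f G K (a k, b k)"
    and x: "(\<lambda>k. (x k - xb) /\<^sub>R t k) \<longlonglongrightarrow> d" and y: "(\<lambda>k. (y k - yb) /\<^sub>R t k) \<longlonglongrightarrow> \<eta>"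
    and a: "(\<lambda>k. a k /\<^sub>R t k) \<longlonglongrightarrow> \<alpha>" and b: "(\<lambda>k. b k /\<^sub>R t k) \<longlonglongrightarrow> 0"
  shows "B d \<in> critical" "\<eta> - curv (B d) \<in> normal_cone critical (B d)"
    "Hred d + adjoint B (\<eta> - curv (B d)) = \<alpha>"
proof -
  have N: "y k \<in> normal_cone K (G (x k) + b k)" and ak: "a k = grad_L f G (x k) (y k)" for k
    using kkt[of k] by (simp_all add: KKT_iff)
  have "(\<lambda>k. (G (x k) - G xb) /\<^sub>R t k + b k /\<^sub>R t k) \<longlonglongrightarrow> B d + 0"
    by (intro tendsto_add G_scaled_limit t x b)
  moreover have "(G (x k) - G xb) /\<^sub>R t k + b k /\<^sub>R t k = (G (x k) + b k - G xb) /\<^sub>R t k" for k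
    by (simp add: algebra_simps)
  ultimately have "(\<lambda>k. (G (x k) + b k - G xb) /\<^sub>R t k) \<longlonglongrightarrow> B d" by simp
  note * = normal_cone_graph_derivative[OF t this y N]
  show "B d \<in> critical" "\<eta> - curv (B d) \<in> normal_cone critical (B d)" by (fact *)+
  have "(\<lambda>k. a k /\<^sub>R t k) \<longlonglongrightarrow> H d + adjoint B \<eta>"
    unfolding ak by (rule grad_L_scaled_limit[OF t x y])
  then have "\<alpha> = H d + adjoint B \<eta>" using a LIMSEQ_unique by blast
  then show "Hred d + adjoint B (\<eta> - curv (B d)) = \<alpha>" by (simp add: Hred_def adjoint_diff)
qed

text \<open>Take the points on the ray \<open>xb + t d\<close> and the normals from the graph of the normal cone mapping; the
parameters are chosen so that the KKT system holds exactly, and they are \<open>o(t)\<close> by the equations that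
define the direction.\<close>

lemma kkt_direction_realisation:
  assumes "kkt_direction d \<nu>"
  obtains t x y a b where "\<And>k::nat. t k > 0" "t \<longlonglongrightarrow> 0" "\<And>k. (x k, y k) \<in> S_KKT f G K (a k, b k)"
    "(\<lambda>k. (x k - xb) /\<^sub>R t k) \<longlonglongrightarrow> d" "(\<lambda>k. (y k - yb) /\<^sub>R t k) \<longlonglongrightarrow> \<nu> + curv (B d)"
    "(\<lambda>k. a k /\<^sub>R t k) \<longlonglongrightarrow> 0" "(\<lambda>k. b k /\<^sub>R t k) \<longlonglongrightarrow> 0"
proof -
  have d: "B d \<in> critical" "\<nu> \<in> normal_cone critical (B d)" "Hred d + adjoint B \<nu> = 0"
    using assms by (auto simp: kkt_direction_def)
  show ?thesis
  proof (rule normal_cone_graph_realisation[OF d(1,2)])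
    fix t A y
    assume t: "\<And>k::nat. t k > 0" "t \<longlonglongrightarrow> 0" and N: "\<And>k. y k \<in> normal_cone K (A k)"
      and A: "(\<lambda>k. (A k - G xb) /\<^sub>R t k) \<longlonglongrightarrow> B d" and y: "(\<lambda>k. (y k - yb) /\<^sub>R t k) \<longlonglongrightarrow> \<nu> + curv (B d)"
    define x where "x k = xb + t k *\<^sub>R d" for k
    have "(x k - xb) /\<^sub>R t k = d" for k using t(1)[of k] by (simp add: x_def)
    then have x: "(\<lambda>k. (x k - xb) /\<^sub>R t k) \<longlonglongrightarrow> d" by simp
    have "(\<lambda>k. grad_L f G (x k) (y k) /\<^sub>R t k) \<longlonglongrightarrow> H d + adjoint B (\<nu> + curv (B d))"
      by (rule grad_L_scaled_limit[OF t x y])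
    moreover have "H d + adjoint B (\<nu> + curv (B d)) = 0" using d(3) by (simp add: Hred_def adjoint_add algebra_simps)
    ultimately have a: "(\<lambda>k. grad_L f G (x k) (y k) /\<^sub>R t k) \<longlonglongrightarrow> 0" by simp
    have "(\<lambda>k. (A k - G xb) /\<^sub>R t k - (G (x k) - G xb) /\<^sub>R t k) \<longlonglongrightarrow> B d - B d"
      by (intro tendsto_diff A G_scaled_limit t x)
    then have b: "(\<lambda>k. (A k - G (x k)) /\<^sub>R t k) \<longlonglongrightarrow> 0" by (simp add: scaleR_diff_right[symmetric])
    show ?thesis
      by (rule that[of t x y "\<lambda>k. grad_L f G (x k) (y k)" "\<lambda>k. A k - G (x k)", OF t _ x y a b])
        (simp add: KKT_iff N)
  qed
qed

end

section \<open>Qualification and second order conditions at a charted KKT point\<close>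

context kkt_chart
begin

text \<open>The condition dual to SRCQ: by separation, the convex cone \<open>range B + critical\<close> is the whole space if
and only if its polar is trivial.\<close>

definition dual_SRCQ :: bool where
  "dual_SRCQ \<longleftrightarrow> (\<forall>w\<in>normal_cone critical 0. adjoint B w = 0 \<longrightarrow> w = 0)"

definition Hred_positive :: bool where
  "Hred_positive \<longleftrightarrow> (\<forall>d. d \<noteq> 0 \<longrightarrow> B d \<in> critical \<longrightarrow> Hred d \<bullet> d > 0)"

lemma zero_critical: "0 \<in> critical"
  using convex_cone_critical by (rule convex_cone_contains_0)

lemma normal_cone_critical_0: "w \<in> normal_cone critical 0 \<longleftrightarrow> (\<forall>c\<in>critical. w \<bullet> c \<le> 0)"
  using zero_critical by (simp add: normal_cone_def)

lemma normal_cone_critical_subset: "w \<in> normal_cone critical h \<Longrightarrow> w \<in> normal_cone critical 0"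
  unfolding normal_cone_critical_0 normal_cone_convex_cone[OF convex_cone_critical] by (auto simp: zero_critical)

lemma dual_SRCQ_D:
  assumes "dual_SRCQ" "w \<in> normal_cone critical h" "\<And>v. w \<bullet> B v = 0"
  shows "w = 0"
proof -
  have "adjoint B w \<bullet> v = 0" for v using assms(3) by (simp add: adjoint_blinfun)
  then have "adjoint B w = 0" by (metis inner_eq_zero_iff)
  then show ?thesis using assms(1) normal_cone_critical_subset[OF assms(2)] by (auto simp: dual_SRCQ_def)
qed

lemma tangent_cap_perp: "tangent_cone K (G xb) \<inter> {z. z \<bullet> yb = 0} = critical"
  unfolding tangent_cone_eq critical_def by auto

lemma SRCQ_iff_dual: "SRCQ G K xb yb \<longleftrightarrow> dual_SRCQ"
proof
  assume S: "SRCQ G K xb yb"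
  have "w = 0" if w: "w \<in> normal_cone critical 0" "adjoint B w = 0" for w
  proof -
    have "w \<in> range B + critical"
      using S unfolding SRCQ_def tangent_cap_perp fderiv_G by simp
    then obtain v c where vc: "c \<in> critical" "w = B v + c" by (auto elim!: set_plus_elim)
    have "w \<bullet> B v = 0" using w(2) adjoint_blinfun[of B w v] by simp
    moreover have "w \<bullet> c \<le> 0" using w(1) vc(1) by (simp add: normal_cone_critical_0)
    moreover have "w \<bullet> w = w \<bullet> B v + w \<bullet> c" by (subst (2) vc(2)) (rule inner_add_right)
    ultimately have "w \<bullet> w \<le> 0" by simp
    then show ?thesis by (metis inner_eq_zero_iff inner_ge_zero order_antisym)
  qed
  then show dual_SRCQ by (simp add: dual_SRCQ_def)
next
  assume D: dual_SRCQ
  let ?S = "range B + critical"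
  have "z \<in> ?S" for z
  proof (rule ccontr)
    assume z: "z \<notin> ?S"
    have "convex ?S"
      using convex_cone_critical
      by (intro convex_set_plus convex_linear_image bounded_linear.linear[OF blinfun.bounded_linear_right] convex_UNIV)
        (simp add: convex_cone_def)
    moreover have S0: "B v + c \<in> ?S" if "c \<in> critical" for v c
      using that by (intro set_plus_intro) auto
    ultimately obtain a b where ab: "a \<noteq> 0" "\<And>x. x \<in> ?S \<Longrightarrow> a \<bullet> x \<ge> b"
      using separating_hyperplane_sets[of "{z}" ?S] z zero_critical by fastforce
    have nonneg: "a \<bullet> x \<ge> 0" if "\<And>s. s \<ge> 0 \<Longrightarrow> s *\<^sub>R x \<in> ?S" for x
    proof (rule ccontr)
      assume "\<not> 0 \<le> a \<bullet> x"
      then have neg: "a \<bullet> x < 0" by simp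
      define s where "s = (\<bar>b\<bar> + 1) / - (a \<bullet> x)"
      have "s \<ge> 0" using neg by (simp add: s_def divide_nonneg_neg divide_nonpos_neg)
      then have "b \<le> s * (a \<bullet> x)" using ab(2)[OF that] by simp
      also have "\<dots> = - (\<bar>b\<bar> + 1)" using neg by (simp add: s_def)
      finally show False by simp
    qed
    have c: "a \<bullet> c \<ge> 0" if "c \<in> critical" for c
      using nonneg[of c] S0[of "s *\<^sub>R c" 0 for s] convex_cone_scaleR[OF convex_cone_critical _ that] by simp
    have Bv: "a \<bullet> B v \<ge> 0" for v
      using nonneg[of "B v"] S0[OF zero_critical, of "s *\<^sub>R v" for s] by (simp add: blinfun.scaleR_right)
    have "- a = 0"
    proof (rule dual_SRCQ_D[OF D])
      show "- a \<in> normal_cone critical 0" using c by (simp add: normal_cone_critical_0)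
      show "- a \<bullet> B v = 0" for v using Bv[of v] Bv[of "- v"] by (simp add: blinfun.minus_right)
    qed
    then show False using ab(1) by simp
  qed
  then show "SRCQ G K xb yb" unfolding SRCQ_def tangent_cap_perp fderiv_G by blast
qed

text \<open>The difference of two multipliers is annihilated by \<open>B\<^sup>*\<close>, and it is nonpositive on the critical
cone because \<open>yb\<close> vanishes there.\<close>

lemma multipliers_unique:
  assumes dual_SRCQ
  shows "multipliers f G K xb 0 0 = {yb}"
proof -
  have "y = yb" if "y \<in> multipliers f G K xb 0 0" for y
  proof -
    have y: "grad_L f G xb y = 0" "y \<in> normal_cone K (G xb)"
      using that unfolding mult_iff by simp_all
    have "adjoint B (y - yb) = 0" using y(1) grad_L_split[of xb y] grad_L_0 by simp
    then have ker: "(y - yb) \<bullet> B v = 0" for v using adjoint_blinfun[of B "y - yb" v] by simp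
    have "(y - yb) \<bullet> c \<le> 0" if "c \<in> critical" for c
    proof -
      have "y \<bullet> c \<le> 0" "yb \<bullet> c = 0"
        using y(2) that by (simp_all add: normal_cone_eq critical_def inner_commute[of yb c])
      then show ?thesis by (simp add: inner_diff_left)
    qed
    then have "y - yb \<in> normal_cone critical 0" by (simp add: normal_cone_critical_0)
    then have "y - yb = 0" by (rule dual_SRCQ_D[OF assms _ ker])
    then show ?thesis by simp
  qed
  then have "multipliers f G K xb 0 0 \<subseteq> {yb}" by blast
  moreover have "{yb} \<subseteq> multipliers f G K xb 0 0" using mult by simp
  ultimately show ?thesis by (rule subset_antisym)
qed

lemma critical_cone_iff: "d \<in> critical_cone f G K xb \<longleftrightarrow> B d \<in> critical"
proof -
  have "fderiv f xb = (\<lambda>v. gradient f xb \<bullet> v)"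
    by (rule frechet_derivative_at[symmetric]) (rule C2_gradient(1)[OF f])
  moreover have "gradient f xb = - adjoint B yb"
    using grad_L_0 by (simp add: grad_L_gradient eq_neg_iff_add_eq_0)
  ultimately have "fderiv f xb d = - (yb \<bullet> B d)" by (simp add: adjoint_blinfun)
  then show ?thesis
    using yb_polar[of "B d"]
    by (auto simp: critical_cone_def critical_def tangent_cone_eq fderiv_G inner_commute)
qed

lemma SOSC_iff:
  assumes "multipliers f G K xb 0 0 = {yb}"
  shows "SOSC f G K xb \<longleftrightarrow> Hred_positive"
proof -
  have "(SUP y \<in> multipliers f G K xb 0 0. ereal (d \<bullet> hess_L f G xb y d)
           - support_fun y (second_order_tangent_set K (G xb) (fderiv G xb d))) > 0 \<longleftrightarrow> Hred d \<bullet> d > 0"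
    if "B d \<in> critical" for d
    unfolding assms fderiv_G
    using inner_commute[of d "H d"]
    by (simp add: support_fun_second_order_tangent_set[OF that] inner_Hred)
  then show ?thesis
    unfolding SOSC_def Hred_positive_def using critical_cone_iff by auto
qed

lemma reduced_lagrangian_expansion:
  assumes t: "\<And>k. t k > 0" "t \<longlonglongrightarrow> 0" and x: "(\<lambda>k. (x k - xb) /\<^sub>R t k) \<longlonglongrightarrow> d"
  shows "(\<lambda>k. (f (x k) - f xb + yb \<bullet> \<Phi> (G (x k))) / (t k)\<^sup>2) \<longlonglongrightarrow> (1/2) * (Hred d \<bullet> d)"
proof -
  have 0: "(\<lambda>k. (G xb - G xb) /\<^sub>R t k) \<longlonglongrightarrow> 0" by simp
  have "(\<lambda>k. (\<Phi> (G (x k)) - \<Phi> (G xb) - \<Phi>' (G xb) (G (x k) - G xb)) /\<^sub>R (t k)\<^sup>2)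
      \<longlonglongrightarrow> \<Phi>'' 0 (B d - 0) + (1/2) *\<^sub>R \<Phi>'' (B d - 0) (B d - 0)"
    by (rule second_order_expansion[OF W A0(1) \<Phi>' \<Phi>'' t 0 G_scaled_limit[OF t x]])
  then have X: "(\<lambda>k. (\<Phi> (G (x k)) - (G (x k) - G xb)) /\<^sub>R (t k)\<^sup>2) \<longlonglongrightarrow> (1/2) *\<^sub>R \<Phi>'' (B d) (B d)"
    by (simp only: A0(2) \<Phi>'_A0 id_blinfun.rep_eq diff_0_right blinfun.zero_right blinfun.zero_left add_0_left)
  have "(\<lambda>k. (lagrangian f G (x k) yb - lagrangian f G xb yb) / (t k)\<^sup>2 + yb \<bullet> ((\<Phi> (G (x k)) - (G (x k) - G xb)) /\<^sub>R (t k)\<^sup>2))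
      \<longlonglongrightarrow> (1/2) * (H d \<bullet> d) + yb \<bullet> ((1/2) *\<^sub>R \<Phi>'' (B d) (B d))"
    by (intro tendsto_add lagrangian_expansion[OF t x] tendsto_inner[OF tendsto_const X])
  moreover have "(lagrangian f G (x k) yb - lagrangian f G xb yb) / (t k)\<^sup>2 + yb \<bullet> ((\<Phi> (G (x k)) - (G (x k) - G xb)) /\<^sub>R (t k)\<^sup>2)
      = (f (x k) - f xb + yb \<bullet> \<Phi> (G (x k))) / (t k)\<^sup>2" for k
  proof -
    have "yb \<bullet> ((\<Phi> (G (x k)) - (G (x k) - G xb)) /\<^sub>R (t k)\<^sup>2) = (yb \<bullet> \<Phi> (G (x k)) - yb \<bullet> G (x k) + yb \<bullet> G xb) / (t k)\<^sup>2"
      by (simp add: inner_diff_right divide_inverse_commute)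
    then show ?thesis
      by (simp only: add_divide_distrib[symmetric] lagrangian_def) simp
  qed
  moreover have "(1/2) * (H d \<bullet> d) + yb \<bullet> ((1/2) *\<^sub>R \<Phi>'' (B d) (B d)) = (1/2) * (Hred d \<bullet> d)"
    by (simp add: inner_Hred)
  ultimately show ?thesis by (simp only:)
qed

text \<open>SRCQ at \<open>xb\<close> is the constraint qualification for the smaller feasible set given by
\<open>\<Phi> (G x) \<in> critical\<close>. Metric regularity of this constraint bends the ray \<open>xb + t d\<close> into feasible
points with the same tangent direction. On them the term \<open>yb \<bullet> \<Phi> (G x)\<close> vanishes, so that the reduced
Lagrangian agrees with \<open>f\<close> and its second order term inherits the sign from local optimality.\<close>

lemma second_order_necessary:
  assumes D: dual_SRCQ and opt: "locally_optimal f G K 0 0 xb" and d: "B d \<in> critical"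
  shows "Hred d \<bullet> d \<ge> 0"
proof -
  define S where "S = G -` W"
  have contG: "continuous_on UNIV G"
    using C2_bderiv(1)[OF G] by (meson continuous_at_imp_continuous_on has_derivative_continuous)
  have S: "open S" "xb \<in> S"
    using open_vimage[OF W contG] A0(1) by (auto simp: S_def)
  define g' where "g' x = \<Phi>' (G x) o\<^sub>L G' x" for x
  have g': "((\<lambda>x. \<Phi> (G x)) has_derivative g' x) (at x)" if "x \<in> S" for x
  proof -
    have "(\<Phi> has_derivative blinfun_apply (\<Phi>' (G x))) (at (G x))" using \<Phi>' that by (simp add: S_def)
    from has_derivative_compose[OF C2_bderiv(1)[OF G] this]
    show ?thesis by (simp add: g'_def blinfun_compose.rep_eq o_def)
  qed
  have "isCont \<Phi>' (G xb)" using has_derivative_continuous[OF \<Phi>''] .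
  from isCont_o2[OF has_derivative_continuous[OF C2_bderiv(1)[OF G]] this]
  have "isCont (\<lambda>x. \<Phi>' (G x)) xb" .
  then have cont: "isCont g' xb"
    unfolding g'_def[abs_def] by (intro continuous_intros C2_bderiv(4)[OF G])
  have g'_xb: "g' xb = B" by (rule blinfun_eqI) (simp add: g'_def \<Phi>'_A0)
  have "\<exists>\<kappa>>0. \<exists>\<delta>>0. \<forall>x b. dist x xb < \<delta> \<longrightarrow> norm b < \<delta> \<longrightarrow>
       (\<exists>x'\<in>S. \<Phi> (G x') + b \<in> critical \<and> dist x' x \<le> \<kappa> * infdist (\<Phi> (G x) + b) critical)"
  proof (rule metric_regularity[OF closed_critical _ _ S g' cont])
    show "convex critical" using convex_cone_critical by (simp add: convex_cone_def)
    show "\<Phi> (G xb) \<in> critical" using A0(2) zero_critical by simp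
    show "n = 0" if "n \<in> normal_cone critical (\<Phi> (G xb))" "\<And>v. n \<bullet> blinfun_apply (g' xb) v = 0" for n
      using dual_SRCQ_D[OF D that(1)] that(2) by (simp add: g'_xb)
  qed
  then obtain \<kappa> \<delta> where \<kappa>: "\<kappa> > 0" "\<delta> > 0"
    "\<And>x b. dist x xb < \<delta> \<Longrightarrow> norm b < \<delta> \<Longrightarrow>
       \<exists>x'\<in>S. \<Phi> (G x') + b \<in> critical \<and> dist x' x \<le> \<kappa> * infdist (\<Phi> (G x) + b) critical"
    by auto
  obtain t :: "nat \<Rightarrow> real" where t: "\<And>k. t k > 0" "t \<longlonglongrightarrow> 0"
    using positive_null_sequence by metis
  define z where "z k = xb + t k *\<^sub>R d" for k
  have "(z k - xb) /\<^sub>R t k = d" for k using t(1)[of k] by (simp add: z_def)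
  then have zt: "(\<lambda>k. (z k - xb) /\<^sub>R t k) \<longlonglongrightarrow> d" by simp
  have "\<forall>\<^sub>F k in sequentially. dist (z k) xb < \<delta>"
    by (rule tendstoD[OF tendsto_scaled_imp_tendsto[OF t(2) zt t(1)] \<kappa>(2)])
  then obtain N where N: "\<And>k. k \<ge> N \<Longrightarrow> dist (z k) xb < \<delta>" by (auto simp: eventually_sequentially)
  have "\<exists>x'. k \<ge> N \<longrightarrow> x' \<in> S \<and> \<Phi> (G x') \<in> critical \<and> dist x' (z k) \<le> \<kappa> * norm (\<Phi> (G (z k)) - t k *\<^sub>R B d)" for k
  proof (cases "k \<ge> N")
    case True
    obtain x' where x': "x' \<in> S" "\<Phi> (G x') + 0 \<in> critical" "dist x' (z k) \<le> \<kappa> * infdist (\<Phi> (G (z k)) + 0) critical"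
      using \<kappa>(3)[OF N[OF True], of 0] \<kappa>(2) by auto
    have "t k *\<^sub>R B d \<in> critical"
      using t(1)[of k] d by (intro convex_cone_scaleR[OF convex_cone_critical]) auto
    then have "infdist (\<Phi> (G (z k)) + 0) critical \<le> norm (\<Phi> (G (z k)) - t k *\<^sub>R B d)"
      using infdist_le[of "t k *\<^sub>R B d" critical "\<Phi> (G (z k)) + 0"] by (simp add: dist_norm)
    then have "\<kappa> * infdist (\<Phi> (G (z k)) + 0) critical \<le> \<kappa> * norm (\<Phi> (G (z k)) - t k *\<^sub>R B d)"
      using \<kappa>(1) by (intro mult_left_mono) auto
    then show ?thesis using x' by (intro exI[of _ x']) auto
  qed simp
  then obtain x where x: "\<And>k. k \<ge> N \<Longrightarrow> x k \<in> S \<and> \<Phi> (G (x k)) \<in> critical \<and>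
      dist (x k) (z k) \<le> \<kappa> * norm (\<Phi> (G (z k)) - t k *\<^sub>R B d)" by metis
  have "(\<lambda>k. \<Phi> (G (z k)) /\<^sub>R t k) \<longlonglongrightarrow> B d" by (rule Phi_scaled_limit[OF t G_scaled_limit[OF t zt]])
  then have "(\<lambda>k. \<Phi> (G (z k)) /\<^sub>R t k - B d) \<longlonglongrightarrow> 0" by (rule LIM_zero)
  from tendsto_mult_right_zero[OF tendsto_norm_zero[OF this], of \<kappa>]
  have lim0: "(\<lambda>k. \<kappa> * norm (\<Phi> (G (z k)) /\<^sub>R t k - B d)) \<longlonglongrightarrow> 0" .
  have "(\<lambda>k. (x k - z k) /\<^sub>R t k) \<longlonglongrightarrow> 0"
  proof (rule Lim_null_comparison[OF eventually_sequentiallyI[of N] lim0])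
    fix k assume "N \<le> k"
    have "norm ((x k - z k) /\<^sub>R t k) = dist (x k) (z k) / t k"
      using t(1)[of k] by (simp add: dist_norm divide_inverse_commute)
    also have "\<dots> \<le> \<kappa> * norm (\<Phi> (G (z k)) - t k *\<^sub>R B d) / t k"
      using x[OF \<open>N \<le> k\<close>] t(1)[of k] by (intro divide_right_mono) auto
    also have "\<dots> = \<kappa> * norm ((\<Phi> (G (z k)) - t k *\<^sub>R B d) /\<^sub>R t k)"
      using t(1)[of k] by (simp add: divide_inverse_commute)
    also have "(\<Phi> (G (z k)) - t k *\<^sub>R B d) /\<^sub>R t k = \<Phi> (G (z k)) /\<^sub>R t k - B d"
      using t(1)[of k] by (simp add: scaleR_diff_right)
    finally show "norm ((x k - z k) /\<^sub>R t k) \<le> \<kappa> * norm (\<Phi> (G (z k)) /\<^sub>R t k - B d)" .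
  qed
  from tendsto_add[OF this zt] have xt: "(\<lambda>k. (x k - xb) /\<^sub>R t k) \<longlonglongrightarrow> d"
    by (simp add: scaleR_add_right[symmetric])
  obtain \<epsilon> where \<epsilon>: "\<epsilon> > 0" "\<And>u. G u \<in> K \<Longrightarrow> dist u xb < \<epsilon> \<Longrightarrow> f xb \<le> f u"
    using opt by (auto simp: locally_optimal_def feasible_def dist_commute)
  have "0 \<le> (1/2) * (Hred d \<bullet> d)"
  proof (rule tendsto_lowerbound[OF reduced_lagrangian_expansion[OF t xt]])
    have "\<forall>\<^sub>F k in sequentially. dist (x k) xb < \<epsilon>"
      by (rule tendstoD[OF tendsto_scaled_imp_tendsto[OF t(2) xt t(1)] \<epsilon>(1)])
    then show "\<forall>\<^sub>F k in sequentially. 0 \<le> (f (x k) - f xb + yb \<bullet> \<Phi> (G (x k))) / (t k)\<^sup>2"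
      using eventually_ge_at_top[of N]
    proof eventually_elim
      case (elim k)
      have "G (x k) \<in> W" "\<Phi> (G (x k)) \<in> critical" using x[OF elim(2)] by (auto simp: S_def)
      then have "G (x k) \<in> K" "yb \<bullet> \<Phi> (G (x k)) = 0"
        using K_iff[of "G (x k)"] by (auto simp: critical_def inner_commute)
      then show ?case using \<epsilon>(2)[OF _ elim(1)] by simp
    qed
  qed simp
  then show ?thesis by simp
qed

text \<open>The quadratic form is nonnegative on the feasible directions, so each of its zeros is a minimiser
and has a multiplier.\<close>

lemma Hred_positive_if_no_direction:
  assumes D: dual_SRCQ and opt: "locally_optimal f G K 0 0 xb"
    and no: "\<And>d \<nu>. kkt_direction d \<nu> \<Longrightarrow> Hred d \<bullet> d = 0 \<Longrightarrow> d = 0"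
  shows Hred_positive
proof -
  have "Hred d \<bullet> d > 0" if "d \<noteq> 0" and d: "B d \<in> critical" for d
  proof (rule ccontr)
    assume "\<not> ?thesis"
    then have q0: "Hred d \<bullet> d = 0" using second_order_necessary[OF D opt d] by simp
    have bl: "bounded_linear Hred" using linear_Hred by (simp add: linear_conv_bounded_linear)
    have cont: "isCont Hred d" using linear_continuous_at[OF bl] .
    have der: "((\<lambda>u. (Hred u \<bullet> u) / 2) has_derivative (\<lambda>v. Hred u \<bullet> v)) (at u)" for u
    proof -
      have "((\<lambda>u. (Hred u \<bullet> u) / 2) has_derivative (\<lambda>v. (Hred u \<bullet> v + Hred v \<bullet> u) / 2)) (at u)"
        by (rule bounded_linear.has_derivative[OF bounded_linear_divide
              has_derivative_inner[OF bounded_linear_imp_has_derivative[OF bl] has_derivative_ident]])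
      moreover have "(\<lambda>v. (Hred u \<bullet> v + Hred v \<bullet> u) / 2) = (\<lambda>v. Hred u \<bullet> v)"
      proof
        show "(Hred u \<bullet> v + Hred v \<bullet> u) / 2 = Hred u \<bullet> v" for v using Hred_sym[of v u] by simp
      qed
      ultimately show ?thesis by simp
    qed
    have "\<exists>\<nu>\<in>normal_cone critical (B d). Hred d + adjoint B \<nu> = 0"
    proof (rule lagrange_multiplier_rule[where \<phi> = "\<lambda>u. (Hred u \<bullet> u) / 2" and S = UNIV
          and g = "blinfun_apply B" and g' = "\<lambda>_. B" and d\<phi> = Hred and K = critical])
      show "(blinfun_apply B has_derivative blinfun_apply B) (at u)" for u
        by (rule bounded_linear_imp_has_derivative[OF blinfun.bounded_linear_right])
      show "convex critical" using convex_cone_critical by (simp add: convex_cone_def)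
      show "n = 0" if "n \<in> normal_cone critical (B d)" "\<And>v. n \<bullet> B v = 0" for n
        by (rule dual_SRCQ_D[OF D that])
      show "Hred d \<bullet> d / 2 \<le> Hred u \<bullet> u / 2" if "B u \<in> critical" for u
        using second_order_necessary[OF D opt that] q0 by simp
      show "((\<lambda>u. (Hred u \<bullet> u) / 2) has_derivative (\<lambda>v. Hred u \<bullet> v)) (at u)" for u by (rule der)
    qed (simp_all add: closed_critical d cont)
    then obtain \<nu> where "\<nu> \<in> normal_cone critical (B d)" "Hred d + adjoint B \<nu> = 0" by blast
    then have "kkt_direction d \<nu>" using d by (simp add: kkt_direction_def)
    then show False using no[OF _ q0] \<open>d \<noteq> 0\<close> by blast
  qed
  then show ?thesis by (simp add: Hred_positive_def)
qed

text \<open>The solutions realising the direction move at order \<open>t\<close> while the parameters are \<open>o(t)\<close>, which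
calmness forbids unless the limit vanishes.\<close>

lemma isolated_calm_no_direction:
  assumes calm: "isolated_calm (S_KKT f G K) (0, 0) (xb, yb)" and dir: "kkt_direction d \<nu>"
  shows "d = 0" "\<nu> = 0"
proof -
  obtain \<kappa> U V' where c: "isolated_calm_on (S_KKT f G K) (0, 0) (xb, yb) \<kappa> U V'"
    using calm by (auto simp: isolated_calm_def)
  have U: "\<kappa> > 0" "open U" "(0, 0) \<in> U" "open V'" "(xb, yb) \<in> V'"
    using c by (simp_all add: isolated_calm_on_def)
  have U6: "S_KKT f G K p \<inter> V' \<subseteq> {(xb, yb)} + cball 0 (\<kappa> * norm (p - (0, 0)))" if "p \<in> U" for p
    using c that by (simp add: isolated_calm_on_def)
  have "norm (d, \<nu> + curv (B d)) \<le> 0"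
  proof (rule kkt_direction_realisation[OF dir])
    fix t x y a b
    assume t: "\<And>k::nat. t k > 0" "t \<longlonglongrightarrow> 0" and kkt: "\<And>k. (x k, y k) \<in> S_KKT f G K (a k, b k)"
      and x: "(\<lambda>k. (x k - xb) /\<^sub>R t k) \<longlonglongrightarrow> d" and y: "(\<lambda>k. (y k - yb) /\<^sub>R t k) \<longlonglongrightarrow> \<nu> + curv (B d)"
      and a: "(\<lambda>k. a k /\<^sub>R t k) \<longlonglongrightarrow> 0" and b: "(\<lambda>k. b k /\<^sub>R t k) \<longlonglongrightarrow> 0"
    have "(\<lambda>k. (x k, y k)) \<longlonglongrightarrow> (xb, yb)"
      by (rule tendsto_Pair[OF tendsto_scaled_imp_tendsto[OF t(2) x t(1)] tendsto_scaled_imp_tendsto[OF t(2) y t(1)]])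
    then have ev1: "\<forall>\<^sub>F k in sequentially. (x k, y k) \<in> V'" by (rule topological_tendstoD[OF _ U(4,5)])
    have "(\<lambda>k. (a k, b k)) \<longlonglongrightarrow> (0, 0)"
    proof (rule tendsto_Pair)
      show "a \<longlonglongrightarrow> 0" by (rule tendsto_scaled_imp_tendsto[of t a 0 0, OF t(2) _ t(1)]) (simp add: a)
      show "b \<longlonglongrightarrow> 0" by (rule tendsto_scaled_imp_tendsto[of t b 0 0, OF t(2) _ t(1)]) (simp add: b)
    qed
    then have ev2: "\<forall>\<^sub>F k in sequentially. (a k, b k) \<in> U" by (rule topological_tendstoD[OF _ U(2,3)])
    show ?thesis
    proof (rule tendsto_le[OF _ _ _])
      show "(\<lambda>k. norm ((x k - xb) /\<^sub>R t k, (y k - yb) /\<^sub>R t k)) \<longlonglongrightarrow> norm (d, \<nu> + curv (B d))"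
        by (intro tendsto_norm tendsto_Pair x y)
      have "(\<lambda>k. \<kappa> * norm (a k /\<^sub>R t k, b k /\<^sub>R t k)) \<longlonglongrightarrow> \<kappa> * norm (0 :: 'x, 0 :: 'y)"
        by (intro tendsto_intros a b)
      then show "(\<lambda>k. \<kappa> * norm (a k /\<^sub>R t k, b k /\<^sub>R t k)) \<longlonglongrightarrow> 0" by (simp add: norm_Pair)
      show "\<forall>\<^sub>F k in sequentially. norm ((x k - xb) /\<^sub>R t k, (y k - yb) /\<^sub>R t k) \<le> \<kappa> * norm (a k /\<^sub>R t k, b k /\<^sub>R t k)"
        using ev1 ev2
      proof eventually_elim
        case (elim k)
        then have "(x k, y k) \<in> {(xb, yb)} + cball 0 (\<kappa> * norm ((a k, b k) - (0, 0)))"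
          using subsetD[OF U6[OF elim(2)] IntI[OF kkt elim(1)]] by simp
        then have "norm ((x k, y k) - (xb, yb)) \<le> \<kappa> * norm (a k, b k)"
          unfolding mem_singleton_plus_cball by simp
        then have "norm ((x k, y k) - (xb, yb)) / t k \<le> \<kappa> * norm (a k, b k) / t k"
          using t(1)[of k] by (intro divide_right_mono) auto
        moreover have "((x k - xb) /\<^sub>R t k, (y k - yb) /\<^sub>R t k) = ((x k, y k) - (xb, yb)) /\<^sub>R t k"
          "(a k /\<^sub>R t k, b k /\<^sub>R t k) = (a k, b k) /\<^sub>R t k" by simp_all
        ultimately show ?case using t(1)[of k] by (simp only: norm_scaleR) (simp add: divide_inverse_commute)
      qed
    qed simp
  qed
  then have "(d, \<nu> + curv (B d)) = 0" by simp
  then have d0: "d = 0" "\<nu> + curv (B d) = 0" unfolding zero_prod_def by blast+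
  show "d = 0" by (rule d0(1))
  show "\<nu> = 0" using d0(2) by (simp add: d0(1) blinfun.zero_right linear_0[OF linear_curv])
qed

lemma isolated_calm_imp_SRCQ_SOSC:
  assumes "isolated_calm (S_KKT f G K) (0, 0) (xb, yb)" and opt: "locally_optimal f G K 0 0 xb"
  shows dual_SRCQ Hred_positive
proof -
  show D: dual_SRCQ
    unfolding dual_SRCQ_def
  proof (intro ballI impI)
    fix w assume "w \<in> normal_cone critical 0" "adjoint B w = 0"
    then have "kkt_direction 0 w"
      using zero_critical linear_0[OF linear_Hred] by (simp add: kkt_direction_def)
    then show "w = 0" by (rule isolated_calm_no_direction(2)[OF assms(1)])
  qed
  show Hred_positive
    by (rule Hred_positive_if_no_direction[OF D opt]) (rule isolated_calm_no_direction(1)[OF assms(1)])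
qed

end

section \<open>Isolated calmness and solvability\<close>

lemma bounded_subsequence:
  fixes z :: "nat \<Rightarrow> 'a::heine_borel"
  assumes "bounded (range z)"
  obtains r l where "strict_mono (r :: nat \<Rightarrow> nat)" "(\<lambda>k. z (r k)) \<longlonglongrightarrow> l"
proof -
  have "\<exists>l r. strict_mono (r :: nat \<Rightarrow> nat) \<and> (z \<circ> r) \<longlonglongrightarrow> l"
    by (rule bounded_imp_convergent_subsequence[OF assms])
  then obtain l r where "strict_mono (r :: nat \<Rightarrow> nat)" "(z \<circ> r) \<longlonglongrightarrow> l" by (elim exE conjE)
  then show ?thesis by (intro that[of r l]) (simp_all add: o_def)
qed

lemma tendsto_subsequence: "z \<longlonglongrightarrow> l \<Longrightarrow> strict_mono r \<Longrightarrow> (\<lambda>k. z (r k)) \<longlonglongrightarrow> l"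
  using LIMSEQ_subseq_LIMSEQ[of z l r] by (simp add: o_def)

lemma null_comparison_seq:
  fixes z :: "nat \<Rightarrow> 'a::real_normed_vector"
  assumes "\<And>k. norm (z k - l) \<le> e k" "e \<longlonglongrightarrow> 0"
  shows "z \<longlonglongrightarrow> l"
proof -
  have "(\<lambda>k. z k - l) \<longlonglongrightarrow> 0"
    by (rule Lim_null_comparison[OF always_eventually assms(2)]) (simp add: assms(1))
  then show ?thesis by (rule LIM_zero_cancel)
qed

context kkt_chart
begin

text \<open>If calmness failed, the displacements of suitable solutions, divided by their norm, would converge to
a unit vector that comes from a \<open>kkt_direction\<close>. Pairing its equation with \<open>d\<close> contradicts SOSC
unless \<open>d = 0\<close>, and then SRCQ removes \<open>\<nu>\<close>.\<close>

lemma SRCQ_SOSC_imp_isolated_calm: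
  assumes D: dual_SRCQ and pos: Hred_positive
  shows "isolated_calm (S_KKT f G K) (0, 0) (xb, yb)"
proof (rule ccontr)
  let ?q = "(xb, yb)"
  assume "\<not> ?thesis"
  moreover have "?q \<in> S_KKT f G K (0, 0)" using mult by (simp add: multipliers_def)
  ultimately have no: "\<not> isolated_calm_on (S_KKT f G K) (0, 0) ?q \<kappa> U V'" for \<kappa> U V'
    unfolding isolated_calm_def by blast
  obtain e :: "nat \<Rightarrow> real" where e: "\<And>k. e k > 0" "e \<longlonglongrightarrow> 0"
    using positive_null_sequence by metis
  have "\<exists>p q. norm p < e k \<and> norm (q - ?q) < e k \<and> q \<in> S_KKT f G K p \<and> inverse (e k) * norm p < norm (q - ?q)" for k
  proof -
    have "\<not> (\<forall>p\<in>ball (0, 0) (e k). S_KKT f G K p \<inter> ball ?q (e k) \<subseteq> {?q} + cball 0 (inverse (e k) * norm (p - (0, 0))))"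
      using no[of "inverse (e k)" "ball (0, 0) (e k)" "ball ?q (e k)"] e(1)[of k]
      by (simp add: isolated_calm_on_def)
    then obtain p q where pq: "p \<in> ball (0, 0) (e k)" "q \<in> S_KKT f G K p" "q \<in> ball ?q (e k)"
      "q \<notin> {?q} + cball 0 (inverse (e k) * norm (p - (0, 0)))" by blast
    have "norm p < e k" using pq(1) by (simp add: zero_prod_def[symmetric])
    moreover have "norm (q - ?q) < e k" using pq(3) by (simp add: dist_norm norm_minus_commute)
    moreover have "inverse (e k) * norm p < norm (q - ?q)"
      using pq(4) unfolding mem_singleton_plus_cball by (simp add: zero_prod_def[symmetric])
    ultimately show ?thesis using pq(2) by blast
  qed
  then obtain p q where pq: "\<And>k. norm (p k) < e k" "\<And>k. norm (q k - ?q) < e k" "\<And>k. q k \<in> S_KKT f G K (p k)"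
    "\<And>k. inverse (e k) * norm (p k) < norm (q k - ?q)" by metis
  define \<tau> where "\<tau> k = norm (q k - ?q)" for k
  have \<tau>: "\<tau> k > 0" for k
  proof -
    have "0 \<le> inverse (e k) * norm (p k)" using e(1)[of k] by simp
    then show ?thesis unfolding \<tau>_def using pq(4)[of k] by (rule order.strict_trans1)
  qed
  have \<tau>0: "\<tau> \<longlonglongrightarrow> 0"
    by (rule null_comparison_seq[OF _ e(2)]) (use pq(2) in \<open>simp add: \<tau>_def less_imp_le\<close>)
  have p\<tau>: "(\<lambda>k. p k /\<^sub>R \<tau> k) \<longlonglongrightarrow> 0"
  proof (rule null_comparison_seq[OF _ e(2)])
    fix k
    have "norm (p k) \<le> e k * \<tau> k" using pq(4)[of k] e(1)[of k] by (simp add: \<tau>_def field_simps)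
    then show "norm (p k /\<^sub>R \<tau> k - 0) \<le> e k" using \<tau>[of k] by (simp add: field_simps)
  qed
  define w where "w k = (q k - ?q) /\<^sub>R \<tau> k" for k
  have w1: "norm (w k) = 1" for k
  proof -
    have "norm (w k) = inverse (\<tau> k) * \<tau> k" using \<tau>[of k] by (simp add: w_def \<tau>_def)
    then show ?thesis using \<tau>[of k] by simp
  qed
  have "bounded (range w)" using w1 by (auto simp: bounded_iff)
  then obtain r l where r: "strict_mono r" and wl: "(\<lambda>k. w (r k)) \<longlonglongrightarrow> l"
    by (rule bounded_subsequence)
  have "(\<lambda>k. norm (w (r k))) \<longlonglongrightarrow> norm l" by (rule tendsto_norm[OF wl])
  then have l1: "norm l = 1" by (simp add: w1 LIMSEQ_const_iff)
  define t where "t k = \<tau> (r k)" for k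
  have t: "\<And>k. t k > 0" "t \<longlonglongrightarrow> 0"
    using \<tau> tendsto_subsequence[OF \<tau>0 r] by (simp_all add: t_def[abs_def])
  have kkt: "(fst (q (r k)), snd (q (r k))) \<in> S_KKT f G K (fst (p (r k)), snd (p (r k)))" for k
    using pq(3)[of "r k"] by simp
  have x: "(\<lambda>k. (fst (q (r k)) - xb) /\<^sub>R t k) \<longlonglongrightarrow> fst l"
    using tendsto_fst[OF wl] by (simp add: w_def t_def)
  have y: "(\<lambda>k. (snd (q (r k)) - yb) /\<^sub>R t k) \<longlonglongrightarrow> snd l"
    using tendsto_snd[OF wl] by (simp add: w_def t_def)
  have a: "(\<lambda>k. fst (p (r k)) /\<^sub>R t k) \<longlonglongrightarrow> 0" and b: "(\<lambda>k. snd (p (r k)) /\<^sub>R t k) \<longlonglongrightarrow> 0"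
    using tendsto_fst[OF tendsto_subsequence[OF p\<tau> r]] tendsto_snd[OF tendsto_subsequence[OF p\<tau> r]]
    by (simp_all add: t_def)
  note lim = kkt_sequence_limit[OF t kkt x y a b]
  define d \<nu> where "d = fst l" and "\<nu> = snd l - curv (B (fst l))"
  have d: "B d \<in> critical" "\<nu> \<in> normal_cone critical (B d)" "Hred d + adjoint B \<nu> = 0"
    using lim by (simp_all add: d_def \<nu>_def)
  have "\<nu> \<bullet> B d = 0" using d(2) by (simp add: normal_cone_convex_cone[OF convex_cone_critical])
  moreover have "Hred d \<bullet> d + \<nu> \<bullet> B d = 0"
    using d(3) by (metis adjoint_blinfun inner_add_left inner_zero_left)
  ultimately have "Hred d \<bullet> d = 0" by simp
  then have d0: "d = 0" using pos d(1) by (auto simp: Hred_positive_def)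
  have "adjoint B \<nu> = 0" using d(3) by (simp add: d0 linear_0[OF linear_Hred])
  then have "\<nu> = 0"
    using D d(2) by (simp add: dual_SRCQ_def d0 blinfun.zero_right)
  then have "snd l = 0" using d0 by (simp add: \<nu>_def d_def blinfun.zero_right linear_0[OF linear_curv])
  then have "l = 0" using d0 by (simp add: d_def prod_eq_iff)
  then show False using l1 by simp
qed

text \<open>Feasible points \<open>x\<close> with \<open>f x \<le> f xb\<close> tending to \<open>xb\<close> would have a limiting direction that is critical
and at which the reduced quadratic form is nonpositive, since \<open>yb \<bullet> \<Phi> (G x) \<le> 0\<close> at feasible points.\<close>

lemma strict_local_minimum:
  assumes pos: Hred_positive
  shows "\<exists>r>0. \<forall>x. dist x xb \<le> r \<longrightarrow> G x \<in> K \<longrightarrow> f x \<le> f xb \<longrightarrow> x = xb"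
proof (rule ccontr)
    assume no: "\<not> ?thesis"
    obtain e :: "nat \<Rightarrow> real" where e: "\<And>k. e k > 0" "e \<longlonglongrightarrow> 0"
      using positive_null_sequence by metis
    have "\<exists>x. dist x xb \<le> e k \<and> G x \<in> K \<and> f x \<le> f xb \<and> x \<noteq> xb" for k
      using no e(1)[of k] by blast
    then obtain x where x: "\<And>k. dist (x k) xb \<le> e k" "\<And>k. G (x k) \<in> K" "\<And>k. f (x k) \<le> f xb" "\<And>k. x k \<noteq> xb"
      by metis
    define \<tau> where "\<tau> k = norm (x k - xb)" for k
    have \<tau>: "\<tau> k > 0" for k using x(4)[of k] by (simp add: \<tau>_def)
    have \<tau>0: "\<tau> \<longlonglongrightarrow> 0" by (rule null_comparison_seq[OF _ e(2)]) (use x(1) in \<open>simp add: \<tau>_def dist_norm\<close>)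
    define w where "w k = (x k - xb) /\<^sub>R \<tau> k" for k
    have w1: "norm (w k) = 1" for k
    proof -
      have "norm (w k) = inverse (\<tau> k) * \<tau> k" using \<tau>[of k] by (simp add: w_def \<tau>_def)
      then show ?thesis using \<tau>[of k] by simp
    qed
    have "bounded (range w)" using w1 by (auto simp: bounded_iff)
    then obtain r d where r: "strict_mono r" and wl: "(\<lambda>k. w (r k)) \<longlonglongrightarrow> d"
      by (rule bounded_subsequence)
    have "(\<lambda>k. norm (w (r k))) \<longlonglongrightarrow> norm d" by (rule tendsto_norm[OF wl])
    then have "norm d = 1" by (simp add: w1 LIMSEQ_const_iff)
    then have dn0: "d \<noteq> 0" by auto
    define t where "t k = \<tau> (r k)" for k
    have t: "\<And>k. t k > 0" "t \<longlonglongrightarrow> 0"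
      using \<tau> tendsto_subsequence[OF \<tau>0 r] by (simp_all add: t_def[abs_def])
    have xt: "(\<lambda>k. (x (r k) - xb) /\<^sub>R t k) \<longlonglongrightarrow> d" using wl by (simp add: w_def t_def)
    have "B d \<in> Q" by (rule tangent_direction_in_Q[OF t G_scaled_limit[OF t xt]]) (rule x(2))
    moreover have "fderiv f xb d \<le> 0"
    proof (rule LIMSEQ_le_const2)
      show "(\<lambda>k. (f (x (r k)) - f xb) /\<^sub>R t k) \<longlonglongrightarrow> fderiv f xb d"
        using has_derivative_scaled_limit[OF C2_bderiv(1)[OF f] t xt] by (simp only: C2_bderiv(2)[OF f])
      have "(f (x (r k)) - f xb) /\<^sub>R t k \<le> 0" for k
        using x(3)[of "r k"] t(1)[of k] by (simp add: mult_nonneg_nonpos)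
      then show "\<exists>N. \<forall>k\<ge>N. (f (x (r k)) - f xb) /\<^sub>R t k \<le> 0" by blast
    qed
    ultimately have Bd: "B d \<in> critical"
      unfolding critical_cone_iff[symmetric] critical_cone_def tangent_cone_eq fderiv_G by simp
    have "(1/2) * (Hred d \<bullet> d) \<le> 0"
    proof (rule tendsto_upperbound[OF reduced_lagrangian_expansion[OF t xt]])
      show "\<forall>\<^sub>F k in sequentially. (f (x (r k)) - f xb + yb \<bullet> \<Phi> (G (x (r k)))) / (t k)\<^sup>2 \<le> 0"
        using eventually_W[OF t G_scaled_limit[OF t xt]]
      proof eventually_elim
        case (elim k)
        then have "\<Phi> (G (x (r k))) \<in> Q" using K_iff[OF elim] x(2)[of "r k"] by simp
        then have "f (x (r k)) - f xb + yb \<bullet> \<Phi> (G (x (r k))) \<le> 0"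
          using yb_polar x(3)[of "r k"] by (simp add: add_nonpos_nonpos)
        then show ?case by (simp add: divide_nonpos_nonneg)
      qed
    qed simp
    then show False using pos dn0 Bd by (auto simp: Hred_positive_def)
qed

text \<open>Minimise the perturbed objective over the perturbed feasible set in a small ball around \<open>xb\<close>. Metric
regularity makes this set nonempty, with points near \<open>xb\<close>, and the minimisers converge to \<open>xb\<close>
because \<open>xb\<close> is the only minimiser of the limit problem; hence they finally lie in the interior of the
ball and have multipliers. These are bounded, and each of their limits is a multiplier of the
unperturbed problem, hence equal to \<open>yb\<close>.\<close>

lemma perturbed_KKT_solvable:
  assumes D: dual_SRCQ and pos: Hred_positive and V': "open V'" "(xb, yb) \<in> V'"
  shows "\<exists>\<delta>>0. \<forall>p. norm p < \<delta> \<longrightarrow> S_KKT f G K p \<inter> V' \<noteq> {}"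
proof -
  have reg: "n = 0" if "n \<in> normal_cone K (G xb)" "\<And>v. n \<bullet> B v = 0" for n
  proof (rule dual_SRCQ_D[OF D _ that(2)])
    show "n \<in> normal_cone critical 0"
      using that(1) unfolding normal_cone_critical_0 by (simp add: normal_cone_eq critical_def)
  qed
  obtain r where r0: "r > 0" "\<forall>x. dist x xb \<le> r \<longrightarrow> G x \<in> K \<longrightarrow> f x \<le> f xb \<longrightarrow> x = xb"
    using strict_local_minimum[OF pos] by blast
  note r = r0(1) r0(2)[rule_format]
  obtain c \<epsilon> where c: "c > 0" "\<epsilon> > 0"
    "\<And>x z n. dist x xb \<le> \<epsilon> \<Longrightarrow> dist z (G xb) \<le> \<epsilon> \<Longrightarrow> n \<in> normal_cone K z \<Longrightarrow> c * norm n \<le> norm (adjoint (G' x) n)"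
    using uniform_regularity[OF K_closed C2_bderiv(4)[OF G] reg] by metis
  have contG: "isCont G x" and contf: "isCont f x" and contdf: "isCont (gradient f) x" for x
    using has_derivative_continuous[OF C2_bderiv(1)[OF G]] has_derivative_continuous[OF C2_bderiv(1)[OF f]]
      has_derivative_continuous[OF C2_gradient(2)[OF f]] by auto
  have "\<exists>\<kappa>>0. \<exists>\<delta>>0. \<forall>x b. dist x xb < \<delta> \<longrightarrow> norm b < \<delta> \<longrightarrow>
       (\<exists>x'\<in>UNIV. G x' + b \<in> K \<and> dist x' x \<le> \<kappa> * infdist (G x + b) K)"
    by (rule metric_regularity[OF K_closed K_convex feasible_xb open_UNIV UNIV_I C2_bderiv(1)[OF G] C2_bderiv(4)[OF G] reg])
  then obtain \<kappa> \<delta>1 where \<kappa>: "\<kappa> > 0" "\<delta>1 > 0" and mr: "\<And>b. norm b < \<delta>1 \<Longrightarrow>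
       \<exists>x'. G x' + b \<in> K \<and> dist x' xb \<le> \<kappa> * infdist (G xb + b) K"
    by (metis dist_self)
  have feas: "\<exists>x'. G x' + b \<in> K \<and> dist x' xb \<le> \<kappa> * norm b" if b: "norm b < \<delta>1" for b
  proof -
    have "\<kappa> * infdist (G xb + b) K \<le> \<kappa> * norm b"
      using infdist_le[OF feasible_xb, of "G xb + b"] \<kappa>(1) by (intro mult_left_mono) (auto simp: dist_norm)
    then show ?thesis using mr[OF b] by force
  qed
  show ?thesis
  proof (rule ccontr)
    \<comment> \<open>Sequences replace a modulus of continuity here: parameters without a solution in \<open>V'\<close> are assumed to tend to \<open>0\<close>.\<close>
    assume no: "\<not> ?thesis"
    define \<delta>2 where "\<delta>2 = min \<delta>1 (r / \<kappa>)"
    have \<delta>2: "\<delta>2 > 0" using \<kappa> r(1) by (simp add: \<delta>2_def)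
    obtain e' :: "nat \<Rightarrow> real" where e': "\<And>k. e' k > 0" "e' \<longlonglongrightarrow> 0"
      using positive_null_sequence by metis
    define e where "e k = min (e' k) \<delta>2" for k
    have e: "e k > 0" "e k \<le> \<delta>2" "e k \<le> e' k" for k using e'(1)[of k] \<delta>2 by (simp_all add: e_def)
    have "\<exists>p. norm p < e k \<and> S_KKT f G K p \<inter> V' = {}" for k
      using no e(1)[of k] by blast
    then obtain p where p: "\<And>k. norm (p k) < e k" "\<And>k. S_KKT f G K (p k) \<inter> V' = {}" by metis
    define a b where "a k = fst (p k)" and "b k = snd (p k)" for k
    have pab: "p k = (a k, b k)" for k by (simp add: a_def b_def)
    have ab: "norm (a k) \<le> e' k" "norm (b k) \<le> e' k" "norm (b k) < \<delta>1" "\<kappa> * norm (b k) \<le> r" for k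
    proof -
      have na: "norm (a k) < e k" and nb: "norm (b k) < e k"
        using norm_fst_le[of "a k" "b k"] norm_snd_le[of "b k" "a k"] p(1)[of k] unfolding pab by linarith+
      show "norm (a k) \<le> e' k" "norm (b k) \<le> e' k" using na nb e(3)[of k] by simp_all
      show "norm (b k) < \<delta>1" using nb e(2)[of k] by (simp add: \<delta>2_def)
      have "norm (b k) \<le> r / \<kappa>" using nb e(2)[of k] by (simp add: \<delta>2_def)
      then show "\<kappa> * norm (b k) \<le> r" using \<kappa>(1) by (simp add: field_simps)
    qed
    have a0: "a \<longlonglongrightarrow> 0" by (rule null_comparison_seq[OF _ e'(2)]) (simp add: ab)
    have b0: "b \<longlonglongrightarrow> 0" by (rule null_comparison_seq[OF _ e'(2)]) (simp add: ab)
    have "\<exists>x'. G x' + b k \<in> K \<and> dist x' xb \<le> \<kappa> * norm (b k)" for k using feas[OF ab(3)] .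
    then obtain u where u: "\<And>k. G (u k) + b k \<in> K" "\<And>k. dist (u k) xb \<le> \<kappa> * norm (b k)" by metis
    define F where "F k = cball xb r \<inter> (\<lambda>x. G x + b k) -` K" for k
    have cF: "compact (F k)" for k
      unfolding F_def
      by (intro compact_Int_closed compact_cball closed_vimage K_closed continuous_intros continuous_at_imp_continuous_on ballI contG)
    have uF: "u k \<in> F k" for k
      using u[of k] ab(4)[of k] by (simp add: F_def dist_commute)
    have "\<exists>x\<in>F k. \<forall>z\<in>F k. f x - a k \<bullet> x \<le> f z - a k \<bullet> z" for k
      by (rule continuous_attains_inf[OF cF])
        (use uF in \<open>auto intro!: continuous_intros continuous_at_imp_continuous_on contf\<close>)
    then obtain x where x: "\<And>k. x k \<in> F k" "\<And>k z. z \<in> F k \<Longrightarrow> f (x k) - a k \<bullet> x k \<le> f z - a k \<bullet> z" by metis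
    have "bounded (range x)"
      by (rule bounded_subset[OF bounded_cball[of xb r]]) (use x(1) in \<open>auto simp: F_def\<close>)
    then obtain s l where s: "strict_mono s" and xl: "(\<lambda>k. x (s k)) \<longlonglongrightarrow> l"
      by (rule bounded_subsequence)
    have as: "(\<lambda>k. a (s k)) \<longlonglongrightarrow> 0" and bs: "(\<lambda>k. b (s k)) \<longlonglongrightarrow> 0"
      by (rule tendsto_subsequence[OF a0 s] tendsto_subsequence[OF b0 s])+
    have l_ball: "l \<in> cball xb r"
      by (rule closed_sequentially[OF closed_cball _ xl]) (use x(1) in \<open>simp add: F_def\<close>)
    have "(\<lambda>k. G (x (s k)) + b (s k)) \<longlonglongrightarrow> G l + 0"
      by (intro tendsto_add bs isCont_tendsto_compose[OF contG xl])
    then have lK: "G l \<in> K"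
      using closed_sequentially[OF K_closed, of "\<lambda>k. G (x (s k)) + b (s k)" "G l"] x(1) by (simp add: F_def)
    have "(\<lambda>k. \<kappa> * norm (b (s k))) \<longlonglongrightarrow> \<kappa> * norm (0::'y)" by (intro tendsto_intros bs)
    then have "(\<lambda>k. \<kappa> * norm (b (s k))) \<longlonglongrightarrow> 0" by simp
    from null_comparison_seq[OF _ this, of "\<lambda>k. u (s k)" xb] have us: "(\<lambda>k. u (s k)) \<longlonglongrightarrow> xb"
      using u(2) by (simp add: dist_norm)
    have "f l - 0 \<bullet> l \<le> f xb - 0 \<bullet> xb"
    proof (rule LIMSEQ_le)
      show "(\<lambda>k. f (x (s k)) - a (s k) \<bullet> x (s k)) \<longlonglongrightarrow> f l - 0 \<bullet> l"
        by (intro tendsto_intros as xl isCont_tendsto_compose[OF contf xl])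
      show "(\<lambda>k. f (u (s k)) - a (s k) \<bullet> u (s k)) \<longlonglongrightarrow> f xb - 0 \<bullet> xb"
        by (intro tendsto_intros as us isCont_tendsto_compose[OF contf us])
    qed (use x(2)[OF uF] in blast)
    then have lxb: "l = xb" using r(2)[OF _ lK] l_ball by (simp add: dist_commute)
    have Glim: "(\<lambda>k. G (x (s k)) + b (s k)) \<longlonglongrightarrow> G xb"
      using tendsto_add[OF isCont_tendsto_compose[OF contG xl] bs] by (simp add: lxb)
    have "\<forall>\<^sub>F k in sequentially. dist (x (s k)) xb < min r \<epsilon>"
      using xl r(1) c(2) unfolding lxb by (intro tendstoD) simp_all
    moreover have "\<forall>\<^sub>F k in sequentially. dist (G (x (s k)) + b (s k)) (G xb) < \<epsilon>"
      by (rule tendstoD[OF Glim c(2)])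
    ultimately have "\<forall>\<^sub>F k in sequentially. dist (x (s k)) xb < min r \<epsilon> \<and> dist (G (x (s k)) + b (s k)) (G xb) < \<epsilon>"
      by (rule eventually_conj)
    then obtain N where N: "\<And>k. k \<ge> N \<Longrightarrow> dist (x (s k)) xb < min r \<epsilon> \<and> dist (G (x (s k)) + b (s k)) (G xb) < \<epsilon>"
      unfolding eventually_sequentially by blast
    define j where "j k = s (k + N)" for k
    have Nj: "dist (x (j k)) xb < r" "dist (x (j k)) xb \<le> \<epsilon>" "dist (G (x (j k)) + b (j k)) (G xb) \<le> \<epsilon>" for k
      using N[of "k + N"] by (simp_all add: j_def)
    have "\<exists>y. y \<in> normal_cone K (G (x (j k)) + b (j k)) \<and> gradient f (x (j k)) - a (j k) + adjoint (G' (x (j k))) y = 0" for k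
    proof -
      have "\<exists>y\<in>normal_cone K ((\<lambda>x. G x + b (j k)) (x (j k))). (\<lambda>x. gradient f x - a (j k)) (x (j k)) + adjoint (G' (x (j k))) y = 0"
      proof (rule lagrange_multiplier_rule[OF K_closed K_convex _ open_ball[of xb r]])
        show "x (j k) \<in> ball xb r" using Nj(1)[of k] by (simp add: dist_commute)
        show "G (x (j k)) + b (j k) \<in> K" using x(1)[of "j k"] by (simp add: F_def)
        show "((\<lambda>x. G x + b (j k)) has_derivative blinfun_apply (G' z)) (at z)" for z
          using has_derivative_add[OF C2_bderiv(1)[OF G] has_derivative_const] by simp
        show "isCont G' (x (j k))" by (rule C2_bderiv(4)[OF G])
        show "((\<lambda>x. f x - a (j k) \<bullet> x) has_derivative (\<lambda>v. (gradient f z - a (j k)) \<bullet> v)) (at z)" for z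
          using has_derivative_diff[OF C2_gradient(1)[OF f, of z] bounded_linear_imp_has_derivative[OF bounded_linear_inner_right[of "a (j k)"]]]
          by (simp add: inner_diff_left)
        show "isCont (\<lambda>x. gradient f x - a (j k)) (x (j k))" by (intro continuous_intros contdf)
        show "n = 0" if n: "n \<in> normal_cone K (G (x (j k)) + b (j k))" and v: "\<And>v. n \<bullet> blinfun_apply (G' (x (j k))) v = 0" for n
        proof -
          have "adjoint (G' (x (j k))) n \<bullet> v = 0" for v using v by (simp add: adjoint_blinfun)
          then have "adjoint (G' (x (j k))) n = 0" by (metis inner_eq_zero_iff)
          then have "c * norm n \<le> 0" using c(3)[OF Nj(2)[of k] Nj(3)[of k] n] by simp
          then show ?thesis using c(1) by (simp add: mult_le_0_iff)
        qed
        show "f (x (j k)) - a (j k) \<bullet> x (j k) \<le> f z - a (j k) \<bullet> z" if "z \<in> ball xb r" "G z + b (j k) \<in> K" for z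
          by (rule x(2)) (use that in \<open>simp add: F_def\<close>)
      qed
      then show ?thesis by blast
    qed
    then obtain y where y: "\<And>k. y k \<in> normal_cone K (G (x (j k)) + b (j k))"
      "\<And>k. gradient f (x (j k)) - a (j k) + adjoint (G' (x (j k))) (y k) = 0" by metis
    have kkt: "(x (j k), y k) \<in> S_KKT f G K (p (j k))" for k
      unfolding pab KKT_iff grad_L_gradient using y[of k] by (simp add: algebra_simps)
    have xj: "(\<lambda>k. x (j k)) \<longlonglongrightarrow> xb" and aj: "(\<lambda>k. a (j k)) \<longlonglongrightarrow> 0" and Gj: "(\<lambda>k. G (x (j k)) + b (j k)) \<longlonglongrightarrow> G xb"
      unfolding j_def using LIMSEQ_ignore_initial_segment[OF xl, of N] LIMSEQ_ignore_initial_segment[OF as, of N]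
        LIMSEQ_ignore_initial_segment[OF Glim, of N] lxb by simp_all
    have dlim: "(\<lambda>k. gradient f (x (j k)) - a (j k)) \<longlonglongrightarrow> gradient f xb - 0"
      by (intro tendsto_diff aj isCont_tendsto_compose[OF contdf xj])
    obtain M where M: "\<And>k. norm (gradient f (x (j k)) - a (j k)) \<le> M"
      using convergent_imp_Bseq[OF convergentI[OF dlim]] unfolding Bseq_def by blast
    have "norm (y k) \<le> M / c" for k
    proof -
      have "adjoint (G' (x (j k))) (y k) = - (gradient f (x (j k)) - a (j k))"
        using y(2)[of k] by (simp only: eq_neg_iff_add_eq_0 add.commute)
      then have "c * norm (y k) \<le> M" using c(3)[OF Nj(2)[of k] Nj(3)[of k] y(1)[of k]] M[of k] by (metis norm_minus_cancel order_trans)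
      then show ?thesis using c(1) by (simp add: field_simps)
    qed
    then have "bounded (range y)" unfolding bounded_iff by blast
    then obtain i z where i: "strict_mono i" and yz: "(\<lambda>k. y (i k)) \<longlonglongrightarrow> z" by (rule bounded_subsequence)
    have zN: "z \<in> normal_cone K (G xb)"
      by (rule normal_cone_limit[OF K_closed _ yz tendsto_subsequence[OF Gj i]]) (rule y(1))
    have "(\<lambda>k. gradient f (x (j (i k))) - a (j (i k)) + adjoint (G' (x (j (i k)))) (y (i k)))
        \<longlonglongrightarrow> gradient f xb - 0 + adjoint B z"
      by (intro tendsto_add tendsto_subsequence[OF dlim i] tendsto_adjoint yz
          isCont_tendsto_compose[OF C2_bderiv(4)[OF G] tendsto_subsequence[OF xj i]])
    then have "grad_L f G xb z = 0" by (simp add: y(2) LIMSEQ_const_iff grad_L_gradient)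
    then have "z = yb" using zN multipliers_unique[OF D] mult_iff by blast
    then have "(\<lambda>k. (x (j (i k)), y (i k))) \<longlonglongrightarrow> (xb, yb)"
      using tendsto_Pair[OF tendsto_subsequence[OF xj i] yz] by simp
    then have "\<forall>\<^sub>F k in sequentially. (x (j (i k)), y (i k)) \<in> V'" by (rule topological_tendstoD[OF _ V'])
    then obtain k where "(x (j (i k)), y (i k)) \<in> V'" unfolding eventually_sequentially by blast
    then show False using p(2)[of "j (i k)"] kkt[of "i k"] by blast
  qed
qed

lemma robustly_isolated_calm_iff:
  assumes opt: "locally_optimal f G K 0 0 xb"
  shows "robustly_isolated_calm (S_KKT f G K) (0, 0) (xb, yb) \<longleftrightarrow> SRCQ G K xb yb \<and> SOSC f G K xb"
    and "isolated_calm (S_KKT f G K) (0, 0) (xb, yb) \<longleftrightarrow> SRCQ G K xb yb \<and> SOSC f G K xb"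
proof -
  have eq: "SRCQ G K xb yb \<and> SOSC f G K xb \<longleftrightarrow> dual_SRCQ \<and> Hred_positive"
    using SRCQ_iff_dual SOSC_iff multipliers_unique by blast
  show calm: "isolated_calm (S_KKT f G K) (0, 0) (xb, yb) \<longleftrightarrow> SRCQ G K xb yb \<and> SOSC f G K xb"
    unfolding eq using SRCQ_SOSC_imp_isolated_calm isolated_calm_imp_SRCQ_SOSC[OF _ opt] by blast
  show "robustly_isolated_calm (S_KKT f G K) (0, 0) (xb, yb) \<longleftrightarrow> SRCQ G K xb yb \<and> SOSC f G K xb"
  proof
    assume "robustly_isolated_calm (S_KKT f G K) (0, 0) (xb, yb)"
    then have "isolated_calm (S_KKT f G K) (0, 0) (xb, yb)"
      unfolding robustly_isolated_calm_def isolated_calm_def by blast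
    then show "SRCQ G K xb yb \<and> SOSC f G K xb" using calm by blast
  next
    assume A: "SRCQ G K xb yb \<and> SOSC f G K xb"
    then have "isolated_calm (S_KKT f G K) (0, 0) (xb, yb)" using calm by blast
    then obtain \<kappa> U V' where q: "(xb, yb) \<in> S_KKT f G K (0, 0)"
      and c: "isolated_calm_on (S_KKT f G K) (0, 0) (xb, yb) \<kappa> U V'"
      unfolding isolated_calm_def by blast
    have V': "open V'" "(xb, yb) \<in> V'" using c by (simp_all add: isolated_calm_on_def)
    have "dual_SRCQ" "Hred_positive" using A eq by blast+
    from perturbed_KKT_solvable[OF this V']
    obtain \<delta> where \<delta>: "\<delta> > 0" "\<forall>p. norm p < \<delta> \<longrightarrow> S_KKT f G K p \<inter> V' \<noteq> {}" by blast
    have "isolated_calm_on (S_KKT f G K) (0, 0) (xb, yb) \<kappa> (U \<inter> ball 0 \<delta>) V'"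
      using c \<delta>(1) by (simp add: isolated_calm_on_def open_Int zero_prod_def)
    moreover have "\<forall>p\<in>U \<inter> ball 0 \<delta>. S_KKT f G K p \<inter> V' \<noteq> {}"
      using \<delta>(2) by (metis IntD2 mem_ball_0)
    ultimately show "robustly_isolated_calm (S_KKT f G K) (0, 0) (xb, yb)"
      unfolding robustly_isolated_calm_def using q by blast
  qed
qed

end

section \<open>Consequences of the Aubin property\<close>

lemma mem_plus_cball:
  fixes z :: "'a::real_normed_vector"
  shows "z \<in> A + cball 0 r \<longleftrightarrow> (\<exists>q\<in>A. norm (z - q) \<le> r)"
proof
  assume "z \<in> A + cball 0 r"
  then obtain q c where "z = q + c" "q \<in> A" "c \<in> cball 0 r" by (rule set_plus_elim)
  then show "\<exists>q\<in>A. norm (z - q) \<le> r" by (intro bexI[of _ q]) simp_all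
next
  assume "\<exists>q\<in>A. norm (z - q) \<le> r"
  then obtain q where "q \<in> A" "norm (z - q) \<le> r" by blast
  then have "q + (z - q) \<in> A + cball 0 r" by (intro set_plus_intro) simp_all
  then show "z \<in> A + cball 0 r" by simp
qed

context kkt_chart
begin

lemma nondegenerate_imp_SRCQ:
  assumes "constraint_nondegenerate G K xb"
  shows "SRCQ G K xb yb"
proof -
  have "lineality_space (tangent_cone K (G xb)) \<subseteq> critical"
  proof
    fix h assume "h \<in> lineality_space (tangent_cone K (G xb))"
    then obtain S where S: "subspace S" "S \<subseteq> Q" "h \<in> S"
      unfolding lineality_space_def tangent_cone_eq by blast
    then have "h \<in> Q" "- h \<in> Q" using subspace_neg by blast+
    then have "yb \<bullet> h \<le> 0" "yb \<bullet> (- h) \<le> 0" using yb_polar by blast+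
    then show "h \<in> critical" using \<open>h \<in> Q\<close> by (simp add: critical_def inner_commute)
  qed
  then have "range (fderiv G xb) + lineality_space (tangent_cone K (G xb)) \<subseteq> range (fderiv G xb) + critical"
    by (intro set_plus_mono2) simp_all
  then show ?thesis
    using assms unfolding constraint_nondegenerate_def SRCQ_def tangent_cap_perp by blast
qed

lemma Q_bipolar:
  assumes "h \<notin> Q"
  obtains n where "n \<in> normal_cone K (G xb)" "n \<bullet> h > 0"
proof -
  have "convex Q" using Q(2) by (simp add: convex_cone_def)
  then obtain a b where ab: "a \<bullet> h < b" "\<forall>q\<in>Q. a \<bullet> q > b"
    using separating_hyperplane_closed_point[OF _ Q(1) assms] by blast
  have b: "b < 0" using ab(2) zero_Q by force
  have "a \<bullet> q \<ge> 0" if q: "q \<in> Q" for q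
  proof (rule ccontr)
    assume "\<not> ?thesis"
    then have neg: "a \<bullet> q < 0" by simp
    then have "(b / (a \<bullet> q)) *\<^sub>R q \<in> Q" using b by (intro scale_Q q) (simp add: divide_nonpos_nonpos)
    then have "a \<bullet> ((b / (a \<bullet> q)) *\<^sub>R q) > b" using ab(2) by blast
    then show False using neg by simp
  qed
  then have "- a \<in> normal_cone K (G xb)" by (simp add: normal_cone_eq)
  moreover have "- a \<bullet> h > 0" using ab(1) b by simp
  ultimately show ?thesis by (rule that)
qed

text \<open>A normal in the relative interior can be prolonged a little beyond itself, away from any other normal
\<open>n\<close>. If \<open>n \<bullet> h < 0\<close> and \<open>y \<bullet> h = 0\<close>, the prolonged vector would be a normal that is positive at \<open>h\<close>.
So all normals vanish at \<open>h\<close>, and by the bipolar theorem \<open>- h \<in> Q\<close>.\<close>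

lemma relative_interior_normal_detects_lineality:
  assumes y: "y \<in> rel_interior (normal_cone K (G xb))" and h: "h \<in> Q" "y \<bullet> h = 0"
  shows "h \<in> lineality_space (tangent_cone K (G xb))"
proof -
  let ?N = "normal_cone K (G xb)"
  have "convex ?N"
    unfolding normal_cone_eq convex_def by (simp add: inner_add_left add_nonpos_nonpos mult_nonneg_nonpos)
  have mh: "- h \<in> Q"
  proof (rule ccontr)
    assume "- h \<notin> Q"
    then obtain n where n: "n \<in> ?N" "n \<bullet> (- h) > 0" by (rule Q_bipolar)
    have "n \<in> affine hull ?N" using n(1) by (rule hull_inc)
    with convex_rel_interior_if2[OF \<open>convex ?N\<close> y]
    obtain e where e: "e > 1" "(1 - e) *\<^sub>R n + e *\<^sub>R y \<in> ?N" by blast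
    then have "((1 - e) *\<^sub>R n + e *\<^sub>R y) \<bullet> h \<le> 0" using h(1) by (simp add: normal_cone_eq)
    then have "(1 - e) * (n \<bullet> h) \<le> 0" by (simp add: inner_add_left h(2))
    moreover have "(1 - e) * (n \<bullet> h) > 0" using e(1) n(2) by (intro mult_neg_neg) simp_all
    ultimately show False by simp
  qed
  have "span {h} \<subseteq> Q"
  proof
    fix z assume "z \<in> span {h}"
    then obtain c where z: "z = c *\<^sub>R h" by (auto simp: span_singleton)
    show "z \<in> Q"
    proof (cases "c \<ge> 0")
      case True
      then show ?thesis unfolding z by (rule scale_Q[OF _ h(1)])
    next
      case False
      then have "(- c) *\<^sub>R (- h) \<in> Q" by (intro scale_Q mh) simp
      then show ?thesis by (simp add: z)
    qed
  qed
  moreover have "h \<in> span {h}" by (simp add: span_base)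
  ultimately show ?thesis
    unfolding lineality_space_def tangent_cone_eq using subspace_span[of "{h}"] by blast
qed

text \<open>Change the multiplier to a nearby \<open>yt\<close> in the relative interior of the normal cone, which is a KKT point
for a slightly different \<open>a\<close>. The Aubin property there provides, for the shift \<open>s \<beta>\<close> of \<open>b\<close>, KKT
points at distance \<open>O(s)\<close>. The limit \<open>h = B \<xi> + \<beta>\<close> of their scaled constraint values lies in \<open>Q\<close> and
satisfies \<open>yt \<bullet> h = 0\<close>, so it belongs to the lineality space.\<close>

lemma Aubin_imp_nondegenerate:
  assumes Aubin: "Aubin_property (S_KKT f G K) (0, 0) (xb, yb)"
  shows "constraint_nondegenerate G K xb"
proof -
  let ?N = "normal_cone K (G xb)"
  obtain \<kappa> U V' where U: "\<kappa> > 0" "open U" "(0, 0) \<in> U" "open V'" "(xb, yb) \<in> V'"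
    and A: "\<And>p p'. p \<in> U \<Longrightarrow> p' \<in> U \<Longrightarrow> S_KKT f G K p \<inter> V' \<subseteq> S_KKT f G K p' + cball 0 (\<kappa> * norm (p - p'))"
    using Aubin unfolding Aubin_property_def by blast
  have "convex ?N"
    unfolding normal_cone_eq convex_def by (simp add: inner_add_left add_nonpos_nonpos mult_nonneg_nonpos)
  then obtain v where v: "v \<in> rel_interior ?N"
    using rel_interior_eq_empty yb_normal by blast
  obtain e :: "nat \<Rightarrow> real" where e: "\<And>k. e k > 0" "e \<longlonglongrightarrow> 0" "\<And>k. e k \<le> 1"
    using positive_null_sequence by metis
  define Y where "Y k = yb - e k *\<^sub>R (yb - v)" for k
  have Yri: "Y k \<in> rel_interior ?N" for k
    unfolding Y_def by (rule rel_interior_convex_shrink[OF \<open>convex ?N\<close> v yb_normal e(1,3)])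
  have "Y \<longlonglongrightarrow> yb - 0 *\<^sub>R (yb - v)" unfolding Y_def by (intro tendsto_intros e)
  then have Yl: "Y \<longlonglongrightarrow> yb" by simp
  define P where "P k = (grad_L f G xb (Y k), 0 :: 'y)" for k
  have "(\<lambda>k. adjoint B (Y k - yb)) \<longlonglongrightarrow> adjoint B (yb - yb)"
    by (intro tendsto_adjoint tendsto_intros Yl)
  then have "(\<lambda>k. grad_L f G xb (Y k)) \<longlonglongrightarrow> 0"
    unfolding grad_L_split[of xb "Y k" for k] by (simp add: grad_L_0 linear_0[OF linear_adjoint])
  then have "P \<longlonglongrightarrow> (0, 0)" unfolding P_def by (rule tendsto_Pair[OF _ tendsto_const])
  then have "\<forall>\<^sub>F k in sequentially. P k \<in> U" by (rule topological_tendstoD[OF _ U(2,3)])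
  moreover have "\<forall>\<^sub>F k in sequentially. (xb, Y k) \<in> V'"
    by (rule topological_tendstoD[OF tendsto_Pair[OF tendsto_const Yl] U(4,5)])
  ultimately have "\<forall>\<^sub>F k in sequentially. P k \<in> U \<and> (xb, Y k) \<in> V'" by (rule eventually_conj)
  then obtain K0 where K0: "P K0 \<in> U" "(xb, Y K0) \<in> V'" unfolding eventually_sequentially by blast
  define yt where "yt = Y K0"
  define a1 where "a1 = grad_L f G xb yt"
  have ytN: "yt \<in> ?N" and ytri: "yt \<in> rel_interior ?N" using Yri[of K0] rel_interior_subset by (auto simp: yt_def)
  have kkt0: "(xb, yt) \<in> S_KKT f G K (a1, 0)" using ytN by (simp add: KKT_iff a1_def)
  have a1: "(a1, 0) \<in> U" "(xb, yt) \<in> V'" using K0 by (simp_all add: P_def a1_def yt_def)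
  have "\<beta> \<in> range B + lineality_space (tangent_cone K (G xb))" for \<beta>
  proof -
    have "(\<lambda>k. (a1, e k *\<^sub>R \<beta>)) \<longlonglongrightarrow> (a1, 0 *\<^sub>R \<beta>)" by (intro tendsto_intros e)
    then have "(\<lambda>k. (a1, e k *\<^sub>R \<beta>)) \<longlonglongrightarrow> (a1, 0)" by simp
    then have "\<forall>\<^sub>F k in sequentially. (a1, e k *\<^sub>R \<beta>) \<in> U" by (rule topological_tendstoD[OF _ U(2) a1(1)])
    then obtain M where M: "\<And>k. k \<ge> M \<Longrightarrow> (a1, e k *\<^sub>R \<beta>) \<in> U" by (auto simp: eventually_sequentially)
    define s where "s k = e (k + M)" for k
    have s: "\<And>k. s k > 0" "s \<longlonglongrightarrow> 0"
      using e(1) LIMSEQ_ignore_initial_segment[OF e(2), of M] by (simp_all add: s_def[abs_def])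
    have "\<exists>q. q \<in> S_KKT f G K (a1, s k *\<^sub>R \<beta>) \<and> norm ((xb, yt) - q) \<le> s k * (\<kappa> * norm \<beta>)" for k
    proof -
      have "(a1, s k *\<^sub>R \<beta>) \<in> U" unfolding s_def by (rule M) simp
      from subsetD[OF A[OF a1(1) this] IntI[OF kkt0 a1(2)]]
      obtain q where q: "q \<in> S_KKT f G K (a1, s k *\<^sub>R \<beta>)" "norm ((xb, yt) - q) \<le> \<kappa> * norm ((a1, 0) - (a1, s k *\<^sub>R \<beta>))"
        unfolding mem_plus_cball by blast
      have n: "norm ((a1, 0) - (a1, s k *\<^sub>R \<beta>)) = s k * norm \<beta>" using s(1)[of k] by (simp add: norm_Pair)
      have "norm ((xb, yt) - q) \<le> s k * (\<kappa> * norm \<beta>)" using q(2) unfolding n by (simp only: mult_ac)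
      then show ?thesis using q(1) by blast
    qed
    then obtain q where q: "\<And>k. q k \<in> S_KKT f G K (a1, s k *\<^sub>R \<beta>)" "\<And>k. norm ((xb, yt) - q k) \<le> s k * (\<kappa> * norm \<beta>)"
      by metis
    define x y where "x k = fst (q k)" and "y k = snd (q k)" for k
    have yN: "y k \<in> normal_cone K (G (x k) + s k *\<^sub>R \<beta>)" for k
      using q(1)[of k] KKT_iff[of "x k" "y k" f G a1 "s k *\<^sub>R \<beta>"] by (simp add: x_def y_def)
    have xy: "norm (x k - xb) \<le> s k * (\<kappa> * norm \<beta>)" "norm (y k - yt) \<le> s k * (\<kappa> * norm \<beta>)" for k
    proof -
      have eq: "(xb, yt) - q k = (xb - x k, yt - y k)" by (simp add: x_def y_def prod_eq_iff)
      show "norm (x k - xb) \<le> s k * (\<kappa> * norm \<beta>)" "norm (y k - yt) \<le> s k * (\<kappa> * norm \<beta>)"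
        using q(2)[of k] norm_fst_le[of "xb - x k" "yt - y k"] norm_snd_le[of "yt - y k" "xb - x k"]
        unfolding eq norm_minus_commute[of "x k"] norm_minus_commute[of "y k"] by linarith+
    qed
    define w where "w k = (x k - xb) /\<^sub>R s k" for k
    have "norm (w k) \<le> \<kappa> * norm \<beta>" for k
    proof -
      have "norm (w k) = norm (x k - xb) / s k"
        using s(1)[of k] unfolding w_def norm_scaleR by (simp add: divide_inverse_commute)
      then show ?thesis using xy(1)[of k] s(1)[of k] by (simp add: pos_divide_le_eq mult.commute)
    qed
    then have "bounded (range w)" unfolding bounded_iff by blast
    then obtain r \<xi> where r: "strict_mono r" and wl: "(\<lambda>k. w (r k)) \<longlonglongrightarrow> \<xi>" by (rule bounded_subsequence)
    define t where "t k = s (r k)" for k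
    have t: "\<And>k. t k > 0" "t \<longlonglongrightarrow> 0"
      using s(1) tendsto_subsequence[OF s(2) r] by (simp_all add: t_def[abs_def])
    have xt: "(\<lambda>k. (x (r k) - xb) /\<^sub>R t k) \<longlonglongrightarrow> \<xi>" using wl by (simp add: w_def t_def)
    define h where "h = B \<xi> + \<beta>"
    have "(\<lambda>k. (G (x (r k)) - G xb) /\<^sub>R t k + \<beta>) \<longlonglongrightarrow> h"
      unfolding h_def by (intro tendsto_add tendsto_const G_scaled_limit[OF t xt])
    moreover have "(G (x (r k)) - G xb) /\<^sub>R t k + \<beta> = (G (x (r k)) + s (r k) *\<^sub>R \<beta> - G xb) /\<^sub>R t k" for k
    proof -
      have "(G (x (r k)) + s (r k) *\<^sub>R \<beta> - G xb) /\<^sub>R t k = (G (x (r k)) - G xb) /\<^sub>R t k + (t k *\<^sub>R \<beta>) /\<^sub>R t k"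
        unfolding scaleR_add_right[symmetric] by (simp add: t_def)
      then show ?thesis using t(1)[of k] by simp
    qed
    ultimately have At: "(\<lambda>k. (G (x (r k)) + s (r k) *\<^sub>R \<beta> - G xb) /\<^sub>R t k) \<longlonglongrightarrow> h" by simp
    have hQ: "h \<in> Q" by (rule tangent_direction_in_Q[OF t At]) (rule normal_cone_point[OF yN])
    have "(\<lambda>k. s k * (\<kappa> * norm \<beta>)) \<longlonglongrightarrow> 0" using tendsto_mult_right[OF s(2), of "\<kappa> * norm \<beta>"] by simp
    then have "y \<longlonglongrightarrow> yt" by (rule null_comparison_seq[OF xy(2)])
    then have yr: "(\<lambda>k. y (r k)) \<longlonglongrightarrow> yt" by (rule tendsto_subsequence[OF _ r])
    have "0 \<le> yt \<bullet> h"
    proof (rule LIMSEQ_le_const)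
      show "(\<lambda>k. y (r k) \<bullet> ((G (x (r k)) + s (r k) *\<^sub>R \<beta> - G xb) /\<^sub>R t k)) \<longlonglongrightarrow> yt \<bullet> h"
        by (rule tendsto_inner[OF yr At])
      have "0 \<le> y (r k) \<bullet> ((G (x (r k)) + s (r k) *\<^sub>R \<beta> - G xb) /\<^sub>R t k)" for k
      proof -
        have "y (r k) \<bullet> (G xb - (G (x (r k)) + s (r k) *\<^sub>R \<beta>)) \<le> 0" by (rule normal_coneD[OF yN feasible_xb])
        then have "0 \<le> y (r k) \<bullet> (G (x (r k)) + s (r k) *\<^sub>R \<beta> - G xb)" by (simp add: inner_diff_right)
        then show ?thesis using t(1)[of k] by simp
      qed
      then show "\<exists>N. \<forall>k\<ge>N. 0 \<le> y (r k) \<bullet> ((G (x (r k)) + s (r k) *\<^sub>R \<beta> - G xb) /\<^sub>R t k)" by blast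
    qed
    moreover have "yt \<bullet> h \<le> 0" using ytN hQ by (simp add: normal_cone_eq)
    ultimately have "h \<in> lineality_space (tangent_cone K (G xb))"
      by (intro relative_interior_normal_detects_lineality[OF ytri hQ]) simp
    then have "B (- \<xi>) + h \<in> range B + lineality_space (tangent_cone K (G xb))"
      by (intro set_plus_intro rangeI)
    then show ?thesis by (simp add: h_def blinfun.minus_right)
  qed
  then show ?thesis unfolding constraint_nondegenerate_def fderiv_G by blast
qed

text \<open>Along the KKT points realising \<open>(d, \<nu>)\<close>, tilt the objective by \<open>\<theta> t d\<close>. The Aubin property provides
solutions of the tilted systems at distance \<open>\<kappa> \<theta> t (norm d)\<close>, and their scaled displacements have a
limit that solves the quadratic system with right-hand side \<open>\<theta> d\<close>.\<close>

lemma Aubin_shifted_direction: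
  assumes Aubin: "Aubin_property (S_KKT f G K) (0, 0) (xb, yb)"
  shows "\<exists>\<kappa>>0. \<forall>d \<nu> \<theta>. kkt_direction d \<nu> \<longrightarrow> \<theta> > 0 \<longrightarrow>
    (\<exists>u \<nu>'. B u \<in> critical \<and> \<nu>' \<in> normal_cone critical (B u) \<and> Hred u + adjoint B \<nu>' = \<theta> *\<^sub>R d \<and>
      norm (u - d) \<le> \<kappa> * \<theta> * norm d)"
proof -
  obtain \<kappa> U V' where U: "\<kappa> > 0" "open U" "(0, 0) \<in> U" "open V'" "(xb, yb) \<in> V'"
    and A: "\<And>p p'. p \<in> U \<Longrightarrow> p' \<in> U \<Longrightarrow> S_KKT f G K p \<inter> V' \<subseteq> S_KKT f G K p' + cball 0 (\<kappa> * norm (p - p'))"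
    using Aubin unfolding Aubin_property_def by blast
  have "\<exists>u \<nu>'. B u \<in> critical \<and> \<nu>' \<in> normal_cone critical (B u) \<and> Hred u + adjoint B \<nu>' = \<theta> *\<^sub>R d \<and>
      norm (u - d) \<le> \<kappa> * \<theta> * norm d" if dir: "kkt_direction d \<nu>" and \<theta>: "\<theta> > 0" for d \<nu> \<theta>
  proof (rule kkt_direction_realisation[OF dir])
    fix t x y a b
    assume t: "\<And>k::nat. t k > 0" "t \<longlonglongrightarrow> 0" and kkt: "\<And>k. (x k, y k) \<in> S_KKT f G K (a k, b k)"
      and x: "(\<lambda>k. (x k - xb) /\<^sub>R t k) \<longlonglongrightarrow> d" and y: "(\<lambda>k. (y k - yb) /\<^sub>R t k) \<longlonglongrightarrow> \<nu> + curv (B d)"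
      and a: "(\<lambda>k. a k /\<^sub>R t k) \<longlonglongrightarrow> 0" and b: "(\<lambda>k. b k /\<^sub>R t k) \<longlonglongrightarrow> 0"
    have a0: "a \<longlonglongrightarrow> 0" by (rule tendsto_scaled_imp_tendsto[of t a 0 0, OF t(2) _ t(1)]) (simp add: a)
    have b0: "b \<longlonglongrightarrow> 0" by (rule tendsto_scaled_imp_tendsto[of t b 0 0, OF t(2) _ t(1)]) (simp add: b)
    have "(\<lambda>k. a k + (\<theta> * t k) *\<^sub>R d) \<longlonglongrightarrow> 0 + (\<theta> * 0) *\<^sub>R d" by (intro tendsto_intros a0 t)
    then have a'0: "(\<lambda>k. a k + (\<theta> * t k) *\<^sub>R d) \<longlonglongrightarrow> 0" by simp
    have "\<forall>\<^sub>F k in sequentially. (x k, y k) \<in> V'"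
      by (rule topological_tendstoD[OF tendsto_Pair[OF tendsto_scaled_imp_tendsto[OF t(2) x t(1)]
              tendsto_scaled_imp_tendsto[OF t(2) y t(1)]] U(4,5)])
    moreover have "\<forall>\<^sub>F k in sequentially. (a k, b k) \<in> U"
      by (rule topological_tendstoD[OF tendsto_Pair[OF a0 b0] U(2,3)])
    moreover have "\<forall>\<^sub>F k in sequentially. (a k + (\<theta> * t k) *\<^sub>R d, b k) \<in> U"
      by (rule topological_tendstoD[OF tendsto_Pair[OF a'0 b0] U(2,3)])
    ultimately have "\<forall>\<^sub>F k in sequentially. (x k, y k) \<in> V' \<and> (a k, b k) \<in> U \<and> (a k + (\<theta> * t k) *\<^sub>R d, b k) \<in> U"
      by (intro eventually_conj)
    then obtain M where M: "\<And>k. k \<ge> M \<Longrightarrow> (x k, y k) \<in> V' \<and> (a k, b k) \<in> U \<and> (a k + (\<theta> * t k) *\<^sub>R d, b k) \<in> U"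
      unfolding eventually_sequentially by blast
    have "\<exists>q. k \<ge> M \<longrightarrow> q \<in> S_KKT f G K (a k + (\<theta> * t k) *\<^sub>R d, b k) \<and> norm ((x k, y k) - q) \<le> t k * (\<kappa> * \<theta> * norm d)" for k
    proof (cases "k \<ge> M")
      case True
      note m = M[OF True]
      from subsetD[OF A[of "(a k, b k)" "(a k + (\<theta> * t k) *\<^sub>R d, b k)"] IntI[OF kkt]] m
      obtain q where q: "q \<in> S_KKT f G K (a k + (\<theta> * t k) *\<^sub>R d, b k)"
        "norm ((x k, y k) - q) \<le> \<kappa> * norm ((a k, b k) - (a k + (\<theta> * t k) *\<^sub>R d, b k))"
        unfolding mem_plus_cball by blast
      have "norm ((a k, b k) - (a k + (\<theta> * t k) *\<^sub>R d, b k)) = \<theta> * t k * norm d"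
      proof -
        have "(a k, b k) - (a k + (\<theta> * t k) *\<^sub>R d, b k) = (- ((\<theta> * t k) *\<^sub>R d), 0)" by simp
        moreover have "\<theta> * t k > 0" using t(1)[of k] \<theta> by simp
        ultimately show ?thesis by (simp only: norm_Pair) simp
      qed
      with q(2) have "norm ((x k, y k) - q) \<le> t k * (\<kappa> * \<theta> * norm d)" by (simp only: mult_ac)
      then show ?thesis using q(1) by blast
    qed simp
    then obtain q where q: "\<And>k. k \<ge> M \<Longrightarrow> q k \<in> S_KKT f G K (a k + (\<theta> * t k) *\<^sub>R d, b k) \<and>
        norm ((x k, y k) - q k) \<le> t k * (\<kappa> * \<theta> * norm d)" by metis
    define w where "w k = ((x (k + M), y (k + M)) - q (k + M)) /\<^sub>R t (k + M)" for k
    have wb: "norm (w k) \<le> \<kappa> * \<theta> * norm d" for k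
    proof -
      have "norm ((x (k + M), y (k + M)) - q (k + M)) \<le> t (k + M) * (\<kappa> * \<theta> * norm d)" using q[of "k + M"] by simp
      then have "norm ((x (k + M), y (k + M)) - q (k + M)) / t (k + M) \<le> \<kappa> * \<theta> * norm d"
        using t(1)[of "k + M"] by (simp add: pos_divide_le_eq mult.commute)
      moreover have "norm (w k) = norm ((x (k + M), y (k + M)) - q (k + M)) / t (k + M)"
        using t(1)[of "k + M"] unfolding w_def norm_scaleR by (simp add: divide_inverse_commute)
      ultimately show ?thesis by simp
    qed
    then have "bounded (range w)" unfolding bounded_iff by blast
    then obtain r l where r: "strict_mono r" and wl: "(\<lambda>k. w (r k)) \<longlonglongrightarrow> l" by (rule bounded_subsequence)
    have ln: "norm l \<le> \<kappa> * \<theta> * norm d"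
    proof (rule LIMSEQ_le_const2[OF tendsto_norm[OF wl]])
      show "\<exists>N. \<forall>k\<ge>N. norm (w (r k)) \<le> \<kappa> * \<theta> * norm d" using wb by blast
    qed
    define i where "i k = r k + M" for k
    have i: "strict_mono i" using r by (simp add: i_def strict_mono_def)
    define \<tau> where "\<tau> k = t (i k)" for k
    have \<tau>: "\<And>k. \<tau> k > 0" "\<tau> \<longlonglongrightarrow> 0"
      using t(1) tendsto_subsequence[OF t(2) i] by (simp_all add: \<tau>_def[abs_def])
    have kkt': "(fst (q (i k)), snd (q (i k))) \<in> S_KKT f G K (a (i k) + (\<theta> * \<tau> k) *\<^sub>R d, b (i k))" for k
      using q[of "i k"] by (simp add: i_def \<tau>_def)
    have "(\<lambda>k. (x (i k) - xb) /\<^sub>R \<tau> k - fst (w (r k))) \<longlonglongrightarrow> d - fst l"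
      unfolding \<tau>_def by (intro tendsto_diff tendsto_fst wl tendsto_subsequence[OF x i])
    moreover have "(x (i k) - xb) /\<^sub>R \<tau> k - fst (w (r k)) = (fst (q (i k)) - xb) /\<^sub>R \<tau> k" for k
      unfolding w_def i_def \<tau>_def by (simp add: scaleR_diff_right)
    ultimately have x': "(\<lambda>k. (fst (q (i k)) - xb) /\<^sub>R \<tau> k) \<longlonglongrightarrow> d - fst l" by simp
    have "(\<lambda>k. (y (i k) - yb) /\<^sub>R \<tau> k - snd (w (r k))) \<longlonglongrightarrow> (\<nu> + curv (B d)) - snd l"
      unfolding \<tau>_def by (intro tendsto_diff tendsto_snd wl tendsto_subsequence[OF y i])
    moreover have "(y (i k) - yb) /\<^sub>R \<tau> k - snd (w (r k)) = (snd (q (i k)) - yb) /\<^sub>R \<tau> k" for k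
      unfolding w_def i_def \<tau>_def by (simp add: scaleR_diff_right)
    ultimately have y': "(\<lambda>k. (snd (q (i k)) - yb) /\<^sub>R \<tau> k) \<longlonglongrightarrow> (\<nu> + curv (B d)) - snd l" by simp
    have "(\<lambda>k. a (i k) /\<^sub>R \<tau> k + \<theta> *\<^sub>R d) \<longlonglongrightarrow> 0 + \<theta> *\<^sub>R d"
      unfolding \<tau>_def by (intro tendsto_add tendsto_const tendsto_subsequence[OF a i])
    moreover have "a (i k) /\<^sub>R \<tau> k + \<theta> *\<^sub>R d = (a (i k) + (\<theta> * \<tau> k) *\<^sub>R d) /\<^sub>R \<tau> k" for k
      using \<tau>(1)[of k] by (simp add: scaleR_add_right)
    ultimately have a': "(\<lambda>k. (a (i k) + (\<theta> * \<tau> k) *\<^sub>R d) /\<^sub>R \<tau> k) \<longlonglongrightarrow> \<theta> *\<^sub>R d" by simp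
    have b': "(\<lambda>k. b (i k) /\<^sub>R \<tau> k) \<longlonglongrightarrow> 0" unfolding \<tau>_def by (rule tendsto_subsequence[OF b i])
    note lim = kkt_sequence_limit[OF \<tau> kkt' x' y' a' b']
    have "norm (d - fst l - d) \<le> \<kappa> * \<theta> * norm d"
      using ln norm_fst_le[of "fst l" "snd l"] by simp
    with lim show ?thesis by blast
  qed
  then show ?thesis using U(1) by blast
qed

text \<open>Let \<open>d\<close> be a direction with \<open>Hred d \<bullet> d = 0\<close> and let \<open>u = d + w\<close> solve the system tilted by \<open>\<theta> d\<close>.
Testing its equation with \<open>d\<close> gives \<open>\<theta> (d \<bullet> d) \<le> Hred w \<bullet> d\<close>, testing it with \<open>u\<close> gives
\<open>2 (Hred w \<bullet> d) + Hred w \<bullet> w = \<theta> (d \<bullet> d) + \<theta> (d \<bullet> w)\<close>. Together, \<open>\<theta> (d \<bullet> d)\<close> is at most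
\<open>\<theta> (d \<bullet> w) - Hred w \<bullet> w\<close>, which is of order \<open>\<theta>\<^sup>2\<close> because \<open>w\<close> is of order \<open>\<theta>\<close>.\<close>

lemma Aubin_imp_nondegenerate_SOSC:
  assumes Aubin: "Aubin_property (S_KKT f G K) (0, 0) (xb, yb)" and opt: "locally_optimal f G K 0 0 xb"
  shows "constraint_nondegenerate G K xb \<and> SOSC f G K xb"
proof -
  have nd: "constraint_nondegenerate G K xb" by (rule Aubin_imp_nondegenerate[OF Aubin])
  have D: dual_SRCQ using nondegenerate_imp_SRCQ[OF nd] SRCQ_iff_dual by blast
  obtain \<kappa> where \<kappa>: "\<kappa> > 0" and shift: "\<And>d \<nu> \<theta>. kkt_direction d \<nu> \<Longrightarrow> \<theta> > 0 \<Longrightarrow>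
    \<exists>u \<nu>'. B u \<in> critical \<and> \<nu>' \<in> normal_cone critical (B u) \<and> Hred u + adjoint B \<nu>' = \<theta> *\<^sub>R d \<and>
      norm (u - d) \<le> \<kappa> * \<theta> * norm d"
    using Aubin_shifted_direction[OF Aubin] by blast
  have Hred_positive
  proof (rule Hred_positive_if_no_direction[OF D opt], rule ccontr)
    fix d \<nu> assume dir: "kkt_direction d \<nu>" and q0: "Hred d \<bullet> d = 0" and d0: "d \<noteq> 0"
    have bl: "bounded_linear Hred" using linear_Hred by (simp add: linear_conv_bounded_linear)
    obtain M where M: "M \<ge> 0" "\<And>w. norm (Hred w) \<le> norm w * M" using bounded_linear.nonneg_bounded[OF bl] by blast
    \<comment> \<open>\<open>c \<theta>\<^sup>2 (norm d)\<^sup>2\<close> bounds the right-hand side; \<open>\<theta>\<close> makes it half of \<open>\<theta> (d \<bullet> d)\<close>.\<close>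
    define c where "c = \<kappa> + M * \<kappa>\<^sup>2"
    have c: "c > 0" using \<kappa> M(1) by (simp add: c_def add_pos_nonneg)
    define \<theta> where "\<theta> = 1 / (2 * c)"
    have \<theta>: "\<theta> > 0" "\<theta> * c = 1 / 2" using c by (simp_all add: \<theta>_def)
    obtain u \<nu>' where u: "B u \<in> critical" "\<nu>' \<in> normal_cone critical (B u)" "Hred u + adjoint B \<nu>' = \<theta> *\<^sub>R d"
      "norm (u - d) \<le> \<kappa> * \<theta> * norm d" using shift[OF dir \<theta>(1)] by blast
    define w where "w = u - d"
    have uw: "u = d + w" by (simp add: w_def)
    have Bd: "B d \<in> critical" using dir by (simp add: kkt_direction_def)
    have \<nu>': "\<nu>' \<bullet> B u = 0" "\<nu>' \<bullet> B d \<le> 0"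
      using u(2) Bd by (simp_all add: normal_cone_convex_cone[OF convex_cone_critical])
    have test: "Hred u \<bullet> v + \<nu>' \<bullet> B v = \<theta> * (d \<bullet> v)" for v
    proof -
      have "(Hred u + adjoint B \<nu>') \<bullet> v = (\<theta> *\<^sub>R d) \<bullet> v" by (simp only: u(3))
      then show ?thesis by (simp add: inner_add_left adjoint_blinfun)
    qed
    have Hu: "Hred u = Hred d + Hred w" unfolding uw by (rule linear_add[OF linear_Hred])
    have 1: "\<theta> * (d \<bullet> d) \<le> Hred w \<bullet> d" using test[of d] \<nu>'(2) q0 by (simp add: Hu inner_add_left)
    have "Hred u \<bullet> u = 2 * (Hred w \<bullet> d) + Hred w \<bullet> w"
      unfolding Hu using q0 Hred_sym[of d w] by (simp add: uw inner_add_left inner_add_right)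
    then have 2: "2 * (Hred w \<bullet> d) + Hred w \<bullet> w = \<theta> * (d \<bullet> d) + \<theta> * (d \<bullet> w)"
      using test[of u] \<nu>'(1) by (simp add: uw inner_add_right distrib_left)
    have wn: "norm w \<le> \<kappa> * \<theta> * norm d" using u(4) by (simp add: w_def)
    have "\<theta> * (d \<bullet> d) \<le> \<theta> * (d \<bullet> w) - Hred w \<bullet> w" using 1 2 by linarith
    also have "\<dots> \<le> \<theta> * (norm d * norm w) + norm w * M * norm w"
    proof -
      have "\<theta> * (d \<bullet> w) \<le> \<theta> * (norm d * norm w)"
        using \<theta>(1) norm_cauchy_schwarz[of d w] by (intro mult_left_mono) simp_all
      moreover have "- (Hred w \<bullet> w) \<le> norm (Hred w) * norm w"
        using norm_cauchy_schwarz[of "- Hred w" w] by simp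
      moreover have "norm (Hred w) * norm w \<le> norm w * M * norm w" using M(2) by (intro mult_right_mono) simp_all
      ultimately show ?thesis by linarith
    qed
    also have "\<dots> \<le> \<theta> * (norm d * (\<kappa> * \<theta> * norm d)) + (\<kappa> * \<theta> * norm d) * M * (\<kappa> * \<theta> * norm d)"
      using wn \<theta>(1) M(1) \<kappa> by (intro add_mono mult_left_mono mult_mono) simp_all
    also have "\<dots> = \<theta> * (\<theta> * c) * (norm d)\<^sup>2"
      unfolding c_def by (simp add: power2_eq_square algebra_simps)
    also have "\<dots> = \<theta> * (d \<bullet> d) / 2" by (simp add: \<theta>(2) power2_norm_eq_inner)
    finally have "\<theta> * (d \<bullet> d) \<le> 0" by simp
    moreover have "d \<bullet> d > 0" using d0 by simp
    ultimately show False using \<theta>(1) by (simp add: mult_le_0_iff)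
  qed
  then show ?thesis using nd SOSC_iff[OF multipliers_unique[OF D]] by blast
qed

end

section \<open>Transfer between the solution mappings\<close>

lemma locally_Lipschitz_if_C1:
  fixes g :: "'a::real_normed_vector \<Rightarrow> 'b::real_normed_vector" and g' :: "'a \<Rightarrow> 'a \<Rightarrow>\<^sub>L 'b"
  assumes "\<And>x. (g has_derivative g' x) (at x)" "isCont g' x0"
  obtains L r where "L > 0" "r > 0" "\<And>x z. dist x x0 < r \<Longrightarrow> dist z x0 < r \<Longrightarrow> norm (g x - g z) \<le> L * norm (x - z)"
proof -
  obtain r where r: "r > 0" "\<And>x z. dist x x0 < r \<Longrightarrow> dist z x0 < r \<Longrightarrow>
    norm (g x - g z - g' x0 (x - z)) \<le> 1 * norm (x - z)"
    by (rule strictly_differentiable[OF open_UNIV UNIV_I assms(1,2) zero_less_one]) blast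
  have "norm (g x - g z) \<le> (norm (g' x0) + 1) * norm (x - z)" if "dist x x0 < r" "dist z x0 < r" for x z
  proof -
    have "norm (g x - g z) \<le> norm (g x - g z - g' x0 (x - z)) + norm (g' x0 (x - z))"
      using norm_triangle_ineq[of "g x - g z - g' x0 (x - z)" "g' x0 (x - z)"] by simp
    also have "\<dots> \<le> 1 * norm (x - z) + norm (g' x0) * norm (x - z)"
      using r(2)[OF that] norm_blinfun[of "g' x0" "x - z"] by linarith
    finally show ?thesis by (simp add: distrib_right)
  qed
  moreover have "norm (g' x0) + 1 > 0" by (simp add: add_nonneg_pos)
  ultimately show ?thesis using that[OF _ r(1)] by blast
qed

text \<open>The change of variables is Lipschitz in both directions near the reference point. The same form
describes \<open>\<Theta>\<close> in terms of \<open>\<Theta>'\<close>, with \<open>- g\<close> in place of \<open>g\<close>, so that one implication suffices for an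
equivalence.\<close>

lemma Aubin_property_shear:
  fixes \<Theta> \<Theta>' :: "'x::euclidean_space \<times> 'y::euclidean_space \<Rightarrow> ('x \<times> 'y) set"
  assumes \<Theta>': "\<And>a b x z. (x, z) \<in> \<Theta>' (a, b) \<longleftrightarrow> (x, z - g x + b) \<in> \<Theta> (a, - b)"
    and g: "isCont g xb" and L: "L > 0" "r > 0"
      "\<And>x z. dist x xb < r \<Longrightarrow> dist z xb < r \<Longrightarrow> norm (g x - g z) \<le> L * norm (x - z)"
    and Aubin: "Aubin_property \<Theta> (0, 0) (xb, yb)"
  shows "Aubin_property \<Theta>' (0, 0) (xb, yb + g xb)"
proof -
  obtain \<kappa> U V where q0: "(xb, yb) \<in> \<Theta> (0, 0)" and U: "\<kappa> > 0" "open U" "(0, 0) \<in> U" "open V" "(xb, yb) \<in> V"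
    and A: "\<And>p p'. p \<in> U \<Longrightarrow> p' \<in> U \<Longrightarrow> \<Theta> p \<inter> V \<subseteq> \<Theta> p' + cball 0 (\<kappa> * norm (p - p'))"
    using Aubin unfolding Aubin_property_def by blast
  obtain u where u: "u > 0" "ball (0, 0) u \<subseteq> U" using openE[OF U(2,3)] by blast
  obtain v where v: "v > 0" "ball (xb, yb) v \<subseteq> V" using openE[OF U(4,5)] by blast
  obtain d0 where d0: "d0 > 0" "\<And>x. dist x xb < d0 \<Longrightarrow> dist (g x) (g xb) < v / 8"
    using g v(1) unfolding continuous_at_eps_delta by (metis zero_less_divide_iff zero_less_numeral)
  \<comment> \<open>Small enough for points and parameters to stay in the given neighbourhoods, and for the solution
    \<open>x'\<close> at distance \<open>2 \<kappa> \<rho>\<close> to stay where \<open>g\<close> is Lipschitz.\<close>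
  define \<rho> where "\<rho> = min (min u d0) (min (v / 8) (r / (2 * (1 + 2 * \<kappa>))))"
  have \<rho>: "\<rho> > 0" "\<rho> \<le> u" "\<rho> \<le> d0" "\<rho> \<le> v / 8" "\<rho> \<le> r / (2 * (1 + 2 * \<kappa>))"
  proof -
    show "\<rho> > 0" using u(1) d0(1) v(1) L(2) U(1) by (simp add: \<rho>_def)
    show "\<rho> \<le> u" "\<rho> \<le> d0" "\<rho> \<le> v / 8" "\<rho> \<le> r / (2 * (1 + 2 * \<kappa>))"
      by (simp_all only: \<rho>_def min_le_iff_disj order_refl simp_thms)
  qed
  have \<rho>r: "\<rho> + 2 * \<kappa> * \<rho> < r"
  proof -
    have "\<rho> * (2 * (1 + 2 * \<kappa>)) \<le> r" using \<rho>(5) U(1) by (simp add: pos_le_divide_eq)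
    moreover have "\<rho> * (2 * (1 + 2 * \<kappa>)) = 2 * (\<rho> + 2 * \<kappa> * \<rho>)" by (simp add: algebra_simps)
    ultimately have le: "2 * (\<rho> + 2 * \<kappa> * \<rho>) \<le> r" by (simp only:)
    define S where "S = \<rho> + 2 * \<kappa> * \<rho>"
    have "0 < S" using \<rho>(1) U(1) by (simp add: S_def add_pos_pos)
    moreover have "2 * S \<le> r" using le by (simp only: S_def)
    ultimately have "S < r" by linarith
    then show ?thesis by (simp only: S_def)
  qed
  define \<kappa>' where "\<kappa>' = 2 * \<kappa> + L * \<kappa> + 1"
  have "\<Theta>' p \<inter> ball (xb, yb + g xb) \<rho> \<subseteq> \<Theta>' p' + cball 0 (\<kappa>' * norm (p - p'))"
    if p: "p \<in> ball (0, 0) \<rho>" "p' \<in> ball (0, 0) \<rho>" for p p'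
  proof
    fix q assume q: "q \<in> \<Theta>' p \<inter> ball (xb, yb + g xb) \<rho>"
    obtain a b where ab: "p = (a, b)" by (cases p)
    obtain a' b' where ab': "p' = (a', b')" by (cases p')
    obtain x z where xz: "q = (x, z)" by (cases q)
    have np: "norm (a, b) < \<rho>" "norm (a', b') < \<rho>"
      using p by (simp_all add: ab ab' zero_prod_def[symmetric])
    have npm: "norm (a, - b) < u" "norm (a', - b') < u"
      using np \<rho>(2) by (simp_all add: norm_Pair)
    have pU: "(a, - b) \<in> U" "(a', - b') \<in> U"
      using npm u(2) by (auto simp: zero_prod_def[symmetric])
    have "dist (xb, yb + g xb) q < \<rho>" using q by simp
    then have nq: "norm ((x, z) - (xb, yb + g xb)) < \<rho>" unfolding xz by (metis dist_commute dist_norm)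
    have nxz: "norm (x - xb) < \<rho>" "norm (z - (yb + g xb)) < \<rho>"
      using nq norm_fst_le[of "x - xb" "z - (yb + g xb)"] norm_snd_le[of "z - (yb + g xb)" "x - xb"] by simp_all
    have nb: "norm b < \<rho>" using np(1) norm_snd_le[of b a] by simp
    define y where "y = z - g x + b"
    have "(x, y) \<in> V"
    proof -
      have eq: "y - yb = (z - (yb + g xb)) - (g x - g xb) + b" by (simp add: y_def)
      have "norm (y - yb) \<le> norm (z - (yb + g xb)) + norm (g x - g xb) + norm b"
        unfolding eq by (rule order_trans[OF norm_triangle_ineq add_right_mono[OF norm_triangle_ineq4]])
      moreover have "norm (g x - g xb) < v / 8" using d0(2)[of x] nxz(1) \<rho>(3) by (simp add: dist_norm)
      ultimately have "norm (y - yb) \<le> 3 * (v / 8)" using nxz(2) nb \<rho>(4) by linarith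
      moreover have "norm ((x, y) - (xb, yb)) \<le> norm (x - xb) + norm (y - yb)"
        using norm_Pair_le[of "x - xb" "y - yb"] by simp
      ultimately have "norm ((x, y) - (xb, yb)) < v" using nxz(1) \<rho>(4) v(1) by linarith
      then have "(x, y) \<in> ball (xb, yb) v" by (metis mem_ball dist_commute dist_norm)
      then show ?thesis using v(2) by blast
    qed
    moreover have "(x, y) \<in> \<Theta> (a, - b)" using q \<Theta>'[of x z a b] by (simp add: xz ab y_def)
    ultimately obtain q' where q': "q' \<in> \<Theta> (a', - b')" "norm ((x, y) - q') \<le> \<kappa> * norm ((a, - b) - (a', - b'))"
      using subsetD[OF A[OF pU]] unfolding mem_plus_cball by blast
    obtain x' y' where xy': "q' = (x', y')" by (cases q')
    have npp: "norm ((a, - b) - (a', - b')) = norm (p - p')"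
      by (simp add: ab ab' norm_Pair norm_minus_commute)
    define D where "D = norm (p - p')"
    have D: "norm (x - x') \<le> \<kappa> * D" "norm (y - y') \<le> \<kappa> * D"
      using q'(2) norm_fst_le[of "x - x'" "y - y'"] norm_snd_le[of "y - y'" "x - x'"]
      unfolding npp D_def[symmetric] xy' by simp_all
    have Db: "norm (b - b') \<le> D" using norm_snd_le[of "b - b'" "a - a'"] by (simp add: D_def ab ab')
    have "D \<le> norm p + norm p'" unfolding D_def by (rule norm_triangle_ineq4)
    then have "D \<le> 2 * \<rho>" using np by (simp add: ab ab')
    then have "\<kappa> * D \<le> 2 * \<kappa> * \<rho>" using U(1) by (simp add: mult.assoc[symmetric])
    then have "norm (x - x') + norm (x - xb) < r" using D(1) nxz(1) \<rho>r by linarith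
    then have near: "dist x' x + dist x xb < r" by (simp add: dist_norm norm_minus_commute)
    have "dist x' xb < r" using near dist_triangle[of x' xb x] by linarith
    moreover have "dist x xb < r" using near zero_le_dist[of x' x] by linarith
    ultimately have "norm (g x - g x') \<le> L * norm (x - x')" using L(3) by blast
    also have "\<dots> \<le> L * (\<kappa> * D)" using D(1) L(1) by (intro mult_left_mono) simp_all
    finally have Dg: "norm (g x - g x') \<le> L * (\<kappa> * D)" .
    define z' where "z' = y' + g x' - b'"
    have "(x', z') \<in> \<Theta>' p'" using q'(1) \<Theta>'[of x' z' a' b'] by (simp add: ab' xy' z'_def)
    moreover have "norm (q - (x', z')) \<le> \<kappa>' * D"
    proof -
      have eq: "z - z' = (y - y') + (g x - g x') - (b - b')" by (simp add: y_def z'_def)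
      have "norm (z - z') \<le> norm (y - y') + norm (g x - g x') + norm (b - b')"
        unfolding eq by (rule order_trans[OF norm_triangle_ineq4 add_right_mono[OF norm_triangle_ineq]])
      moreover have "norm (q - (x', z')) \<le> norm (x - x') + norm (z - z')"
        using norm_Pair_le[of "x - x'" "z - z'"] by (simp add: xz)
      ultimately have "norm (q - (x', z')) \<le> \<kappa> * D + (\<kappa> * D + L * (\<kappa> * D) + D)" using D Dg Db by linarith
      then show ?thesis by (simp add: \<kappa>'_def algebra_simps)
    qed
    ultimately show "q \<in> \<Theta>' p' + cball 0 (\<kappa>' * norm (p - p'))" unfolding mem_plus_cball D_def by blast
  qed
  moreover have "(xb, yb + g xb) \<in> \<Theta>' (0, 0)" using \<Theta>'[of xb "yb + g xb" 0 0] q0 by simp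
  moreover have "\<kappa>' > 0" using U(1) L(1) by (simp add: \<kappa>'_def add_pos_pos)
  ultimately show ?thesis
    unfolding Aubin_property_def using \<rho>(1)
    by (intro conjI exI[of _ \<kappa>'] exI[of _ "ball (0, 0) \<rho>"] exI[of _ "ball (xb, yb + g xb) \<rho>"]) auto
qed

text \<open>The parameter change depends on the solution through \<open>g x b\<close>. Calmness tolerates this, because it
bounds solutions by the size of their own parameter only, and \<open>g x b\<close> is of the order of \<open>b\<close>. If
\<open>g\<close> is odd in \<open>b\<close>, the relation between \<open>\<Theta>\<close> and \<open>\<Theta>'\<close> is symmetric.\<close>

lemma isolated_calm_shear:
  fixes \<Theta> \<Theta>' :: "'x::euclidean_space \<times> 'y::euclidean_space \<Rightarrow> ('x \<times> 'y) set"
  assumes \<Theta>': "\<And>a b x y. (x, y) \<in> \<Theta>' (a, b) \<longleftrightarrow> (x, y + b) \<in> \<Theta> (a + g x b, - b)"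
    and g: "M > 0" "r > 0" "\<And>x b. dist x xb < r \<Longrightarrow> norm (g x b) \<le> M * norm b" "g xb 0 = 0"
    and calm: "isolated_calm \<Theta> (0, 0) (xb, yb)"
  shows "isolated_calm \<Theta>' (0, 0) (xb, yb)"
proof -
  obtain \<kappa> U V where q0: "(xb, yb) \<in> \<Theta> (0, 0)" and c: "isolated_calm_on \<Theta> (0, 0) (xb, yb) \<kappa> U V"
    using calm unfolding isolated_calm_def by blast
  have U: "\<kappa> > 0" "open U" "(0, 0) \<in> U" "open V" "(xb, yb) \<in> V" using c by (simp_all add: isolated_calm_on_def)
  have A: "\<Theta> p \<inter> V \<subseteq> {(xb, yb)} + cball 0 (\<kappa> * norm (p - (0, 0)))" if "p \<in> U" for p
    using c that by (simp add: isolated_calm_on_def)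
  obtain u where u: "u > 0" "ball (0, 0) u \<subseteq> U" using openE[OF U(2,3)] by blast
  obtain v where v: "v > 0" "ball (xb, yb) v \<subseteq> V" using openE[OF U(4,5)] by blast
  define \<rho> where "\<rho> = min (min (u / (M + 2)) (v / 2)) r"
  have \<rho>: "\<rho> > 0" "\<rho> \<le> u / (M + 2)" "\<rho> \<le> v / 2" "\<rho> \<le> r" 
  proof -
    show "\<rho> > 0" using u(1) v(1) g(1,2) by (simp add: \<rho>_def)
    show "\<rho> \<le> u / (M + 2)" "\<rho> \<le> v / 2" "\<rho> \<le> r"
      by (simp_all only: \<rho>_def min_le_iff_disj order_refl simp_thms)
  qed
  define \<kappa>' where "\<kappa>' = \<kappa> * (M + 2) + 1"
  have "\<Theta>' p \<inter> ball (xb, yb) \<rho> \<subseteq> {(xb, yb)} + cball 0 (\<kappa>' * norm (p - (0, 0)))" if p: "p \<in> ball (0, 0) \<rho>" for p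
  proof
    fix q assume q: "q \<in> \<Theta>' p \<inter> ball (xb, yb) \<rho>"
    obtain a b where ab: "p = (a, b)" by (cases p)
    obtain x y where xy: "q = (x, y)" by (cases q)
    have np: "norm p < \<rho>" using p by (simp add: zero_prod_def[symmetric])
    have nab: "norm a \<le> norm p" "norm b \<le> norm p" using norm_fst_le[of a b] norm_snd_le[of b a] by (simp_all add: ab)
    have "dist (xb, yb) q < \<rho>" using q by simp
    then have nq: "norm ((x, y) - (xb, yb)) < \<rho>" unfolding xy by (metis dist_commute dist_norm)
    have nx: "norm (x - xb) < \<rho>" using nq norm_fst_le[of "x - xb" "y - yb"] by simp
    then have gb: "norm (g x b) \<le> M * norm b" using g(3) \<rho>(4) by (simp add: dist_norm)
    also have "\<dots> \<le> M * norm p" using nab(2) g(1) by (intro mult_left_mono) simp_all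
    finally have gb: "norm (g x b) \<le> M * norm p" .
    have np': "norm (a + g x b, - b) \<le> (M + 2) * norm p"
      using norm_Pair_le[of "a + g x b" "- b"] norm_triangle_ineq[of a "g x b"] gb nab
      by (simp add: distrib_right)
    also have "\<dots> < (M + 2) * \<rho>" using np g(1) by (intro mult_strict_left_mono) simp_all
    also have "\<dots> \<le> u" using \<rho>(2) g(1) by (simp add: pos_le_divide_eq mult.commute)
    finally have "norm (a + g x b, - b) < u" .
    then have pU: "(a + g x b, - b) \<in> U" using u(2) by (auto simp: zero_prod_def[symmetric])
    have eq: "(x, y + b) - (xb, yb) = ((x, y) - (xb, yb)) + (0, b)" by simp
    have n0b: "norm (0 :: 'x, b) = norm b" by (simp add: norm_Pair)
    have "norm ((x, y + b) - (xb, yb)) < v"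
      unfolding eq using norm_triangle_ineq[of "(x, y) - (xb, yb)" "(0, b)"] nq n0b nab(2) np \<rho>(3) by linarith
    then have "(x, y + b) \<in> ball (xb, yb) v" by (metis mem_ball dist_commute dist_norm)
    then have "(x, y + b) \<in> V" using v(2) by blast
    moreover have "(x, y + b) \<in> \<Theta> (a + g x b, - b)" using q \<Theta>'[of x y a b] by (simp add: xy ab)
    ultimately have "(x, y + b) \<in> {(xb, yb)} + cball 0 (\<kappa> * norm ((a + g x b, - b) - (0, 0)))"
      using subsetD[OF A[OF pU]] by blast
    then have "norm ((x, y + b) - (xb, yb)) \<le> \<kappa> * norm (a + g x b, - b)"
      unfolding mem_singleton_plus_cball by simp
    also have "\<dots> \<le> \<kappa> * ((M + 2) * norm p)" using np' U(1) by (intro mult_left_mono) simp_all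
    finally have e1: "norm ((x, y + b) - (xb, yb)) \<le> \<kappa> * ((M + 2) * norm p)" .
    have eq': "(x, y) - (xb, yb) = ((x, y + b) - (xb, yb)) - (0, b)" by simp
    have "norm ((x, y) - (xb, yb)) \<le> norm ((x, y + b) - (xb, yb)) + norm b"
      unfolding eq' n0b[symmetric] by (rule norm_triangle_ineq4)
    then have "norm (q - (xb, yb)) \<le> \<kappa>' * norm p"
      using e1 nab(2) unfolding xy \<kappa>'_def by (simp add: algebra_simps)
    then show "q \<in> {(xb, yb)} + cball 0 (\<kappa>' * norm (p - (0, 0)))"
      unfolding mem_singleton_plus_cball by (simp add: zero_prod_def[symmetric])
  qed
  moreover have "\<kappa>' > 0" using U(1) g(1) by (simp add: \<kappa>'_def add_pos_pos)
  ultimately have "isolated_calm_on \<Theta>' (0, 0) (xb, yb) \<kappa>' (ball (0, 0) \<rho>) (ball (xb, yb) \<rho>)"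
    unfolding isolated_calm_on_def using \<rho>(1) by auto
  moreover have "(xb, yb) \<in> \<Theta>' (0, 0)" using \<Theta>'[of xb yb 0 0] q0 g(4) by simp
  ultimately show ?thesis unfolding isolated_calm_def by blast
qed

lemma norm_adjoint_le:
  fixes L :: "'a::euclidean_space \<Rightarrow>\<^sub>L 'b::euclidean_space"
  shows "norm (adjoint L n) \<le> norm L * norm n"
proof (cases "adjoint (blinfun_apply L) n = 0")
  case False
  have "norm (adjoint L n) * norm (adjoint L n) = n \<bullet> L (adjoint L n)"
    by (simp add: adjoint_blinfun[symmetric] power2_eq_square[symmetric] power2_norm_eq_inner)
  also have "\<dots> \<le> norm n * norm (L (adjoint L n))" by (rule norm_cauchy_schwarz)
  also have "\<dots> \<le> norm n * (norm L * norm (adjoint L n))" by (intro mult_left_mono norm_blinfun norm_ge_zero)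
  also have "\<dots> = (norm L * norm n) * norm (adjoint L n)" by (simp only: mult_ac)
  finally show ?thesis using False by simp
qed simp

context kkt_problem
begin

lemma normal_mapping_iff:
  "(x, z) \<in> set_inverse (normal_mapping f G K) (a, b) \<longleftrightarrow> (x, z - G x + b) \<in> S_KKT f G K (a, - b)"
proof -
  have "G x - closest_point K z = b \<longleftrightarrow> closest_point K z = G x - b" by auto
  also have "\<dots> \<longleftrightarrow> z - (G x - b) \<in> normal_cone K (G x - b)"
    by (rule closest_point_eq_iff_normal_cone[OF K_closed K_convex K_ne])
  finally have *: "G x - closest_point K z = b \<longleftrightarrow> z - G x + b \<in> normal_cone K (G x - b)"
    by (simp add: algebra_simps)
  show ?thesis
  proof (cases "G x - closest_point K z = b")
    case True
    then have zc: "z - closest_point K z = z - G x + b" by (simp add: algebra_simps)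
    show ?thesis
      using True * by (auto simp: set_inverse_def normal_mapping_def KKT_iff grad_L_gradient fderiv_G zc)
  next
    case False
    then show ?thesis using * by (simp add: set_inverse_def normal_mapping_def KKT_iff)
  qed
qed

lemma natural_mapping_iff:
  "(x, y) \<in> set_inverse (natural_mapping f G K) (a, b) \<longleftrightarrow> (x, y + b) \<in> S_KKT f G K (a + adjoint (G' x) b, - b)"
proof -
  have "G x - closest_point K (G x + y) = b \<longleftrightarrow> closest_point K (G x + y) = G x - b" by auto
  also have "\<dots> \<longleftrightarrow> G x + y - (G x - b) \<in> normal_cone K (G x - b)"
    by (rule closest_point_eq_iff_normal_cone[OF K_closed K_convex K_ne])
  finally have *: "G x - closest_point K (G x + y) = b \<longleftrightarrow> y + b \<in> normal_cone K (G x - b)" by simp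
  have "gradient f x + adjoint (fderiv G x) y = a \<longleftrightarrow> a + adjoint (G' x) b = grad_L f G x (y + b)"
    unfolding grad_L_gradient fderiv_G adjoint_add by (auto simp: add.assoc[symmetric])
  then show ?thesis using * by (simp add: set_inverse_def natural_mapping_def KKT_iff)
qed

lemma Aubin_normal_mapping_iff:
  "Aubin_property (set_inverse (normal_mapping f G K)) (0, 0) (xb, G xb + yb) \<longleftrightarrow>
   Aubin_property (S_KKT f G K) (0, 0) (xb, yb)"
proof
  have cG: "isCont G xb" using has_derivative_continuous[OF C2_bderiv(1)[OF G]] .
  obtain L r where L: "L > 0" "r > 0" "\<And>x z. dist x xb < r \<Longrightarrow> dist z xb < r \<Longrightarrow> norm (G x - G z) \<le> L * norm (x - z)"
    using locally_Lipschitz_if_C1[OF C2_bderiv(1)[OF G] C2_bderiv(4)[OF G]] by metis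
  { assume "Aubin_property (S_KKT f G K) (0, 0) (xb, yb)"
    from Aubin_property_shear[OF normal_mapping_iff cG L this]
    show "Aubin_property (set_inverse (normal_mapping f G K)) (0, 0) (xb, G xb + yb)" by (simp add: add.commute) }
  { assume A: "Aubin_property (set_inverse (normal_mapping f G K)) (0, 0) (xb, G xb + yb)"
    have eq: "(x, y) \<in> S_KKT f G K (a, b) \<longleftrightarrow> (x, y - (- G x) + b) \<in> set_inverse (normal_mapping f G K) (a, - b)" for a b x y
      by (simp add: normal_mapping_iff)
    have "Aubin_property (S_KKT f G K) (0, 0) (xb, (G xb + yb) + - G xb)"
    proof (rule Aubin_property_shear[OF eq _ L(1,2) _ A])
      show "isCont (\<lambda>x. - G x) xb" by (intro continuous_intros cG)
      show "norm (- G x - - G z) \<le> L * norm (x - z)" if "dist x xb < r" "dist z xb < r" for x z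
        using L(3)[OF that] by (simp add: norm_minus_commute)
    qed
    then show "Aubin_property (S_KKT f G K) (0, 0) (xb, yb)" by simp }
qed

lemma isolated_calm_natural_mapping_iff:
  "isolated_calm (set_inverse (natural_mapping f G K)) (0, 0) (xb, yb) \<longleftrightarrow>
   isolated_calm (S_KKT f G K) (0, 0) (xb, yb)"
proof -
  have "isCont (\<lambda>x. norm (G' x)) xb" by (intro continuous_intros C2_bderiv(4)[OF G])
  then obtain r where r: "r > 0" "\<And>x. dist x xb < r \<Longrightarrow> dist (norm (G' x)) (norm B) < 1"
    unfolding continuous_at_eps_delta by (metis zero_less_one)
  define M where "M = norm B + 1"
  have M: "M > 0" by (simp add: M_def add_nonneg_pos)
  have bound: "norm (adjoint (G' x) b) \<le> M * norm b" if "dist x xb < r" for x b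
  proof -
    have "norm (G' x) \<le> M" using r(2)[OF that] by (simp add: M_def dist_real_def abs_less_iff)
    then have "norm (G' x) * norm b \<le> M * norm b" by (intro mult_right_mono) simp_all
    then show ?thesis using norm_adjoint_le[of "G' x" b] by linarith
  qed
  have z0: "adjoint B 0 = 0" by (rule linear_0[OF linear_adjoint])
  show ?thesis
  proof
    assume c: "isolated_calm (S_KKT f G K) (0, 0) (xb, yb)"
    show "isolated_calm (set_inverse (natural_mapping f G K)) (0, 0) (xb, yb)"
      by (rule isolated_calm_shear[OF natural_mapping_iff M r(1) bound z0 c])
  next
    assume c: "isolated_calm (set_inverse (natural_mapping f G K)) (0, 0) (xb, yb)"
    have eq: "(x, y) \<in> S_KKT f G K (a, b) \<longleftrightarrow> (x, y + b) \<in> set_inverse (natural_mapping f G K) (a + adjoint (G' x) b, - b)" for a b x y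
      using linear_neg[OF linear_adjoint, of "G' x" b] by (simp add: natural_mapping_iff)
    show "isolated_calm (S_KKT f G K) (0, 0) (xb, yb)"
      by (rule isolated_calm_shear[OF eq M r(1) bound z0 c])
  qed
qed

end

section \<open>Strong regularity\<close>

context kkt_problem
begin

text \<open>The error is measured so that the KKT system at \<open>q\<close> becomes the linearised system with the
parameter increased by \<open>lin_error q\<close>.\<close>

definition lin_error :: "'x \<times> 'y \<Rightarrow> 'x \<times> 'y" where
  "lin_error q = (H (fst q - xb) + adjoint B (snd q - yb) - grad_L f G (fst q) (snd q),
     G (fst q) - G xb - B (fst q - xb))"

lemma linearized_KKT_iff:
  "(x, y) \<in> linearized_KKT f G K xb yb (a, b) \<longleftrightarrow>
     a = H (x - xb) + adjoint B (y - yb) \<and> y \<in> normal_cone K (G xb + B (x - xb) + b)"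
proof -
  let ?S = "subdifferential (\<lambda>v. support_fun v K) y"
  let ?c = "- G xb - B (x - xb)"
  have "b \<in> {?c} + ?S \<longleftrightarrow> G xb + B (x - xb) + b \<in> ?S"
  proof
    assume "b \<in> {?c} + ?S"
    then obtain s where "s \<in> ?S" "b = ?c + s" by (auto simp: set_plus_def)
    then show "G xb + B (x - xb) + b \<in> ?S" by simp
  next
    assume "G xb + B (x - xb) + b \<in> ?S"
    from set_plus_intro[OF singletonI this, of ?c]
    show "b \<in> {?c} + ?S" by simp
  qed
  then show ?thesis
    unfolding linearized_KKT_def fderiv_G
    using subdifferential_support_fun_iff[OF K_closed K_convex K_ne, of "G xb + B (x - xb) + b" y]
    by (auto simp: grad_L_0 normal_cone_def)
qed

lemma S_KKT_iff_linearized: "q \<in> S_KKT f G K p \<longleftrightarrow> q \<in> linearized_KKT f G K xb yb (p + lin_error q)"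
proof -
  obtain x y where q: "q = (x, y)" by (cases q)
  obtain a b where p: "p = (a, b)" by (cases p)
  have "p + lin_error q = (a + (H (x - xb) + adjoint B (y - yb) - grad_L f G x y), b + (G x - G xb - B (x - xb)))"
    by (simp add: q p lin_error_def)
  moreover have "G xb + B (x - xb) + (b + (G x - G xb - B (x - xb))) = G x + b" by simp
  moreover have "a + (H (x - xb) + adjoint B (y - yb) - grad_L f G x y) = H (x - xb) + adjoint B (y - yb) \<longleftrightarrow> a = grad_L f G x y"
    by (auto simp: algebra_simps)
  ultimately show ?thesis unfolding q p by (simp only: linearized_KKT_iff KKT_iff)
qed

text \<open>The error is the difference of a map with continuous derivative and its linearisation at
\<open>(xb, yb)\<close>. In the first component the gradient at \<open>yb\<close> and the part linear in the multiplier are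
estimated separately, the latter through the Lipschitz continuity of \<open>G'\<close>.\<close>

lemma lin_error_small_Lipschitz:
  assumes "\<epsilon> > 0"
  obtains \<rho> where "\<rho> > 0" "\<And>q q'. norm (q - (xb, yb)) < \<rho> \<Longrightarrow> norm (q' - (xb, yb)) < \<rho> \<Longrightarrow>
    norm (lin_error q - lin_error q') \<le> \<epsilon> * norm (q - q')"
proof -
  define e where "e = \<epsilon> / 4"
  have e: "e > 0" using assms by (simp add: e_def)
  obtain g'' where g'': "\<And>x. (G' has_derivative blinfun_apply (g'' x)) (at x)" "isCont g'' xb"
  proof -
    obtain h' h'' where h: "\<And>x. (G has_derivative blinfun_apply (h' x)) (at x)"
      "\<And>x. (h' has_derivative blinfun_apply (h'' x)) (at x)" "continuous_on UNIV h''"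
      using C2_on_D[OF G] by (metis UNIV_I)
    have "G' x = h' x" for x
      using frechet_derivative_at[OF h(1)[of x]] by (simp add: bderiv_def blinfun_apply_inverse flip: frechet_derivative_at[OF h(1)[of x]])
    then have "G' = h'" by (rule ext)
    moreover have "isCont h'' xb" using h(3) by (simp add: continuous_on_eq_continuous_at)
    ultimately show ?thesis using that[of h''] h(2) by simp
  qed
  obtain L r1 where L: "L > 0" "r1 > 0"
    "\<And>x z. dist x xb < r1 \<Longrightarrow> dist z xb < r1 \<Longrightarrow> norm (G' x - G' z) \<le> L * norm (x - z)"
    using locally_Lipschitz_if_C1[OF g''] by metis
  have "isCont HL xb" using continuous_HL by (simp add: continuous_on_eq_continuous_at)
  then obtain r2 where r2: "r2 > 0" "\<And>x z. dist x xb < r2 \<Longrightarrow> dist z xb < r2 \<Longrightarrow>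
    norm (grad_L f G x yb - grad_L f G z yb - HL xb (x - z)) \<le> e * norm (x - z)"
    using strictly_differentiable[OF open_UNIV UNIV_I grad_L_deriv _ e, of xb] by metis
  obtain r3 where r3: "r3 > 0" "\<And>x z. dist x xb < r3 \<Longrightarrow> dist z xb < r3 \<Longrightarrow>
    norm (G x - G z - B (x - z)) \<le> e * norm (x - z)"
    using strictly_differentiable[OF open_UNIV UNIV_I C2_bderiv(1)[OF G] C2_bderiv(4)[OF G, of xb] e] by metis
  define \<rho> where "\<rho> = min (min r1 r2) (min r3 (e / L))"
  have \<rho>0: "\<rho> > 0" using L(1,2) r2(1) r3(1) e by (simp add: \<rho>_def)
  have \<rho>: "\<rho> \<le> r1" "\<rho> \<le> r2" "\<rho> \<le> r3" "\<rho> \<le> e / L"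
    by (simp_all only: \<rho>_def min_le_iff_disj order_refl simp_thms)
  have "L * \<rho> \<le> L * (e / L)" using \<rho>(4) L(1) by (intro mult_left_mono) simp_all
  then have L\<rho>: "L * \<rho> \<le> e" using L(1) by simp
  have "norm (lin_error q - lin_error q') \<le> \<epsilon> * norm (q - q')"
    if q: "norm (q - (xb, yb)) < \<rho>" "norm (q' - (xb, yb)) < \<rho>" for q q'
  proof -
    obtain x y where xy: "q = (x, y)" by (cases q)
    obtain x' y' where xy': "q' = (x', y')" by (cases q')
    define N where "N = norm (q - q')"
    have N: "norm (x - x') \<le> N" "norm (y - y') \<le> N"
      using norm_fst_le[of "x - x'" "y - y'"] norm_snd_le[of "y - y'" "x - x'"] by (simp_all add: N_def xy xy')
    have nx: "norm (x - xb) < \<rho>" "norm (x' - xb) < \<rho>" "norm (y' - yb) < \<rho>"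
      using q norm_fst_le[of "x - xb" "y - yb"] norm_fst_le[of "x' - xb" "y' - yb"] norm_snd_le[of "y' - yb" "x' - xb"]
      by (simp_all add: xy xy')
    then have dx: "dist x xb < \<rho>" "dist x' xb < \<rho>" by (simp_all add: dist_norm)
    have dx1: "dist x xb < r1" "dist x' xb < r1" "dist x xb < r2" "dist x' xb < r2" "dist x xb < r3" "dist x' xb < r3"
      using dx \<rho> by linarith+
    have eN: "e * norm (x - x') \<le> e * N" "e * norm (y - y') \<le> e * N"
      using N e by (simp_all add: mult_left_mono)
    define t1 where "t1 = grad_L f G x yb - grad_L f G x' yb - H (x - x')"
    define t2 where "t2 = adjoint (G' x - B) (y - y')"
    define t3 where "t3 = adjoint (G' x - G' x') (y' - yb)"
    have t1: "norm t1 \<le> e * N" using r2(2)[OF dx1(3,4)] eN(1) unfolding t1_def HL_xb by linarith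
    have "L * norm (x - xb) \<le> L * \<rho>" using nx(1) L(1) by (intro mult_left_mono) simp_all
    then have GB: "norm (G' x - B) \<le> e" using L(3)[OF dx1(1), of xb] L(2) L\<rho> by simp
    have "norm t2 \<le> norm (G' x - B) * norm (y - y')" unfolding t2_def by (rule norm_adjoint_le)
    also have "\<dots> \<le> e * norm (y - y')" using GB by (intro mult_right_mono) simp_all
    finally have t2: "norm t2 \<le> e * N" using eN(2) by linarith
    have "norm t3 \<le> norm (G' x - G' x') * norm (y' - yb)" unfolding t3_def by (rule norm_adjoint_le)
    also have "\<dots> \<le> (L * norm (x - x')) * \<rho>" using L(1) L(3)[OF dx1(1,2)] nx(3) by (intro mult_mono) simp_all
    also have "\<dots> = (L * \<rho>) * norm (x - x')" by (simp only: mult_ac)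
    also have "\<dots> \<le> e * norm (x - x')" using L\<rho> by (intro mult_right_mono) simp_all
    finally have t3: "norm t3 \<le> e * N" using eN(1) by linarith
    have G4: "norm (G x - G x' - B (x - x')) \<le> e * N" using r3(2)[OF dx1(5,6)] eN(1) by linarith
    have "fst (lin_error q - lin_error q') \<bullet> v = - (t1 + t2 + t3) \<bullet> v" for v
      by (simp add: lin_error_def xy xy' t1_def t2_def t3_def grad_L_split[of x y] grad_L_split[of x' y']
          linear_diff[OF linear_H] adjoint_blinfun blinfun.diff_left inner_diff_left inner_add_left inner_diff_right algebra_simps)
    then have f: "fst (lin_error q - lin_error q') = - (t1 + t2 + t3)" using vector_eq_rdot by blast
    have "norm (fst (lin_error q - lin_error q')) \<le> norm t1 + norm t2 + norm t3"
      unfolding f norm_minus_cancel by (rule order_trans[OF norm_triangle_ineq add_right_mono[OF norm_triangle_ineq]])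
    moreover have "snd (lin_error q - lin_error q') = G x - G x' - B (x - x')"
      by (simp add: lin_error_def xy xy' blinfun.diff_right)
    moreover have "norm (lin_error q - lin_error q') \<le> norm (fst (lin_error q - lin_error q')) + norm (snd (lin_error q - lin_error q'))"
      by (metis norm_Pair_le prod.collapse)
    ultimately have "norm (lin_error q - lin_error q') \<le> 4 * (e * N)" using t1 t2 t3 G4 by simp
    then show ?thesis by (simp add: e_def N_def)
  qed
  then show ?thesis using that[OF \<rho>0] by blast
qed

text \<open>Let \<open>s\<close> be the Lipschitz solution map of the linearised system. The KKT points for the parameter \<open>p\<close>
near \<open>(xb, yb)\<close> are the fixed points of \<open>q \<mapsto> s (p + lin_error q)\<close>. This map is a contraction with
factor \<open>1/2\<close>, since the error has a small Lipschitz constant, so fixed points exist for all small \<open>p\<close>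
and depend on \<open>p\<close> with Lipschitz constant \<open>2 C\<close>.\<close>

lemma strongly_regular_imp_Aubin:
  assumes "strongly_regular f G K xb yb"
  shows "Aubin_property (S_KKT f G K) (0, 0) (xb, yb)"
proof -
  let ?q = "(xb, yb)"
  have q0: "?q \<in> S_KKT f G K (0, 0)" using assms by (simp add: strongly_regular_def)
  from assms[unfolded strongly_regular_def, THEN conjunct2]
  obtain U V s C where reg: "(0, 0) \<in> interior U \<and> ?q \<in> interior V \<and>
      (\<forall>\<delta>\<in>U. linearized_KKT f G K xb yb \<delta> \<inter> V = {s \<delta>}) \<and> C-lipschitz_on U s"
    by (elim exE) (rule that)
  have U: "(0, 0) \<in> interior U" and V: "?q \<in> interior V" and lip: "C-lipschitz_on U s"
    using reg by simp_all
  have sol: "linearized_KKT f G K xb yb \<delta> \<inter> V = {s \<delta>}" if "\<delta> \<in> U" for \<delta>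
    using reg that by simp
  have C: "C \<ge> 0" using lip by (rule lipschitz_on_nonneg)
  obtain u where u: "u > 0" "ball (0, 0) u \<subseteq> U" using U unfolding mem_interior by blast
  obtain v where v: "v > 0" "ball ?q v \<subseteq> V" using V unfolding mem_interior by blast
  have inU: "\<delta> \<in> U" if "norm \<delta> < u" for \<delta> using u(2) that by (auto simp: zero_prod_def[symmetric])
  have inV: "q \<in> V" if "norm (q - ?q) < v" for q
  proof -
    have "q \<in> ball ?q v" using that by (metis mem_ball dist_commute dist_norm)
    then show ?thesis using v(2) by blast
  qed
  \<comment> \<open>The summand \<open>1\<close> covers \<open>C = 0\<close>.\<close>
  define \<epsilon> where "\<epsilon> = 1 / (2 * (C + 1))"
  have \<epsilon>: "\<epsilon> > 0" "C * \<epsilon> \<le> 1 / 2" "\<epsilon> \<le> 1 / 2" using C by (simp_all add: \<epsilon>_def field_simps)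
  obtain \<rho> where \<rho>: "\<rho> > 0" "\<And>q q'. norm (q - ?q) < \<rho> \<Longrightarrow> norm (q' - ?q) < \<rho> \<Longrightarrow>
    norm (lin_error q - lin_error q') \<le> \<epsilon> * norm (q - q')"
    using lin_error_small_Lipschitz[OF \<epsilon>(1)] by metis
  have e0: "lin_error ?q = 0"
    by (simp add: lin_error_def linear_0[OF linear_H] linear_0[OF linear_adjoint] grad_L_0 zero_prod_def blinfun.zero_right)
  have U0: "0 \<in> U" using inU[of 0] u(1) by simp
  have s0: "s 0 = ?q"
  proof -
    have "?q \<in> linearized_KKT f G K xb yb 0"
      using q0 unfolding S_KKT_iff_linearized e0 by (simp add: zero_prod_def)
    moreover have "?q \<in> V" using inV[of ?q] v(1) by simp
    ultimately have "?q \<in> linearized_KKT f G K xb yb 0 \<inter> V" by (rule IntI)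
    then show ?thesis unfolding sol[OF U0] by simp
  qed
  define R where "R = min (min (\<rho> / 2) (v / 2)) (u / 2)"
  have R: "R > 0" "R < \<rho>" "R < v" "R \<le> u / 2" using \<rho>(1) u(1) v(1) by (auto simp: R_def min_def)
  \<comment> \<open>With \<open>C P\<close> and \<open>C \<epsilon> R\<close> both at most \<open>R / 2\<close>, the iteration maps the ball of radius \<open>R\<close> to itself.\<close>
  define P where "P = min (u / 2) (R / (2 * (C + 1)))"
  have P0: "P > 0" using u(1) R(1) C by (simp add: P_def)
  have P1: "P \<le> u / 2" "P \<le> R / (2 * (C + 1))" by (simp_all only: P_def min_le_iff_disj order_refl simp_thms)
  have CP: "C * P \<le> R / 2"
  proof -
    have "(C + 1) * P \<le> (C + 1) * (R / (2 * (C + 1)))" using P1(2) C by (intro mult_left_mono) simp_all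
    also have "\<dots> = R / 2"
    proof -
      have "D * (R / (2 * D)) = R / 2" if "D > 0" for D :: real using that by simp
      from this[of "C + 1"] show ?thesis using C by simp
    qed
    finally have "C * P + P \<le> R / 2" by (simp add: distrib_right)
    then show ?thesis using P0 by linarith
  qed
  have eb: "norm (lin_error q) \<le> \<epsilon> * norm (q - ?q)" if "norm (q - ?q) \<le> R" for q
    using \<rho>(2)[of q ?q] that R(2) \<rho>(1) e0 by simp
  have \<delta>U: "p + lin_error q \<in> U" "norm (p + lin_error q) \<le> P + \<epsilon> * R" if "norm p < P" "norm (q - ?q) \<le> R" for p q
  proof -
    have "\<epsilon> * norm (q - ?q) \<le> \<epsilon> * R" using that(2) \<epsilon>(1) by (intro mult_left_mono) simp_all
    then have n: "norm (p + lin_error q) < P + \<epsilon> * R"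
      using norm_triangle_ineq[of p "lin_error q"] eb[OF that(2)] that(1) by linarith
    then show "norm (p + lin_error q) \<le> P + \<epsilon> * R" by simp
    have "\<epsilon> * R \<le> (1 / 2) * R" using \<epsilon>(3) R(1) by (intro mult_right_mono) simp_all
    then have "P + \<epsilon> * R \<le> u" using P1(1) R(4) u(1) by linarith
    then show "p + lin_error q \<in> U" using n by (intro inU) linarith
  qed
  have slip: "norm (s \<delta> - s \<delta>') \<le> C * norm (\<delta> - \<delta>')" if "\<delta> \<in> U" "\<delta>' \<in> U" for \<delta> \<delta>'
    using lipschitz_onD[OF lip that] by (simp only: dist_norm)
  have ex: "\<exists>q. norm (q - ?q) \<le> R \<and> s (p + lin_error q) = q" if p: "norm p < P" for p
  proof -
    have "\<exists>!q\<in>cball ?q R. (\<lambda>q. s (p + lin_error q)) q = q"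
    proof (rule Banach_fix[where c = "1 / 2"])
      show "complete (cball ?q R)" by (simp add: complete_eq_closed)
      show "cball ?q R \<noteq> {}" using R(1) by simp
      have nb: "norm (q - ?q) \<le> R" if "q \<in> cball ?q R" for q using that by (metis mem_cball dist_commute dist_norm)
      show "(\<lambda>q. s (p + lin_error q)) ` cball ?q R \<subseteq> cball ?q R"
      proof (rule image_subsetI)
        fix q assume "q \<in> cball ?q R"
        note q = nb[OF this]
        have "norm (s (p + lin_error q) - ?q) \<le> C * norm (p + lin_error q)"
          using slip[OF \<delta>U(1)[OF p q] U0] by (simp add: s0)
        also have "\<dots> \<le> C * (P + \<epsilon> * R)" using \<delta>U(2)[OF p q] C by (intro mult_left_mono)
        also have "\<dots> = C * P + (C * \<epsilon>) * R" by (simp add: algebra_simps)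
        also have "\<dots> \<le> R / 2 + (1 / 2) * R" using CP \<epsilon>(2) R(1) by (intro add_mono mult_right_mono) simp_all
        finally have "norm (s (p + lin_error q) - ?q) \<le> R" by simp
        then show "s (p + lin_error q) \<in> cball ?q R" by (metis mem_cball dist_commute dist_norm)
      qed
      fix q q' assume "q \<in> cball ?q R" "q' \<in> cball ?q R"
      note q = nb[OF this(1)] nb[OF this(2)]
      have "norm (s (p + lin_error q) - s (p + lin_error q')) \<le> C * norm (lin_error q - lin_error q')"
        using slip[OF \<delta>U(1)[OF p q(1)] \<delta>U(1)[OF p q(2)]] by simp
      also have "\<dots> \<le> C * (\<epsilon> * norm (q - q'))" using \<rho>(2)[of q q'] q R(2) C by (intro mult_left_mono) simp_all
      also have "\<dots> \<le> (1 / 2) * norm (q - q')" using \<epsilon>(2) by (simp only: mult.assoc[symmetric]) (intro mult_right_mono, simp_all)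
      finally show "dist (s (p + lin_error q)) (s (p + lin_error q')) \<le> (1 / 2) * dist q q'" by (simp only: dist_norm)
    qed simp_all
    then obtain q where "q \<in> cball ?q R" "s (p + lin_error q) = q" by blast
    then show ?thesis by (metis mem_cball dist_commute dist_norm)
  qed
  have "S_KKT f G K p \<inter> ball ?q R \<subseteq> S_KKT f G K p' + cball 0 ((2 * C + 1) * norm (p - p'))"
    if pp: "p \<in> ball (0, 0) P" "p' \<in> ball (0, 0) P" for p p'
  proof
    fix q assume q: "q \<in> S_KKT f G K p \<inter> ball ?q R"
    have np: "norm p < P" "norm p' < P" using pp by (simp_all add: zero_prod_def[symmetric])
    have "dist ?q q < R" using q by simp
    then have nq: "norm (q - ?q) < R" by (metis dist_commute dist_norm)
    then have nqR: "norm (q - ?q) \<le> R" by simp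
    have "q \<in> linearized_KKT f G K xb yb (p + lin_error q)" using q by (simp add: S_KKT_iff_linearized)
    moreover have "q \<in> V" using nq R(3) by (intro inV) linarith
    ultimately have "q \<in> linearized_KKT f G K xb yb (p + lin_error q) \<inter> V" by (rule IntI)
    then have qs: "q = s (p + lin_error q)" unfolding sol[OF \<delta>U(1)[OF np(1) nqR]] by simp
    obtain q' where q': "norm (q' - ?q) \<le> R" "s (p' + lin_error q') = q'" using ex[OF np(2)] by blast
    have "q' \<in> linearized_KKT f G K xb yb (p' + lin_error q') \<inter> V"
      unfolding sol[OF \<delta>U(1)[OF np(2) q'(1)]] q'(2) by simp
    then have q'S: "q' \<in> S_KKT f G K p'" by (simp add: S_KKT_iff_linearized)
    have "norm (q - q') \<le> C * norm ((p + lin_error q) - (p' + lin_error q'))"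
      using slip[OF \<delta>U(1)[OF np(1) nqR] \<delta>U(1)[OF np(2) q'(1)]] qs q'(2) by simp
    also have "\<dots> \<le> C * (norm (p - p') + \<epsilon> * norm (q - q'))"
    proof (intro mult_left_mono C)
      have eq: "(p + lin_error q) - (p' + lin_error q') = (p - p') + (lin_error q - lin_error q')" by simp
      show "norm ((p + lin_error q) - (p' + lin_error q')) \<le> norm (p - p') + \<epsilon> * norm (q - q')"
        unfolding eq
        using norm_triangle_ineq[of "p - p'" "lin_error q - lin_error q'"] \<rho>(2)[of q q'] nq q'(1) R(2) by linarith
    qed
    also have "\<dots> = C * norm (p - p') + (C * \<epsilon>) * norm (q - q')" by (simp add: algebra_simps)
    also have "\<dots> \<le> C * norm (p - p') + (1 / 2) * norm (q - q')" using \<epsilon>(2) by (intro add_left_mono mult_right_mono) simp_all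
    finally have "norm (q - q') \<le> 2 * (C * norm (p - p'))" by simp
    also have "\<dots> \<le> (2 * C + 1) * norm (p - p')" by (simp add: distrib_right)
    finally show "q \<in> S_KKT f G K p' + cball 0 ((2 * C + 1) * norm (p - p'))"
      unfolding mem_plus_cball using q'S by blast
  qed
  moreover have "2 * C + 1 > 0" using C by simp
  ultimately show ?thesis
    unfolding Aubin_property_def using q0 P0 R(1)
    by (intro conjI exI[of _ "2 * C + 1"] exI[of _ "ball (0, 0) P"] exI[of _ "ball ?q R"]) auto
qed

end

section \<open>The implications between the stability properties\<close>

theorem corollary25:
  fixes f :: "'x::euclidean_space \<Rightarrow> real"
    and G :: "'x \<Rightarrow> 'y::euclidean_space"
    and K :: "'y set"
    and xbar :: 'x and ybar zbar :: 'y
  assumes "C2_on UNIV f" and "C2_on UNIV G"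
    and "K \<noteq> {}" and "closed K" and "convex K"
    and "C2_cone_reducible K"
    and "locally_optimal f G K 0 0 xbar"
    and "RCQ G K xbar"
    and "ybar \<in> multipliers f G K xbar 0 0"
    and "zbar = G xbar + ybar"
  defines "st_i \<equiv> strongly_regular f G K xbar ybar"
    and "st_ii \<equiv> Aubin_property (set_inverse (normal_mapping f G K)) (0, 0) (xbar, zbar)"
    and "st_iii \<equiv> Aubin_property (S_KKT f G K) (0, 0) (xbar, ybar)"
    and "st_iv \<equiv> constraint_nondegenerate G K xbar \<and> SOSC f G K xbar"
    and "st_v \<equiv> SRCQ G K xbar ybar \<and> SOSC f G K xbar"
    and "st_vi \<equiv> robustly_isolated_calm (S_KKT f G K) (0, 0) (xbar, ybar)"
    and "st_vii \<equiv> isolated_calm (set_inverse (natural_mapping f G K)) (0, 0) (xbar, ybar)"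
  shows "(st_i \<longrightarrow> st_ii) \<and> (st_ii \<longleftrightarrow> st_iii) \<and> (st_iii \<longrightarrow> st_iv) \<and>
         (st_iv \<longrightarrow> st_v) \<and> (st_v \<longleftrightarrow> st_vi) \<and> (st_vi \<longleftrightarrow> st_vii)"
proof -
  interpret kkt_problem f G K xbar ybar
    using assms(1,2,4,5,9) by (unfold_locales)
  have "cone_reducible_at K (G xbar)"
    using assms(6) feasible_xb by (simp add: C2_cone_reducible_def)
  then obtain Q W V \<Phi> \<Psi> \<Phi>' \<Phi>'' where chart: "cone_chart K Q W V (G xbar) \<Phi> \<Psi> \<Phi>' \<Phi>''"
    using cone_reducible_at_chart[OF assms(4,5) feasible_xb] by blast
  interpret cone_chart K Q W V "G xbar" \<Phi> \<Psi> \<Phi>' \<Phi>'' by (rule chart)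
  interpret kkt_chart f G K xbar ybar Q W V \<Phi> \<Psi> \<Phi>' \<Phi>''
    by unfold_locales (rule yb_normal)
  have "st_i \<longrightarrow> st_iii"
    unfolding st_i_def st_iii_def using strongly_regular_imp_Aubin by blast
  moreover have "st_ii \<longleftrightarrow> st_iii"
    unfolding st_ii_def st_iii_def assms(10) by (rule Aubin_normal_mapping_iff)
  moreover have "st_iii \<longrightarrow> st_iv"
    unfolding st_iii_def st_iv_def using Aubin_imp_nondegenerate_SOSC[OF _ assms(7)] by blast
  moreover have "st_iv \<longrightarrow> st_v"
    unfolding st_iv_def st_v_def using nondegenerate_imp_SRCQ by blast
  moreover have "st_v \<longleftrightarrow> st_vi"
    unfolding st_v_def st_vi_def using robustly_isolated_calm_iff(1)[OF assms(7)] by blast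
  moreover have "st_v \<longleftrightarrow> st_vii"
    unfolding st_v_def st_vii_def isolated_calm_natural_mapping_iff
    using robustly_isolated_calm_iff(2)[OF assms(7)] by blast
  ultimately show ?thesis by blast
qed

end
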